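(* Let $M$ be a compact smooth manifold, let $\mathcal G$ be a subgroup of the diffeomorphism group $\mathrm{Diff}^\infty(M)$, and let $\mathcal S\subset\mathfrak X^\infty(M)$ be a subset all of whose elements are tangent to $\mathcal G$. Then every element of the Lie subalgebra $\langle\mathcal S\rangle_{\mathrm{Lie}}$ of $\mathfrak X^\infty(M)$ generated by $\mathcal S$ is tangent to $\mathcal G$; that is, $$\mathcal S\subset\mathcal T_o\mathcal G\quad\Longrightarrow\quad\langle\mathcal S\rangle_{\mathrm{Lie}}\subset\mathcal T_o\mathcal G .$$
   Context: $\mathrm{Diff}^\infty(M)$ is the group of $C^\infty$ diffeomorphisms of $M$, regarded as an infinite-dimensional (Fréchet) Lie group; a curve $t\mapsto\varphi_t$ in it is $C^\infty$-smooth with respect to this structure (for compact $M$, equivalently $(t,p)\mapsto\varphi_t(p)$ is smooth). $\mathfrak X^\infty(M)$ is the Lie algebra of $C^\infty$ vector fields on $M$ with the usual bracket. For an integer $k\ge 1$, a smooth curve $c\colon I\to M$ ($I\subset\mathbb R$ an interval containing $0$) with $c(0)=p$ is a $k$-th order integral curve of $v\in T_pM$ if all its derivatives of orders $1,\dots,k-1$ vanish at $t=0$ and its $k$-th derivative at $0$ (which is then a well-defined tangent vector at $p$) equals $v$. A $C^\infty$-smooth curve $\varphi\colon I\to\mathrm{Diff}^\infty(M)$, $t\mapsto\varphi_t$, is an integral curve of $X\in\mathfrak X^\infty(M)$ if $\varphi_0=\mathrm{id}_M$ and there is an integer $k\ge1$ such that for every $p\in M$ the curve $t\mapsto\varphi_t(p)$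 is a $k$-th order integral curve of $X(p)$. $X\in\mathfrak X^\infty(M)$ is tangent to a subgroup $\mathcal G\subset\mathrm{Diff}^\infty(M)$ if there is an integral curve $\varphi_t$ of $X$ with $\varphi_t\in\mathcal G$ for all $t\in I$. The set of vector fields tangent to $\mathcal G$ is denoted $\mathcal T_o\mathcal G$. *)

theory Defs
  imports "HOL-Analysis.Analysis" "HOL-Algebra.Group"
begin

section \<open>Smooth maps between normed spaces\<close>

text \<open>Derivatives are taken within the domain, so that one-sided derivatives at the endpoints of a
  time interval are covered. Below, the domain is always relatively open in an open set, in a
  nondegenerate interval, or in a product of the two; there the derivative within the domain is
  unique.\<close>

primrec Ck_on :: "nat \<Rightarrow> 'b set \<Rightarrow> ('b::real_normed_vector \<Rightarrow> 'c::real_normed_vector) \<Rightarrow> bool" where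
  "Ck_on 0 S f \<longleftrightarrow> continuous_on S f"
| "Ck_on (Suc k) S f \<longleftrightarrow>
     (\<exists>f'. (\<forall>x\<in>S. (f has_derivative f' x) (at x within S)) \<and> (\<forall>v. Ck_on k S (\<lambda>x. f' x v)))"

definition smooth_on :: "'b set \<Rightarrow> ('b::real_normed_vector \<Rightarrow> 'c::real_normed_vector) \<Rightarrow> bool" where
  "smooth_on S f \<longleftrightarrow> (\<forall>k. Ck_on k S f)"

primrec higher_vector_derivative ::
    "nat \<Rightarrow> (real \<Rightarrow> 'b::real_normed_vector) \<Rightarrow> real set \<Rightarrow> real \<Rightarrow> 'b" where
  "higher_vector_derivative 0 f J = f"
| "higher_vector_derivative (Suc k) f J =
     (\<lambda>t. vector_derivative (higher_vector_derivative k f J) (at t within J))"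

section \<open>Smooth manifolds\<close>

text \<open>The points of the manifold are the elements of the type \<open>'a\<close>, with its type class topology;
  the charts take values in \<open>'e\<close>, so the dimension of the manifold is \<open>DIM('e)\<close>. The coordinate map
  of a chart is a total function, but only its values on the chart domain matter.\<close>

datatype ('a, 'e) chart = Chart (chart_dom: "'a set") (coord: "'a \<Rightarrow> 'e")

definition chart_inv :: "('a, 'e) chart \<Rightarrow> 'e \<Rightarrow> 'a" where
  "chart_inv c = inv_into (chart_dom c) (coord c)"

definition is_chart :: "('a::topological_space, 'e::euclidean_space) chart \<Rightarrow> bool" where
  "is_chart c \<longleftrightarrow> open (chart_dom c) \<and> open (coord c ` chart_dom c) \<and>
     homeomorphism (chart_dom c) (coord c ` chart_dom c) (coord c) (chart_inv c)"

definition smooth_atlas ::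
    "('a::{t2_space, second_countable_topology}, 'e::euclidean_space) chart set \<Rightarrow> bool" where
  "smooth_atlas A \<longleftrightarrow> (\<forall>c\<in>A. is_chart c) \<and> (\<Union>c\<in>A. chart_dom c) = UNIV \<and>
     (\<forall>c\<in>A. \<forall>d\<in>A. smooth_on (coord c ` (chart_dom c \<inter> chart_dom d)) (coord d \<circ> chart_inv c))"

section \<open>The diffeomorphism group\<close>

definition smooth_map :: "('a::topological_space, 'e::euclidean_space) chart set \<Rightarrow> ('a \<Rightarrow> 'a) \<Rightarrow> bool"
  where "smooth_map A f \<longleftrightarrow> continuous_on UNIV f \<and>
     (\<forall>c\<in>A. \<forall>d\<in>A. smooth_on (coord c ` (chart_dom c \<inter> f -` chart_dom d))
        (coord d \<circ> f \<circ> chart_inv c))"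

definition diffeos :: "('a::topological_space, 'e::euclidean_space) chart set \<Rightarrow> ('a \<Rightarrow> 'a) set" where
  "diffeos A = {f. bij f \<and> smooth_map A f \<and> smooth_map A (inv_into UNIV f)}"

definition Diff_group :: "('a::topological_space, 'e::euclidean_space) chart set \<Rightarrow> ('a \<Rightarrow> 'a) monoid"
  where "Diff_group A = \<lparr>carrier = diffeos A, mult = (\<circ>), one = id\<rparr>"

text \<open>A curve in the diffeomorphism group of a compact manifold is smooth for the Frechet Lie group
  structure iff \<open>(t, p) \<mapsto> \<phi> t p\<close> is smooth; the latter is taken as the definition.\<close>

definition smooth_diffeo_curve ::
    "('a::topological_space, 'e::euclidean_space) chart set \<Rightarrow> real set \<Rightarrow> (real \<Rightarrow> 'a \<Rightarrow> 'a) \<Rightarrow> bool" where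
  "smooth_diffeo_curve A I \<phi> \<longleftrightarrow>
     (\<forall>t\<in>I. \<phi> t \<in> diffeos A) \<and>
     continuous_on (I \<times> UNIV) (\<lambda>(t, p). \<phi> t p) \<and>
     (\<forall>c\<in>A. \<forall>d\<in>A. smooth_on
        {(t, x). t \<in> I \<and> x \<in> coord c ` chart_dom c \<and> \<phi> t (chart_inv c x) \<in> chart_dom d}
        (\<lambda>(t, x). coord d (\<phi> t (chart_inv c x))))"

section \<open>Tangent vectors and vector fields\<close>

text \<open>A tangent vector at \<open>p\<close> is the family of its coordinate representations in the charts around
  \<open>p\<close>, related by the derivatives of the chart transitions. Components at indices that are not charts
  around \<open>p\<close> are set to \<open>0\<close>, so that a tangent vector is determined by its coordinates.\<close>

definition tangent_space ::
    "('a, 'e::euclidean_space) chart set \<Rightarrow> 'a \<Rightarrow> (('a, 'e) chart \<Rightarrow> 'e) set" where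
  "tangent_space A p = {v.
     (\<forall>c. c \<notin> A \<or> p \<notin> chart_dom c \<longrightarrow> v c = 0) \<and>
     (\<forall>c\<in>A. \<forall>d\<in>A. p \<in> chart_dom c \<inter> chart_dom d \<longrightarrow>
        v d = frechet_derivative (coord d \<circ> chart_inv c) (at (coord c p)) (v c))}"

type_synonym ('a, 'e) vfield = "'a \<Rightarrow> ('a, 'e) chart \<Rightarrow> 'e"

definition local_rep :: "('a, 'e) chart \<Rightarrow> ('a, 'e) vfield \<Rightarrow> 'e \<Rightarrow> 'e" where
  "local_rep c X = (\<lambda>x. X (chart_inv c x) c)"

definition vector_fields :: "('a, 'e::euclidean_space) chart set \<Rightarrow> ('a, 'e) vfield set" where
  "vector_fields A = {X. (\<forall>p. X p \<in> tangent_space A p) \<and>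
     (\<forall>c\<in>A. smooth_on (coord c ` chart_dom c) (local_rep c X))}"

definition lie_bracket ::
    "('a, 'e::euclidean_space) chart set \<Rightarrow> ('a, 'e) vfield \<Rightarrow> ('a, 'e) vfield \<Rightarrow> ('a, 'e) vfield" where
  "lie_bracket A X Y = (\<lambda>p c.
     if c \<in> A \<and> p \<in> chart_dom c
     then frechet_derivative (local_rep c Y) (at (coord c p)) (X p c)
        - frechet_derivative (local_rep c X) (at (coord c p)) (Y p c)
     else 0)"

definition lie_subalgebra :: "('a, 'e::euclidean_space) chart set \<Rightarrow> ('a, 'e) vfield set \<Rightarrow> bool" where
  "lie_subalgebra A L \<longleftrightarrow> L \<subseteq> vector_fields A \<and>
     (\<lambda>p c. 0) \<in> L \<and>
     (\<forall>X\<in>L. \<forall>Y\<in>L. (\<lambda>p c. X p c + Y p c) \<in> L) \<and>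
     (\<forall>r. \<forall>X\<in>L. (\<lambda>p c. r *\<^sub>R X p c) \<in> L) \<and>
     (\<forall>X\<in>L. \<forall>Y\<in>L. lie_bracket A X Y \<in> L)"

definition lie_generated ::
    "('a, 'e::euclidean_space) chart set \<Rightarrow> ('a, 'e) vfield set \<Rightarrow> ('a, 'e) vfield set" where
  "lie_generated A S = \<Inter>{L. lie_subalgebra A L \<and> S \<subseteq> L}"

section \<open>Integral curves and tangency\<close>

definition smooth_curve ::
    "('a::topological_space, 'e::euclidean_space) chart set \<Rightarrow> real set \<Rightarrow> (real \<Rightarrow> 'a) \<Rightarrow> bool" where
  "smooth_curve A I \<gamma> \<longleftrightarrow> continuous_on I \<gamma> \<and>
     (\<forall>c\<in>A. smooth_on {t\<in>I. \<gamma> t \<in> chart_dom c} (coord c \<circ> \<gamma>))"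

text \<open>The \<open>k\<close>-th derivative of a curve whose lower derivatives vanish at \<open>0\<close> is the tangent vector
  whose component in a chart \<open>c\<close> is the \<open>k\<close>-th derivative of \<open>coord c \<circ> \<gamma>\<close> at \<open>0\<close>.\<close>

definition kth_order_integral_curve ::
    "('a::topological_space, 'e::euclidean_space) chart set \<Rightarrow> nat \<Rightarrow> real set \<Rightarrow> (real \<Rightarrow> 'a) \<Rightarrow>
     'a \<Rightarrow> (('a, 'e) chart \<Rightarrow> 'e) \<Rightarrow> bool" where
  "kth_order_integral_curve A k I \<gamma> p v \<longleftrightarrow>
     smooth_curve A I \<gamma> \<and> \<gamma> 0 = p \<and> v \<in> tangent_space A p \<and>
     (\<forall>c\<in>A. p \<in> chart_dom c \<longrightarrow>
        (\<forall>j\<in>{1..<k}. higher_vector_derivative j (coord c \<circ> \<gamma>) {t\<in>I. \<gamma> t \<in> chart_dom c} 0 = 0) \<and>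
        higher_vector_derivative k (coord c \<circ> \<gamma>) {t\<in>I. \<gamma> t \<in> chart_dom c} 0 = v c)"

text \<open>The degenerate interval \<open>{0}\<close> is excluded, as derivatives at \<open>0\<close> would be meaningless there.\<close>

definition time_interval :: "real set \<Rightarrow> bool" where
  "time_interval I \<longleftrightarrow> is_interval I \<and> 0 \<in> I \<and> I \<noteq> {0}"

definition integral_curve ::
    "('a::topological_space, 'e::euclidean_space) chart set \<Rightarrow> real set \<Rightarrow> (real \<Rightarrow> 'a \<Rightarrow> 'a) \<Rightarrow>
     ('a, 'e) vfield \<Rightarrow> bool" where
  "integral_curve A I \<phi> X \<longleftrightarrow>
     time_interval I \<and> smooth_diffeo_curve A I \<phi> \<and> \<phi> 0 = id \<and>
     (\<exists>k\<ge>1. \<forall>p. kth_order_integral_curve A k I (\<lambda>t. \<phi> t p) p (X p))"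

definition tangent_fields ::
    "('a::topological_space, 'e::euclidean_space) chart set \<Rightarrow> ('a \<Rightarrow> 'a) set \<Rightarrow> ('a, 'e) vfield set" where
  "tangent_fields A G =
     {X \<in> vector_fields A. \<exists>I \<phi>. integral_curve A I \<phi> X \<and> (\<forall>t\<in>I. \<phi> t \<in> G)}"

end

theory Submission
  imports Defs
begin

text \<open>
  In a chart, \<open>\<phi>\<close> is an integral curve of order \<open>k\<close> of a multiple of \<open>X\<close> iff
  \<open>\<phi>\<^sub>t(x) = x + t\<^sup>k X(x) + o(t\<^sup>k)\<close> for a rescaled curve. Substituting \<open>t := a sin\<^sup>2 t\<close> turns a curve on any
  time interval into one on the whole line, of order \<open>2k\<close>. Such curves are closed under the required
  operations: substituting \<open>b t\<close> and inverting give the multiples of \<open>X\<close>; substituting powers of \<open>t\<close>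
  equalises the orders of two curves, whose composition then gives the sum; and the commutator of
  curves of orders \<open>k\<close> and \<open>l\<close> has order \<open>k + l\<close> and leading term the bracket. The last claim needs the
  remainder \<open>\<phi>\<^sub>t(x) - x - t\<^sup>k X(x)\<close> to be \<open>O(t\<^sup>k\<^sup>+\<^sup>1)\<close> together with its derivatives in \<open>x\<close>, which follows from
  the symmetry of mixed partial derivatives. That a bracket is again a vector field comes for free: the
  leading term of a curve in the manifold transforms as a tangent vector.
\<close>

section \<open>Smooth maps\<close>

text \<open>Tangency gives the leading coefficient separately at each point, without uniformity in
  the point, and the time interval may have 0 as an end point. Both shape the proof. On the whole
  line the domains of coordinate representations are open in time and space, so derivatives are
  unique and can be iterated in mixed directions; joint smoothness then turns pointwise flatness in
  t into locally uniform bounds. The new time a sin^2 t stays between 0 and a, hence in any interval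
  containing both, on whichever side of 0 the point a lies. Its order is even, and t^k does not
  change sign for even k, so reversing time cannot produce negative multiples; this is the task of
  inversion in the group. Inversion is the other obstacle: joint smoothness of the inverses in (t,
  x) is not part of the definition of a curve and is derived, from compactness for continuity and
  from the formula for the derivative of an inverse for smoothness. Leading coefficients replace
  k-th derivatives because they enter sums and brackets without factorials; k! is removed at the end
  by rescaling time with a k-th root.\<close>

lemma Ck_on_SucE:
  assumes "Ck_on (Suc k) S f"
  obtains f' where "\<And>x. x\<in>S \<Longrightarrow> (f has_derivative f' x) (at x within S)"
    "\<And>v. Ck_on k S (\<lambda>x. f' x v)"
  using assms by auto

lemma Ck_on_SucI:
  assumes "\<And>x. x\<in>S \<Longrightarrow> (f has_derivative f' x) (at x within S)"
    "\<And>v. Ck_on k S (\<lambda>x. f' x v)"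
  shows "Ck_on (Suc k) S f"
  using assms by auto

lemma Ck_on_cong:
  assumes "Ck_on k S f" "\<And>x. x \<in> S \<Longrightarrow> f x = g x"
  shows "Ck_on k S g"
proof (cases k)
  case 0
  with assms show ?thesis by (metis Ck_on.simps(1) continuous_on_cong)
next
  case (Suc n)
  with assms obtain f' where f': "\<And>x. x\<in>S \<Longrightarrow> (f has_derivative f' x) (at x within S)"
    "\<And>v. Ck_on n S (\<lambda>x. f' x v)" by auto
  have "(g has_derivative f' x) (at x within S)" if "x \<in> S" for x
    using f'(1)[OF that] assms(2) that has_derivative_transform by metis
  with f'(2) Suc show ?thesis by auto
qed

lemma Ck_on_subset:
  "Ck_on k S f \<Longrightarrow> T \<subseteq> S \<Longrightarrow> Ck_on k T f"
proof (induction k arbitrary: f)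
  case 0
  then show ?case by (auto intro: continuous_on_subset)
next
  case (Suc k)
  obtain f' where f': "\<And>x. x\<in>S \<Longrightarrow> (f has_derivative f' x) (at x within S)"
    "\<And>v. Ck_on k S (\<lambda>x. f' x v)" using Ck_on_SucE[OF Suc.prems(1)] by blast
  show ?case
  proof (rule Ck_on_SucI)
    fix x assume "x \<in> T"
    then show "(f has_derivative f' x) (at x within T)"
      using f'(1) Suc.prems(2) has_derivative_subset by blast
  next
    fix v show "Ck_on k T (\<lambda>x. f' x v)" by (rule Suc.IH[OF f'(2) Suc.prems(2)])
  qed
qed

lemma Ck_on_SucD: "Ck_on (Suc k) S f \<Longrightarrow> Ck_on k S f"
proof (induction k arbitrary: f)
  case 0
  then show ?case by (auto intro: has_derivative_continuous_on)
next
  case (Suc k)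
  obtain f' where f': "\<And>x. x\<in>S \<Longrightarrow> (f has_derivative f' x) (at x within S)"
    "\<And>v. Ck_on (Suc k) S (\<lambda>x. f' x v)" using Ck_on_SucE[OF Suc.prems] by blast
  show ?case by (rule Ck_on_SucI[OF f'(1) Suc.IH[OF f'(2)]])
qed

lemma Ck_on_const: "Ck_on k S (\<lambda>x. c)"
  by (induction k arbitrary: c) (auto intro!: exI[of _ "\<lambda>x v. 0"])

lemma Ck_on_linear:
  assumes "bounded_linear f" shows "Ck_on k S f"
proof (cases k)
  case 0
  then show ?thesis using assms by (simp add: linear_continuous_on)
next
  case (Suc n)
  then show ?thesis using assms Ck_on_const bounded_linear_imp_has_derivative
    by (auto intro!: exI[of _ "\<lambda>x. f"])
qed

lemma Ck_on_add:
  "Ck_on k S f \<Longrightarrow> Ck_on k S g \<Longrightarrow> Ck_on k S (\<lambda>x. f x + g x)"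
proof (induction k arbitrary: f g)
  case 0
  then show ?case by (auto intro: continuous_on_add)
next
  case (Suc k)
  obtain f' where F: "\<And>x. x\<in>S \<Longrightarrow> (f has_derivative f' x) (at x within S)"
    "\<And>v. Ck_on k S (\<lambda>x. f' x v)" using Ck_on_SucE[OF Suc.prems(1)] by blast
  obtain g' where G: "\<And>x. x\<in>S \<Longrightarrow> (g has_derivative g' x) (at x within S)"
    "\<And>v. Ck_on k S (\<lambda>x. g' x v)" using Ck_on_SucE[OF Suc.prems(2)] by blast
  note * = F G
  then show ?case
    by (intro Ck_on_SucI[of _ _ "\<lambda>x v. f' x v + g' x v"] has_derivative_add Suc.IH)
qed

lemma Ck_on_sum:
  "(\<And>i. i \<in> I \<Longrightarrow> Ck_on k S (f i)) \<Longrightarrow> Ck_on k S (\<lambda>x. \<Sum>i\<in>I. f i x)"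
  by (induction I rule: infinite_finite_induct) (auto intro: Ck_on_const Ck_on_add)

lemma (in bounded_bilinear) Ck_on:
  "Ck_on k S f \<Longrightarrow> Ck_on k S g \<Longrightarrow> Ck_on k S (\<lambda>x. prod (f x) (g x))"
proof (induction k arbitrary: f g)
  case 0
  then show ?case by (auto intro: continuous_on)
next
  case (Suc k)
  obtain f' where F: "\<And>x. x\<in>S \<Longrightarrow> (f has_derivative f' x) (at x within S)"
    "\<And>v. Ck_on k S (\<lambda>x. f' x v)" using Ck_on_SucE[OF Suc.prems(1)] by blast
  obtain g' where G: "\<And>x. x\<in>S \<Longrightarrow> (g has_derivative g' x) (at x within S)"
    "\<And>v. Ck_on k S (\<lambda>x. g' x v)" using Ck_on_SucE[OF Suc.prems(2)] by blast
  note * = F G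
  have "Ck_on k S f" "Ck_on k S g" using Suc.prems Ck_on_SucD by blast+
  then have "Ck_on k S (\<lambda>x. prod (f x) (g' x v) + prod (f' x v) (g x))" for v
    using * Suc.IH by (intro Ck_on_add) auto
  then show ?case
    by (intro Ck_on_SucI[of _ _ "\<lambda>x v. prod (f x) (g' x v) + prod (f' x v) (g x)"] FDERIV *)
qed

lemma (in bounded_linear) Ck_on_comp:
  "Ck_on k S g \<Longrightarrow> Ck_on k S (\<lambda>x. f (g x))"
proof (induction k arbitrary: g)
  case 0
  then show ?case by (auto intro: continuous_on)
next
  case (Suc k)
  obtain g' where *: 
    "\<And>x. x\<in>S \<Longrightarrow> (g has_derivative g' x) (at x within S)"
    "\<And>v. Ck_on k S (\<lambda>x. g' x v)" using Ck_on_SucE[OF Suc.prems] by blast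
  then show ?case
    by (intro Ck_on_SucI[of _ _ "\<lambda>x v. f (g' x v)"] has_derivative Suc.IH)
qed

lemma Ck_on_diff:
  assumes "Ck_on k S f" "Ck_on k S g" shows "Ck_on k S (\<lambda>x. f x - g x)"
  using Ck_on_add[OF assms(1) bounded_linear.Ck_on_comp[OF bounded_linear_minus[OF bounded_linear_ident] assms(2)]]
  by simp

lemma Ck_on_Pair:
  assumes "Ck_on k S f" "Ck_on k S g" shows "Ck_on k S (\<lambda>x. (f x, g x))"
  using Ck_on_add[OF bounded_linear.Ck_on_comp[OF bounded_linear_Pair[OF bounded_linear_ident bounded_linear_zero] assms(1)]
   bounded_linear.Ck_on_comp[OF bounded_linear_Pair[OF bounded_linear_zero bounded_linear_ident] assms(2)]]
  by simp

text \<open>The chain rule gives \<open>g' (f x) (f' x v)\<close>, whose direction also depends on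
  \<open>x\<close>, whereas \<open>Ck_on\<close> controls \<open>g'\<close> in fixed directions
  only. Expanding \<open>f' x v\<close> in \<open>Basis\<close> separates the two dependences; this
  is why the middle space is euclidean.\<close>

lemma Ck_on_compose:
  fixes f :: "'a::real_normed_vector \<Rightarrow> 'b::euclidean_space"
  shows "Ck_on k S f \<Longrightarrow> Ck_on k T g \<Longrightarrow> f ` S \<subseteq> T \<Longrightarrow> Ck_on k S (\<lambda>x. g (f x))"
proof (induction k arbitrary: g)
  case 0
  then show ?case by (auto intro: continuous_on_compose2)
next
  case (Suc k)
  obtain f' where F: "\<And>x. x\<in>S \<Longrightarrow> (f has_derivative f' x) (at x within S)"
    "\<And>v. Ck_on k S (\<lambda>x. f' x v)" using Ck_on_SucE[OF Suc.prems(1)] by blast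
  obtain g' where G: "\<And>x. x\<in>T \<Longrightarrow> (g has_derivative g' x) (at x within T)"
    "\<And>v. Ck_on k T (\<lambda>x. g' x v)" using Ck_on_SucE[OF Suc.prems(2)] by blast
  note * = F G
  have D: "((\<lambda>x. g (f x)) has_derivative (\<lambda>v. g' (f x) (f' x v))) (at x within S)" if "x \<in> S" for x
    by (rule has_derivative_in_compose[OF *(1)[OF that]])
       (use *(3) Suc.prems(3) that has_derivative_subset in blast)
  have "Ck_on k S f" using Suc.prems(1) Ck_on_SucD by blast
  then have C: "Ck_on k S (\<lambda>x. g' (f x) b)" for b
    using Suc.IH[OF _ *(4) Suc.prems(3)] by auto
  have "Ck_on k S (\<lambda>x. \<Sum>b\<in>Basis. (f' x v \<bullet> b) *\<^sub>R g' (f x) b)" for v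
    by (intro Ck_on_sum bounded_bilinear.Ck_on[OF bounded_bilinear_scaleR] C
        bounded_linear.Ck_on_comp[OF bounded_linear_inner_left] *(2))
  moreover have "g' (f x) (f' x v) = (\<Sum>b\<in>Basis. (f' x v \<bullet> b) *\<^sub>R g' (f x) b)" if "x \<in> S" for x v
  proof -
    interpret bounded_linear "g' (f x)"
      using *(3) Suc.prems(3) that has_derivative_bounded_linear by blast
    have "g' (f x) (f' x v) = g' (f x) (\<Sum>b\<in>Basis. (f' x v \<bullet> b) *\<^sub>R b)"
      by (simp add: euclidean_representation)
    then show ?thesis by (simp add: sum scaleR)
  qed
  ultimately have "Ck_on k S (\<lambda>x. g' (f x) (f' x v))" for v
    using Ck_on_cong[of k S "\<lambda>x. \<Sum>b\<in>Basis. (f' x v \<bullet> b) *\<^sub>R g' (f x) b" "\<lambda>x. g' (f x) (f' x v)"]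
    by metis
  with D show ?case by (intro Ck_on_SucI)
qed

section \<open>Iterated directional derivatives on open sets\<close>

definition dirderiv :: "'b \<Rightarrow> ('b::real_normed_vector \<Rightarrow> 'c::real_normed_vector) \<Rightarrow> 'b \<Rightarrow> 'c" where
  "dirderiv v f x = frechet_derivative f (at x) v"

text \<open>\<open>Ck_on\<close> asserts that some derivative family exists. On an open set the
  family is unique, so the quantifier can be traded for the operator \<open>dirderiv\<close>, which
  can be iterated; its direction comes first so that \<open>dirderiv u ^^ j\<close> makes
  sense.\<close>

lemma Ck_on_Suc_open:
  assumes "open S"
  shows "Ck_on (Suc k) S f \<longleftrightarrow> (\<forall>x\<in>S. f differentiable at x) \<and> (\<forall>v. Ck_on k S (dirderiv v f))"
proof
  assume "Ck_on (Suc k) S f"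
  then obtain f' where *: "\<And>x. x\<in>S \<Longrightarrow> (f has_derivative f' x) (at x)"
    "\<And>v. Ck_on k S (\<lambda>x. f' x v)"
    using Ck_on_SucE[OF \<open>Ck_on (Suc k) S f\<close>] at_within_open[OF _ assms] by fastforce
  then have "f' x = frechet_derivative f (at x)" if "x \<in> S" for x
    using frechet_derivative_at that by blast
  then have "Ck_on k S (dirderiv v f)" for v
    by (intro Ck_on_cong[OF *(2)[of v]]) (simp add: dirderiv_def)
  with * show "(\<forall>x\<in>S. f differentiable at x) \<and> (\<forall>v. Ck_on k S (dirderiv v f))"
    using differentiableI by blast
next
  assume *: "(\<forall>x\<in>S. f differentiable at x) \<and> (\<forall>v. Ck_on k S (dirderiv v f))"
  then show "Ck_on (Suc k) S f"
    using at_within_open[OF _ assms]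
    by (intro Ck_on_SucI[of _ _ "\<lambda>x. frechet_derivative f (at x)"]) (simp_all add: frechet_derivative_works dirderiv_def[abs_def])
qed

text \<open>Derivative families on overlapping open neighbourhoods agree, all being given by
  \<open>dirderiv\<close>. The lemma serves where different points require different intermediate
  charts.\<close>

lemma Ck_on_local:
  assumes "open S" "\<And>x. x \<in> S \<Longrightarrow> \<exists>U. open U \<and> x \<in> U \<and> U \<subseteq> S \<and> Ck_on k U f"
  shows "Ck_on k S f"
  using assms(2)
proof (induction k arbitrary: f)
  case 0
  have "continuous (at x) f" if "x \<in> S" for x
    using 0[OF that] continuous_on_eq_continuous_at by auto
  then show ?case by (simp add: continuous_at_imp_continuous_on)
next
  case (Suc k)
  have "f differentiable at x" if "x \<in> S" for x
    using Suc.prems[OF that] Ck_on_Suc_open by blast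
  moreover have "Ck_on k S (dirderiv v f)" for v
  proof (rule Suc.IH)
    fix x assume "x \<in> S"
    then obtain U where U: "open U" "x \<in> U" "U \<subseteq> S" "Ck_on (Suc k) U f" using Suc.prems by blast
    then have "Ck_on k U (dirderiv v f)" using Ck_on_Suc_open[OF U(1)] by blast
    with U show "\<exists>U. open U \<and> x \<in> U \<and> U \<subseteq> S \<and> Ck_on k U (dirderiv v f)" by blast
  qed
  ultimately show ?case using Ck_on_Suc_open[OF assms(1)] by blast
qed

lemma smooth_on_cong: "smooth_on S f \<Longrightarrow> (\<And>x. x \<in> S \<Longrightarrow> f x = g x) \<Longrightarrow> smooth_on S g"
  unfolding smooth_on_def using Ck_on_cong[of _ S f g] by blast

lemma smooth_on_subset: "smooth_on S f \<Longrightarrow> T \<subseteq> S \<Longrightarrow> smooth_on T f"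
  using Ck_on_subset[of _ S f T] unfolding smooth_on_def by blast

lemma smooth_on_const: "smooth_on S (\<lambda>x. c)"
  by (simp add: smooth_on_def Ck_on_const)

lemma smooth_on_linear: "bounded_linear f \<Longrightarrow> smooth_on S f"
  by (simp add: smooth_on_def Ck_on_linear)

lemma smooth_on_id: "smooth_on S (\<lambda>x. x)"
  by (rule smooth_on_linear) (rule bounded_linear_ident)

lemma smooth_on_add: "smooth_on S f \<Longrightarrow> smooth_on S g \<Longrightarrow> smooth_on S (\<lambda>x. f x + g x)"
  by (simp add: smooth_on_def Ck_on_add)

lemma smooth_on_diff: "smooth_on S f \<Longrightarrow> smooth_on S g \<Longrightarrow> smooth_on S (\<lambda>x. f x - g x)"
  by (simp add: smooth_on_def Ck_on_diff)

lemma smooth_on_sum: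
  "(\<And>i. i \<in> I \<Longrightarrow> smooth_on S (f i)) \<Longrightarrow> smooth_on S (\<lambda>x. \<Sum>i\<in>I. f i x)"
  by (simp add: smooth_on_def Ck_on_sum)

lemma smooth_on_Pair: "smooth_on S f \<Longrightarrow> smooth_on S g \<Longrightarrow> smooth_on S (\<lambda>x. (f x, g x))"
  by (simp add: smooth_on_def Ck_on_Pair)

lemma smooth_on_bilinear:
  "bounded_bilinear p \<Longrightarrow> smooth_on S f \<Longrightarrow> smooth_on S g \<Longrightarrow> smooth_on S (\<lambda>x. p (f x) (g x))"
  by (simp add: smooth_on_def bounded_bilinear.Ck_on)

lemma smooth_on_linear_comp:
  "bounded_linear p \<Longrightarrow> smooth_on S f \<Longrightarrow> smooth_on S (\<lambda>x. p (f x))"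
  by (simp add: smooth_on_def bounded_linear.Ck_on_comp)

lemma smooth_on_compose:
  fixes f :: "'a::real_normed_vector \<Rightarrow> 'b::euclidean_space"
  shows "smooth_on T g \<Longrightarrow> smooth_on S f \<Longrightarrow> f ` S \<subseteq> T \<Longrightarrow> smooth_on S (\<lambda>x. g (f x))"
  using Ck_on_compose[of _ S f T g] unfolding smooth_on_def by blast

lemmas smooth_on_scaleR = smooth_on_bilinear[OF bounded_bilinear_scaleR]

lemma smooth_on_fst: "smooth_on S f \<Longrightarrow> smooth_on S (\<lambda>x. fst (f x))"
  using smooth_on_linear_comp[OF bounded_linear_fst] .

lemma smooth_on_snd: "smooth_on S f \<Longrightarrow> smooth_on S (\<lambda>x. snd (f x))"
  using smooth_on_linear_comp[OF bounded_linear_snd] .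

lemma smooth_on_power:
  fixes f :: "'a::real_normed_vector \<Rightarrow> real"
  assumes "smooth_on S f" shows "smooth_on S (\<lambda>x. f x ^ n)"
  by (induction n) (auto intro: smooth_on_const smooth_on_bilinear[OF bounded_bilinear_mult] assms)

lemma smooth_on_continuous: "smooth_on S f \<Longrightarrow> continuous_on S f"
  unfolding smooth_on_def using Ck_on.simps(1) by blast

lemma smooth_on_local:
  assumes "open S" "\<And>x. x \<in> S \<Longrightarrow> \<exists>U. open U \<and> x \<in> U \<and> U \<subseteq> S \<and> smooth_on U f"
  shows "smooth_on S f"
  unfolding smooth_on_def
proof
  fix k show "Ck_on k S f"
  proof (rule Ck_on_local[OF assms(1)])
    fix x assume "x \<in> S"
    then obtain U where U: "open U" "x \<in> U" "U \<subseteq> S" "smooth_on U f" using assms(2) by blast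
    from U(4) have "Ck_on k U f" by (simp add: smooth_on_def)
    with U show "\<exists>U. open U \<and> x \<in> U \<and> U \<subseteq> S \<and> Ck_on k U f" by blast
  qed
qed

lemma smooth_on_differentiable:
  assumes "smooth_on S f" "open S" "x \<in> S"
  shows "(f has_derivative frechet_derivative f (at x)) (at x)"
proof -
  have "Ck_on (Suc 0) S f" using assms(1) unfolding smooth_on_def by blast
  then show ?thesis
    using assms(3) by (simp add: Ck_on_Suc_open[OF assms(2)] frechet_derivative_works del: Ck_on.simps)
qed

lemma has_derivative_dirderiv:
  "smooth_on S f \<Longrightarrow> open S \<Longrightarrow> x \<in> S \<Longrightarrow> (f has_derivative (\<lambda>v. dirderiv v f x)) (at x)"
  using smooth_on_differentiable by (simp add: dirderiv_def)

lemma dirderiv_eqI: "(f has_derivative f') (at x) \<Longrightarrow> dirderiv v f x = f' v"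
  unfolding dirderiv_def using frechet_derivative_at by metis

lemma smooth_on_dirderiv:
  assumes "smooth_on S f" "open S"
  shows "smooth_on S (dirderiv v f)"
  unfolding smooth_on_def
proof
  fix k
  have "Ck_on (Suc k) S f" using assms(1) unfolding smooth_on_def by blast
  then show "Ck_on k S (dirderiv v f)" unfolding Ck_on_Suc_open[OF assms(2)] by blast
qed

text \<open>The direction varies with the point, hence the expansion in \<open>Basis\<close>. The
  coordinate formula of the bracket consists of two such terms.\<close>

lemma smooth_on_dirderiv_comp:
  fixes f :: "'a::euclidean_space \<Rightarrow> 'b::real_normed_vector"
  assumes "smooth_on S f" "open S" "smooth_on S g"
  shows "smooth_on S (\<lambda>x. frechet_derivative f (at x) (g x))"
proof (rule smooth_on_cong)
  show "smooth_on S (\<lambda>x. \<Sum>b\<in>Basis. (g x \<bullet> b) *\<^sub>R dirderiv b f x)"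
    by (intro smooth_on_sum smooth_on_scaleR smooth_on_dirderiv assms
        smooth_on_linear_comp[OF bounded_linear_inner_left])
  fix x assume "x \<in> S"
  then interpret bounded_linear "frechet_derivative f (at x)"
    using smooth_on_differentiable[OF assms(1,2)] has_derivative_bounded_linear by blast
  have "frechet_derivative f (at x) (g x) = frechet_derivative f (at x) (\<Sum>b\<in>Basis. (g x \<bullet> b) *\<^sub>R b)"
    by (simp add: euclidean_representation)
  then show "(\<Sum>b\<in>Basis. (g x \<bullet> b) *\<^sub>R dirderiv b f x) = frechet_derivative f (at x) (g x)"
    by (simp add: sum scaleR dirderiv_def)
qed

text \<open>Each function reappears in the derivative of the other, so the induction has to treat
  them together.\<close>

lemma Ck_on_sin_cos: "Ck_on k S (sin::real\<Rightarrow>real) \<and> Ck_on k S (cos::real\<Rightarrow>real)"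
proof (induction k)
  case 0
  show ?case by (auto intro: continuous_intros)
next
  case (Suc k)
  have *: "Ck_on k S (\<lambda>x. v * cos x)" "Ck_on k S (\<lambda>x. v * - sin x)" for v :: real
    using Suc bounded_linear.Ck_on_comp[OF bounded_linear_mult_right[of v]]
      bounded_linear.Ck_on_comp[OF bounded_linear_mult_right[of "-v"]] by auto
  then have "Ck_on (Suc k) S (sin::real\<Rightarrow>real)"
    by (intro Ck_on_SucI[of _ _ "\<lambda>x v. v * cos x"]) (auto intro!: derivative_eq_intros)
  moreover from * have "Ck_on (Suc k) S (cos::real\<Rightarrow>real)"
    by (intro Ck_on_SucI[of _ _ "\<lambda>x v. v * - sin x"]) (auto intro!: derivative_eq_intros)
  ultimately show ?case ..
qed

lemma smooth_on_sin: "smooth_on S (sin :: real \<Rightarrow> real)"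
  using Ck_on_sin_cos unfolding smooth_on_def by blast

section \<open>Mixed partial derivatives and Taylor estimates\<close>

lemma vector_derivative_bound:
  fixes f :: "real \<Rightarrow> 'b::real_normed_vector"
  assumes "convex K" "\<And>t. t \<in> K \<Longrightarrow> (f has_vector_derivative f' t) (at t within K)"
    "\<And>t. t \<in> K \<Longrightarrow> norm (f' t) \<le> B" "x \<in> K" "y \<in> K"
  shows "norm (f x - f y) \<le> B * \<bar>x - y\<bar>"
proof -
  have "onorm (\<lambda>x. x *\<^sub>R f' t) \<le> B" if "t \<in> K" for t
    by (rule onorm_le) (use assms(3)[OF that] in \<open>simp add: mult.commute[of B] mult_left_mono\<close>)
  then show ?thesis
    using differentiable_bound[OF assms(1), of f "\<lambda>t x. x *\<^sub>R f' t" B x y] assms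
    by (simp add: has_vector_derivative_def)
qed

lemma has_vector_derivative_line:
  assumes "(f has_derivative D) (at (p + t *\<^sub>R v))"
  shows "((\<lambda>t. f (p + t *\<^sub>R v)) has_vector_derivative D v) (at t within K)"
proof -
  interpret bounded_linear D using assms has_derivative_bounded_linear by blast
  have "((\<lambda>t. p + t *\<^sub>R v) has_derivative (\<lambda>\<tau>. \<tau> *\<^sub>R v)) (at t within K)"
    by (auto intro!: derivative_eq_intros)
  from has_derivative_compose[OF this assms] show ?thesis
    by (simp add: has_vector_derivative_def scaleR)
qed

lemma has_vector_derivative_dirderiv:
  assumes "smooth_on W f" "open W" "p + t *\<^sub>R v \<in> W"
  shows "((\<lambda>t. f (p + t *\<^sub>R v)) has_vector_derivative dirderiv v f (p + t *\<^sub>R v)) (at t within K)"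
  using has_vector_derivative_line[OF has_derivative_dirderiv[OF assms]] .

text \<open>The mean value inequality is used twice on the parallelogram spanned by
  \<open>h *\<^sub>R u\<close> and \<open>h *\<^sub>R v\<close>: for \<open>dirderiv u f\<close> in
  direction \<open>v\<close>, then for \<open>f\<close> in direction \<open>u\<close>. Continuity of
  the second derivative at \<open>z\<close> makes the error small relative to
  \<open>h\<^sup>2\<close>.\<close>

lemma double_difference_bound:
  fixes u v :: "'a::real_normed_vector"
  assumes f: "smooth_on W f" and W: "open W" "z \<in> W" and "\<epsilon> > 0"
  defines "w \<equiv> dirderiv v (dirderiv u f) z"
  shows "\<exists>\<delta>>0. \<forall>h. 0 < h \<and> h < \<delta> \<longrightarrow>
    norm ((f (z + h *\<^sub>R u + h *\<^sub>R v) - f (z + h *\<^sub>R u)) - (f (z + h *\<^sub>R v) - f z) - h\<^sup>2 *\<^sub>R w) \<le> \<epsilon> * h\<^sup>2"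
proof -
  let ?g = "dirderiv v (dirderiv u f)"
  have fu: "smooth_on W (dirderiv u f)" using smooth_on_dirderiv f W by blast
  have "continuous_on W ?g" using smooth_on_continuous smooth_on_dirderiv fu W by blast
  then have "continuous (at z) ?g" using W continuous_on_eq_continuous_at by blast
  then obtain r1 where r1: "r1 > 0" "\<And>x. dist x z < r1 \<Longrightarrow> norm (?g x - w) < \<epsilon>"
    using \<open>\<epsilon> > 0\<close> unfolding w_def continuous_at_eps_delta dist_norm by metis
  obtain r2 where r2: "r2 > 0" "ball z r2 \<subseteq> W" using W open_contains_ball by blast
  define r where "r = min r1 r2"
  have r: "r > 0" "\<And>x. dist x z < r \<Longrightarrow> norm (?g x - w) \<le> \<epsilon>" "\<And>x. dist x z < r \<Longrightarrow> x \<in> W"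
    using r1 r2 unfolding r_def by (auto simp: dist_commute less_imp_le)
  \<comment> \<open>For \<open>h < \<delta>\<close> the whole parallelogram lies within distance
    \<open>r\<close> of \<open>z\<close>; the summand 1 avoids a zero denominator when
    \<open>u\<close> and \<open>v\<close> are both 0.\<close>
  define \<delta> where "\<delta> = r / (norm u + norm v + 1)"
  have nn: "norm u + norm v + 1 > 0" by (simp add: add_nonneg_pos)
  have "\<delta> > 0" using r nn by (simp add: \<delta>_def)
  moreover have "norm ((f (z + h *\<^sub>R u + h *\<^sub>R v) - f (z + h *\<^sub>R u)) - (f (z + h *\<^sub>R v) - f z) - h\<^sup>2 *\<^sub>R w) \<le> \<epsilon> * h\<^sup>2"
    if h: "0 < h" "h < \<delta>" for h
  proof -
    have near: "dist (z + s *\<^sub>R u + k *\<^sub>R v) z < r" if "s \<in> {0..h}" "k \<in> {0..h}" for s k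
    proof -
      have "norm (s *\<^sub>R u + k *\<^sub>R v) \<le> s * norm u + k * norm v"
        using that by (metis abs_of_nonneg atLeastAtMost_iff norm_scaleR norm_triangle_ineq)
      also have "\<dots> \<le> h * norm u + h * norm v"
        using that by (intro add_mono mult_right_mono) auto
      also have "\<dots> \<le> h * (norm u + norm v + 1)" using h by (simp add: algebra_simps)
      also have "\<dots> < r" using h nn by (simp add: \<delta>_def pos_less_divide_eq)
      finally show ?thesis by (simp add: dist_norm add.assoc)
    qed
    have inner: "norm (dirderiv u f (z + s *\<^sub>R u + h *\<^sub>R v) - dirderiv u f (z + s *\<^sub>R u) - h *\<^sub>R w) \<le> \<epsilon> * h"
      if s: "s \<in> {0..h}" for s
    proof -
      let ?F = "\<lambda>k. dirderiv u f (z + s *\<^sub>R u + k *\<^sub>R v) - k *\<^sub>R w"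
      have "norm (?F h - ?F 0) \<le> \<epsilon> * \<bar>h - 0\<bar>"
      proof (rule vector_derivative_bound)
        fix k assume k: "k \<in> {0..h}"
        show "(?F has_vector_derivative ?g (z + s *\<^sub>R u + k *\<^sub>R v) - w) (at k within {0..h})"
          using has_vector_derivative_dirderiv[OF fu W(1) r(3)[OF near[OF s k]]]
          by (auto intro!: derivative_eq_intros)
        show "norm (?g (z + s *\<^sub>R u + k *\<^sub>R v) - w) \<le> \<epsilon>" using r(2) near s k by blast
      qed (use h in auto)
      then show ?thesis using h by (simp add: algebra_simps)
    qed
    let ?F = "\<lambda>s. f ((z + h *\<^sub>R v) + s *\<^sub>R u) - f (z + s *\<^sub>R u) - s *\<^sub>R h *\<^sub>R w"
    have "norm (?F h - ?F 0) \<le> (\<epsilon> * h) * \<bar>h - 0\<bar>"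
    proof (rule vector_derivative_bound)
      fix s assume s: "s \<in> {0..h}"
      have "z + h *\<^sub>R v + s *\<^sub>R u \<in> W" "z + s *\<^sub>R u \<in> W"
        using r(3)[OF near[OF s, of h]] r(3)[OF near[OF s, of 0]] h by (auto simp: algebra_simps)
      then show "(?F has_vector_derivative dirderiv u f ((z + h *\<^sub>R v) + s *\<^sub>R u) - dirderiv u f (z + s *\<^sub>R u)
          - h *\<^sub>R w) (at s within {0..h})"
        using has_vector_derivative_dirderiv[OF f W(1)] by (auto intro!: derivative_eq_intros)
      show "norm (dirderiv u f ((z + h *\<^sub>R v) + s *\<^sub>R u) - dirderiv u f (z + s *\<^sub>R u) - h *\<^sub>R w) \<le> \<epsilon> * h"
        using inner[OF s] by (simp add: algebra_simps)
    qed (use h in auto)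
    then show ?thesis using h by (simp add: algebra_simps power2_eq_square)
  qed
  ultimately show ?thesis by blast
qed

text \<open>With equal steps in both directions the double difference is symmetric in
  \<open>u\<close> and \<open>v\<close>, so its quotient by \<open>h\<^sup>2\<close> is close to
  both mixed derivatives.\<close>

lemma dirderiv_commute:
  assumes f: "smooth_on W f" and W: "open W" "z \<in> W"
  shows "dirderiv u (dirderiv v f) z = dirderiv v (dirderiv u f) z" (is "?w1 = ?w2")
proof -
  have "norm (?w1 - ?w2) \<le> 0 + \<epsilon>" if "\<epsilon> > 0" for \<epsilon>
  proof -
    have e: "\<epsilon>/2 > 0" using that by simp
    obtain d1 where d1: "d1 > 0" "\<forall>h. 0 < h \<and> h < d1 \<longrightarrow> norm ((f (z + h *\<^sub>R u + h *\<^sub>R v) - f (z + h *\<^sub>R u)) - (f (z + h *\<^sub>R v) - f z) - h\<^sup>2 *\<^sub>R ?w2) \<le> \<epsilon>/2 * h\<^sup>2"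
      using double_difference_bound[OF f W e, of u v] by (elim exE conjE) (rule that)
    obtain d2 where d2: "d2 > 0" "\<forall>h. 0 < h \<and> h < d2 \<longrightarrow> norm ((f (z + h *\<^sub>R v + h *\<^sub>R u) - f (z + h *\<^sub>R v)) - (f (z + h *\<^sub>R u) - f z) - h\<^sup>2 *\<^sub>R ?w1) \<le> \<epsilon>/2 * h\<^sup>2"
      using double_difference_bound[OF f W e, of v u] by (elim exE conjE) (rule that)
    define h where "h = min d1 d2 / 2"
    have h: "0 < h" "h < d1" "h < d2" using d1(1) d2(1) by (auto simp: h_def)
    have sw: "z + h *\<^sub>R v + h *\<^sub>R u = z + h *\<^sub>R u + h *\<^sub>R v" by (simp add: algebra_simps)
    let ?D = "f (z + h *\<^sub>R u + h *\<^sub>R v) - f (z + h *\<^sub>R u) - f (z + h *\<^sub>R v) + f z"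
    have "norm (?D - h\<^sup>2 *\<^sub>R ?w2) \<le> \<epsilon>/2 * h\<^sup>2" using d1(2)[rule_format, OF conjI[OF h(1,2)]] by (simp add: algebra_simps)
    moreover have "norm (?D - h\<^sup>2 *\<^sub>R ?w1) \<le> \<epsilon>/2 * h\<^sup>2"
      using d2(2)[rule_format, OF conjI[OF h(1,3)]] unfolding sw by (simp add: algebra_simps)
    ultimately have "norm ((?D - h\<^sup>2 *\<^sub>R ?w2) - (?D - h\<^sup>2 *\<^sub>R ?w1)) \<le> \<epsilon>/2 * h\<^sup>2 + \<epsilon>/2 * h\<^sup>2"
      using norm_triangle_ineq4 add_mono order_trans by blast
    moreover have "(?D - h\<^sup>2 *\<^sub>R ?w2) - (?D - h\<^sup>2 *\<^sub>R ?w1) = h\<^sup>2 *\<^sub>R (?w1 - ?w2)"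
      by (simp add: algebra_simps)
    ultimately have "norm (h\<^sup>2 *\<^sub>R (?w1 - ?w2)) \<le> \<epsilon>/2 * h\<^sup>2 + \<epsilon>/2 * h\<^sup>2" by metis
    then have "h\<^sup>2 * norm (?w1 - ?w2) \<le> h\<^sup>2 * \<epsilon>" by (simp add: mult.commute)
    then show ?thesis using h by simp
  qed
  then have "norm (?w1 - ?w2) \<le> 0" by (rule field_le_epsilon)
  then show ?thesis by simp
qed

lemma dirderiv_cong:
  assumes "open W" "x \<in> W" "\<And>y. y \<in> W \<Longrightarrow> f y = g y" "smooth_on W f"
  shows "dirderiv v f x = dirderiv v g x"
proof -
  have "(f has_derivative (\<lambda>v. dirderiv v f x)) (at x)"
    using has_derivative_dirderiv assms by blast
  then have "(g has_derivative (\<lambda>v. dirderiv v f x)) (at x)"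
    by (rule has_derivative_transform_within_open[OF _ assms(1,2)]) (use assms in auto)
  from dirderiv_eqI[OF this] show ?thesis by simp
qed

lemma smooth_on_dirderiv_funpow:
  "smooth_on W f \<Longrightarrow> open W \<Longrightarrow> smooth_on W ((dirderiv u ^^ j) f)"
  by (induction j) (auto intro: smooth_on_dirderiv)

text \<open>Lets a space derivative pass through any number of time derivatives, so that flatness in
  time is inherited by space derivatives.\<close>

lemma dirderiv_funpow_commute:
  assumes f: "smooth_on W f" and W: "open W" "z \<in> W"
  shows "(dirderiv u ^^ j) (dirderiv v f) z = dirderiv v ((dirderiv u ^^ j) f) z"
  using W(2)
proof (induction j arbitrary: z)
  case (Suc j)
  have "(dirderiv u ^^ Suc j) (dirderiv v f) z = dirderiv u ((dirderiv u ^^ j) (dirderiv v f)) z"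
    by simp
  also have "\<dots> = dirderiv u (dirderiv v ((dirderiv u ^^ j) f)) z"
    by (rule dirderiv_cong[OF W(1)])
       (use Suc f W smooth_on_dirderiv_funpow smooth_on_dirderiv in blast)+
  also have "\<dots> = dirderiv v (dirderiv u ((dirderiv u ^^ j) f)) z"
    by (rule dirderiv_commute[OF smooth_on_dirderiv_funpow[OF f W(1)] W(1) Suc.prems])
  finally show ?case by simp
qed simp

section \<open>Estimates near the time slice t = 0, uniform in the space variable\<close>

lemma dist_Pair_less:
  "dist (t::real) t0 < r/2 \<Longrightarrow> dist x x0 < r/2 \<Longrightarrow> dist (t, x) (t0, x0) < r"
proof -
  assume a: "dist t t0 < r/2" "dist x x0 < r/2"
  have "dist (t, x) (t0, x0) \<le> dist t t0 + dist x x0"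
    unfolding dist_Pair_Pair by (rule sqrt_sum_squares_le_sum) auto
  with a show ?thesis by simp
qed

lemma open_product_nbhd:
  fixes W :: "(real \<times> 'e::metric_space) set"
  assumes "open W" "(0, x0) \<in> W"
  obtains \<delta> where "\<delta> > 0" "\<And>t x. \<bar>t\<bar> < \<delta> \<Longrightarrow> dist x x0 < \<delta> \<Longrightarrow> (t, x) \<in> W"
proof -
  obtain r where r: "r > 0" "ball (0, x0) r \<subseteq> W" using assms open_contains_ball by blast
  show thesis
  proof (rule that[of "r/2"])
    fix t x assume "\<bar>t\<bar> < r/2" "dist x x0 < r/2"
    then have "dist (t, x) (0, x0) < r" by (intro dist_Pair_less) auto
    then show "(t, x) \<in> W" using r by (auto simp: dist_commute)
  qed (use r in simp)
qed

lemma time_derivative: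
  fixes g :: "real \<times> 'e::real_normed_vector \<Rightarrow> 'c::real_normed_vector"
  assumes "smooth_on W g" "open W" "(t, x) \<in> W"
  shows "((\<lambda>t. g (t, x)) has_vector_derivative dirderiv (1, 0) g (t, x)) (at t within K)"
  using has_vector_derivative_dirderiv[OF assms(1,2), of "(0, x)" t "(1, 0)" K] assms(3)
  by simp

lemma space_derivative:
  fixes g :: "real \<times> 'e::real_normed_vector \<Rightarrow> 'c::real_normed_vector"
  assumes "smooth_on W g" "open W" "(t, x) \<in> W"
  shows "((\<lambda>x. g (t, x)) has_derivative (\<lambda>h. dirderiv (0, h) g (t, x))) (at x within K)"
proof -
  have "((\<lambda>x. (t, x)) has_derivative (\<lambda>h. (0, h))) (at x within K)"
    by (auto intro!: derivative_eq_intros)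
  from has_derivative_compose[OF this has_derivative_dirderiv[OF assms]] show ?thesis .
qed

text \<open>A bound for the time derivative, integrated from the slice t = 0, gains one power of t;
  the induction starts from local boundedness. Uniformity in \<open>x\<close> comes from assuming
  the vanishing on the whole slice and not just at \<open>x0\<close>.\<close>

lemma time_flat_bound:
  fixes g :: "real \<times> 'e::real_normed_vector \<Rightarrow> 'c::real_normed_vector"
  assumes W: "open W" "(0, x0) \<in> W"
  shows "smooth_on W g \<Longrightarrow> (\<And>x j. (0, x) \<in> W \<Longrightarrow> j < n \<Longrightarrow> (dirderiv (1, 0) ^^ j) g (0, x) = 0) \<Longrightarrow>
    \<exists>C \<delta>. 0 \<le> C \<and> 0 < \<delta> \<and> (\<forall>t x. \<bar>t\<bar> < \<delta> \<longrightarrow> dist x x0 < \<delta> \<longrightarrow> (t, x) \<in> W \<and> norm (g (t, x)) \<le> C * \<bar>t\<bar> ^ n)"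
proof (induction n arbitrary: g)
  case 0
  have "continuous (at (0, x0)) g"
    using smooth_on_continuous[OF 0(1)] W continuous_on_eq_continuous_at by blast
  then obtain r where r: "r > 0" "\<And>z. dist z (0, x0) < r \<Longrightarrow> dist (g z) (g (0, x0)) < 1"
    unfolding continuous_at_eps_delta by (metis zero_less_one)
  obtain \<delta> where \<delta>: "\<delta> > 0" "\<And>t x. \<bar>t\<bar> < \<delta> \<Longrightarrow> dist x x0 < \<delta> \<Longrightarrow> (t, x) \<in> W"
    using open_product_nbhd[OF W] by blast
  have "norm (g (t, x)) \<le> norm (g (0, x0)) + 1" if "\<bar>t\<bar> < r/2" "dist x x0 < r/2" for t x
  proof -
    have "dist (t, x) (0, x0) < r" using that by (intro dist_Pair_less) auto
    from r(2)[OF this] have "norm (g (t, x) - g (0, x0)) < 1" by (simp add: dist_norm)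
    moreover have "norm (g (t, x)) \<le> norm (g (0, x0)) + norm (g (t, x) - g (0, x0))"
      by (metis add.commute diff_add_cancel norm_triangle_ineq)
    ultimately show ?thesis by linarith
  qed
  then show ?case using \<delta> r(1)
    by (intro exI[of _ "norm (g (0, x0)) + 1"] exI[of _ "min \<delta> (r/2)"]) auto
next
  case (Suc n)
  have "(dirderiv (1, 0) ^^ j) (dirderiv (1, 0) g) (0, x) = 0" if "(0, x) \<in> W" "j < n" for x j
    using Suc.prems(2)[OF that(1), of "Suc j"] that(2) by (simp add: funpow_Suc_right del: funpow.simps)
  from Suc.IH[OF smooth_on_dirderiv[OF Suc.prems(1) W(1)] this]
  obtain C \<delta> where C: "0 \<le> C" "0 < \<delta>"
    "\<And>t x. \<bar>t\<bar> < \<delta> \<Longrightarrow> dist x x0 < \<delta> \<Longrightarrow> (t, x) \<in> W"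
    "\<And>t x. \<bar>t\<bar> < \<delta> \<Longrightarrow> dist x x0 < \<delta> \<Longrightarrow> norm (dirderiv (1, 0) g (t, x)) \<le> C * \<bar>t\<bar> ^ n"
    by blast
  have "norm (g (t, x)) \<le> C * \<bar>t\<bar> ^ Suc n" if "\<bar>t\<bar> < \<delta>" "dist x x0 < \<delta>" for t x
  proof -
    have "norm (g (t, x) - g (0, x)) \<le> (C * \<bar>t\<bar> ^ n) * \<bar>t - 0\<bar>"
    proof (rule vector_derivative_bound)
      fix s :: real assume s: "s \<in> cball 0 \<bar>t\<bar>"
      then have "\<bar>s\<bar> < \<delta>" using that by simp
      then show "((\<lambda>t. g (t, x)) has_vector_derivative dirderiv (1, 0) g (s, x)) (at s within cball 0 \<bar>t\<bar>)"
        using time_derivative[OF Suc.prems(1) W(1) C(3)] that by blast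
      have "C * \<bar>s\<bar> ^ n \<le> C * \<bar>t\<bar> ^ n" using C(1) s by (intro mult_left_mono power_mono) auto
      then show "norm (dirderiv (1, 0) g (s, x)) \<le> C * \<bar>t\<bar> ^ n"
        using C(4)[OF \<open>\<bar>s\<bar> < \<delta>\<close> that(2)] by linarith
    qed auto
    moreover have "g (0, x) = 0" using Suc.prems(2)[of x 0] C(3)[of 0 x] C(2) that by simp
    ultimately show ?thesis by (simp add: mult.assoc mult.commute[of "\<bar>t\<bar>"])
  qed
  with C show ?case by blast
qed

lemma space_derivative_zero:
  fixes g :: "real \<times> 'e::real_normed_vector \<Rightarrow> 'c::real_normed_vector"
  assumes g: "smooth_on W g" and W: "open W" "(0, x0) \<in> W" and 0: "\<And>x. (0, x) \<in> W \<Longrightarrow> g (0, x) = 0"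
  shows "dirderiv (0, b) g (0, x0) = 0"
proof -
  let ?U = "(\<lambda>x. (0::real, x)) -` W"
  have U: "open ?U" "x0 \<in> ?U"
    using W by (auto intro!: open_vimage continuous_intros)
  have "((\<lambda>x. g (0, x)) has_derivative (\<lambda>h. dirderiv (0, h) g (0, x0))) (at x0)"
    using space_derivative[OF g W] .
  moreover have "((\<lambda>x. g (0, x)) has_derivative (\<lambda>h. 0)) (at x0)"
    by (rule has_derivative_transform_within_open[OF has_derivative_const U]) (use 0 in auto)
  ultimately show ?thesis using has_derivative_unique by metis
qed

text \<open>The dimension enters because the operator norm of the space derivative is estimated by
  the sum of its values on the basis.\<close>

lemma space_lipschitz:
  fixes B :: real and g :: "real \<times> 'e::euclidean_space \<Rightarrow> 'c::real_normed_vector"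
  assumes g: "smooth_on W g" and W: "open W"
    and b: "\<And>x. dist x x0 < \<delta> \<Longrightarrow> (t, x) \<in> W"
      "\<And>x b. dist x x0 < \<delta> \<Longrightarrow> b \<in> Basis \<Longrightarrow> norm (dirderiv (0, b) g (t, x)) \<le> B"
    and y: "dist y x0 < \<delta>" "dist y' x0 < \<delta>"
  shows "norm (g (t, y) - g (t, y')) \<le> DIM('e) * B * norm (y - y')"
proof (rule differentiable_bound[of "ball x0 \<delta>" "\<lambda>x. g (t, x)" "\<lambda>x h. dirderiv (0, h) g (t, x)"])
  fix x assume "x \<in> ball x0 \<delta>"
  then have x: "dist x x0 < \<delta>" by (simp add: dist_commute)
  show der: "((\<lambda>x. g (t, x)) has_derivative (\<lambda>h. dirderiv (0, h) g (t, x))) (at x within ball x0 \<delta>)"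
    using space_derivative[OF g W b(1)[OF x]] .
  then interpret bounded_linear "\<lambda>h. dirderiv (0, h) g (t, x)"
    using has_derivative_bounded_linear by blast
  show "onorm (\<lambda>h. dirderiv (0, h) g (t, x)) \<le> DIM('e) * B"
  proof (rule onorm_le)
    fix h :: 'e
    have "dirderiv (0, h) g (t, x) = dirderiv (0, \<Sum>b\<in>Basis. (h \<bullet> b) *\<^sub>R b) g (t, x)"
      by (simp add: euclidean_representation)
    also have "\<dots> = (\<Sum>b\<in>Basis. (h \<bullet> b) *\<^sub>R dirderiv (0, b) g (t, x))"
      by (simp only: sum scaleR)
    also have "norm \<dots> \<le> (\<Sum>b\<in>(Basis::'e set). norm h * B)"
    proof (rule sum_norm_le)
      fix b :: 'e assume bB: "b \<in> Basis"
      show "norm ((h \<bullet> b) *\<^sub>R dirderiv (0, b) g (t, x)) \<le> norm h * B"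
        using Basis_le_norm[OF bB, of h] b(2)[OF x bB] by (simp add: mult_mono)
    qed
    finally show "norm (dirderiv (0, h) g (t, x)) \<le> DIM('e) * B * norm h" by (simp add: ac_simps)
  qed
qed (use y in \<open>auto simp: dist_commute\<close>)

text \<open>The time derivatives of \<open>g\<close> vanish along the slice t = 0, hence so do their
  space derivatives. By symmetry these are the time derivatives of the space derivatives, to which
  \<open>time_flat_bound\<close> applies in each basis direction.\<close>

lemma time_flat_lipschitz:
  fixes g :: "real \<times> 'e::euclidean_space \<Rightarrow> 'c::real_normed_vector"
  assumes g: "smooth_on W g" and W: "open W" "(0, x0) \<in> W"
    and flat: "\<And>x j. (0, x) \<in> W \<Longrightarrow> j < n \<Longrightarrow> (dirderiv (1, 0) ^^ j) g (0, x) = 0"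
  shows "\<exists>C \<delta>. 0 \<le> C \<and> 0 < \<delta> \<and> (\<forall>t y y'. \<bar>t\<bar> < \<delta> \<longrightarrow> dist y x0 < \<delta> \<longrightarrow> dist y' x0 < \<delta> \<longrightarrow>
     norm (g (t, y) - g (t, y')) \<le> C * \<bar>t\<bar> ^ n * norm (y - y'))"
proof -
  have "\<exists>C \<delta>. 0 \<le> C \<and> 0 < \<delta> \<and> (\<forall>t x. \<bar>t\<bar> < \<delta> \<longrightarrow> dist x x0 < \<delta> \<longrightarrow>
      (t, x) \<in> W \<and> norm (dirderiv (0, b) g (t, x)) \<le> C * \<bar>t\<bar> ^ n)" for b
  proof (rule time_flat_bound[OF W smooth_on_dirderiv[OF g W(1)]])
    fix x j assume x: "(0, x) \<in> W" "j < n"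
    have "dirderiv (0, b) ((dirderiv (1, 0) ^^ j) g) (0, x) = 0"
      by (rule space_derivative_zero[OF smooth_on_dirderiv_funpow[OF g W(1)] W(1) x(1)])
         (use flat x(2) in blast)
    then show "(dirderiv (1, 0) ^^ j) (dirderiv (0, b) g) (0, x) = 0"
      using dirderiv_funpow_commute[OF g W(1) x(1)] by metis
  qed
  then obtain C \<delta> where C: "\<And>b. 0 \<le> C b" "\<And>b. 0 < \<delta> b"
    "\<And>b t x. \<bar>t\<bar> < \<delta> b \<Longrightarrow> dist x x0 < \<delta> b \<Longrightarrow> (t, x) \<in> W"
    "\<And>b t x. \<bar>t\<bar> < \<delta> b \<Longrightarrow> dist x x0 < \<delta> b \<Longrightarrow> norm (dirderiv (0, b) g (t, x)) \<le> C b * \<bar>t\<bar> ^ n"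
    by metis
  define K where "K = (\<Sum>b\<in>(Basis::'e set). C b)"
  define d where "d = Min (\<delta> ` (Basis::'e set))"
  have d: "0 < d" "\<And>b. b \<in> Basis \<Longrightarrow> d \<le> \<delta> b"
    using C(2) by (auto simp: d_def)
  have K: "K \<ge> 0" "\<And>b. b \<in> Basis \<Longrightarrow> C b \<le> K"
    unfolding K_def by (auto intro!: sum_nonneg C(1) member_le_sum)
  have "norm (g (t, y) - g (t, y')) \<le> DIM('e) * (K * \<bar>t\<bar> ^ n) * norm (y - y')"
    if t: "\<bar>t\<bar> < d" "dist y x0 < d" "dist y' x0 < d" for t y y'
  proof (rule space_lipschitz[OF g W(1) _ _ t(2,3)])
    fix x assume x: "dist x x0 < d"
    obtain b :: 'e where b: "b \<in> Basis" using nonempty_Basis by blast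
    show "(t, x) \<in> W" using C(3)[of t b x] d(2)[OF b] t(1) x by simp
    fix b :: 'e assume b: "b \<in> Basis"
    have "norm (dirderiv (0, b) g (t, x)) \<le> C b * \<bar>t\<bar> ^ n"
      using C(4)[of t b x] d(2)[OF b] t(1) x by simp
    also have "\<dots> \<le> K * \<bar>t\<bar> ^ n" using K(2)[OF b] by (intro mult_right_mono) auto
    finally show "norm (dirderiv (0, b) g (t, x)) \<le> K * \<bar>t\<bar> ^ n" .
  qed
  then show ?thesis using d(1) K(1)
    by (intro exI[of _ "DIM('e) * K"] exI[of _ d]) (auto simp: mult.assoc)
qed

text \<open>The displacement \<open>R (t, x) - x\<close> vanishes for t = 0, so its space derivative
  is 0 at \<open>(0, x0)\<close> and, by continuity, arbitrarily small nearby.\<close>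

lemma near_identity_lipschitz:
  fixes R :: "real \<times> 'e::euclidean_space \<Rightarrow> 'e"
  assumes R: "smooth_on W R" and W: "open W" "(0, x0) \<in> W"
    and id: "\<And>x. (0, x) \<in> W \<Longrightarrow> R (0, x) = x" and "\<epsilon> > 0"
  shows "\<exists>\<delta>>0. \<forall>t y y'. \<bar>t\<bar> < \<delta> \<longrightarrow> dist y x0 < \<delta> \<longrightarrow> dist y' x0 < \<delta> \<longrightarrow>
     norm (R (t, y) - R (t, y') - (y - y')) \<le> \<epsilon> * norm (y - y')"
proof -
  define g where "g = (\<lambda>z. R z - snd z)"
  have g: "smooth_on W g" unfolding g_def
    by (intro smooth_on_diff R smooth_on_snd smooth_on_id)
  \<comment> \<open>Dividing by the dimension cancels the factor lost in
    \<open>space_lipschitz\<close>.\<close>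
  have pos: "\<epsilon> / DIM('e) > 0" using \<open>\<epsilon> > 0\<close> by simp
  have "\<exists>r>0. \<forall>z. dist z (0, x0) < r \<longrightarrow> norm (dirderiv (0, b) g z) < \<epsilon> / DIM('e)" for b
  proof -
    have "continuous (at (0, x0)) (dirderiv (0, b) g)"
      using smooth_on_continuous[OF smooth_on_dirderiv[OF g W(1)]] W continuous_on_eq_continuous_at by blast
    moreover have "dirderiv (0, b) g (0, x0) = 0"
      by (rule space_derivative_zero[OF g W]) (simp add: g_def id)
    ultimately show ?thesis using pos unfolding continuous_at_eps_delta by simp
  qed
  then obtain r where r: "\<And>b. r b > 0" "\<And>b z. dist z (0, x0) < r b \<Longrightarrow> norm (dirderiv (0, b) g z) < \<epsilon> / DIM('e)"
    by metis
  obtain \<delta> where \<delta>: "\<delta> > 0" "\<And>t x. \<bar>t\<bar> < \<delta> \<Longrightarrow> dist x x0 < \<delta> \<Longrightarrow> (t, x) \<in> W"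
    using open_product_nbhd[OF W] by blast
  define d where "d = min \<delta> (Min (r ` (Basis::'e set)) / 2)"
  have "d > 0" using r(1) \<delta>(1) by (auto simp: d_def)
  moreover have "d \<le> r b / 2" if "b \<in> Basis" for b
  proof -
    have "d \<le> Min (r ` (Basis::'e set)) / 2" unfolding d_def by (rule min.cobounded2)
    also have "\<dots> \<le> r b / 2" using that by simp
    finally show ?thesis .
  qed
  moreover have "d \<le> \<delta>" by (simp add: d_def)
  ultimately have d: "0 < d" "d \<le> \<delta>" "\<And>b. b \<in> Basis \<Longrightarrow> d \<le> r b / 2"
    by blast+
  have "norm (R (t, y) - R (t, y') - (y - y')) \<le> \<epsilon> * norm (y - y')"
    if t: "\<bar>t\<bar> < d" "dist y x0 < d" "dist y' x0 < d" for t y y'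
  proof -
    have "norm (g (t, y) - g (t, y')) \<le> DIM('e) * (\<epsilon> / DIM('e)) * norm (y - y')"
    proof (rule space_lipschitz[OF g W(1) _ _ t(2,3)])
      fix x assume x: "dist x x0 < d"
      show "(t, x) \<in> W" using \<delta>(2)[of t x] d(2) t(1) x by simp
      fix b :: 'e assume b: "b \<in> Basis"
      have "dist (t, x) (0, x0) < r b"
        using d(3)[OF b] t(1) x by (intro dist_Pair_less) auto
      from r(2)[OF this] show "norm (dirderiv (0, b) g (t, x)) \<le> \<epsilon> / DIM('e)" by simp
    qed
    then show ?thesis by (simp add: g_def algebra_simps)
  qed
  with d(1) show ?thesis by blast
qed

text \<open>The assumption \<open>f' 0 = 0 ^ n *\<^sub>R w\<close> only says that \<open>f' 0 = w\<close> for \<open>n = 0\<close> and \<open>f' 0 = 0\<close> otherwise.\<close>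

lemma tendsto_quotient_from_derivative:
  fixes f :: "real \<Rightarrow> 'b::real_normed_vector"
  assumes seg: "\<forall>\<^sub>F t in at 0 within J. closed_segment 0 t \<subseteq> J" and "0 \<in> J"
    and f: "\<And>t. t \<in> J \<Longrightarrow> (f has_vector_derivative f' t) (at t within J)"
    and 0: "f 0 = 0" "f' 0 = 0 ^ n *\<^sub>R w"
    and lim: "((\<lambda>t. f' t /\<^sub>R t ^ n) \<longlongrightarrow> w) (at 0 within J)"
  shows "((\<lambda>t. f t /\<^sub>R t ^ Suc n) \<longlongrightarrow> w /\<^sub>R Suc n) (at 0 within J)"
  unfolding tendsto_iff
proof (intro allI impI)
  fix e :: real assume "e > 0"
  then have "e/2 > 0" by simp
  then have "\<forall>\<^sub>F t in at 0 within J. dist (f' t /\<^sub>R t ^ n) w < e/2" using lim tendstoD by blast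
  then obtain d where d: "d > 0" "\<And>t. t \<in> J \<Longrightarrow> t \<noteq> 0 \<Longrightarrow> dist t 0 < d \<Longrightarrow> dist (f' t /\<^sub>R t ^ n) w < e/2"
    unfolding eventually_at by blast
  have d': "norm (f' t - t ^ n *\<^sub>R w) \<le> e/2 * \<bar>t\<bar> ^ n" if t: "t \<in> J" "\<bar>t\<bar> < d" for t
  proof (cases "t = 0")
    case True
    with 0 \<open>e > 0\<close> show ?thesis by simp
  next
    case False
    have "f' t - t ^ n *\<^sub>R w = t ^ n *\<^sub>R (f' t /\<^sub>R t ^ n - w)" using False by (simp add: algebra_simps)
    then have "norm (f' t - t ^ n *\<^sub>R w) = \<bar>t\<bar> ^ n * dist (f' t /\<^sub>R t ^ n) w"
      by (simp add: dist_norm power_abs)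
    also have "\<dots> \<le> \<bar>t\<bar> ^ n * (e/2)" using d(2)[of t] t False by (intro mult_left_mono) auto
    finally show ?thesis by (simp add: mult.commute)
  qed
  have "\<forall>\<^sub>F t in at 0 within J. t \<noteq> 0 \<and> \<bar>t\<bar> < d"
    unfolding eventually_at using d(1) by (auto intro!: exI[of _ d])
  with seg show "\<forall>\<^sub>F t in at 0 within J. dist (f t /\<^sub>R t ^ Suc n) (w /\<^sub>R Suc n) < e"
  proof eventually_elim
    case (elim t)
    \<comment> \<open>The subtracted monomial has derivative \<open>s ^ n *\<^sub>R w\<close>, so
      the derivative of \<open>?F\<close> is at most \<open>e/2 * \<bar>t\<bar> ^ n\<close> on the
      segment; \<open>seg\<close> keeps the segment inside \<open>J\<close>, where \<open>f'\<close>
      is known.\<close>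
    let ?F = "\<lambda>s. f s - s ^ Suc n *\<^sub>R (w /\<^sub>R Suc n)"
    have "norm (?F t - ?F 0) \<le> (e/2 * \<bar>t\<bar> ^ n) * \<bar>t - 0\<bar>"
    proof (rule vector_derivative_bound)
      fix s assume s: "s \<in> closed_segment 0 t"
      then have sJ: "s \<in> J" using elim by blast
      have st: "\<bar>s\<bar> \<le> \<bar>t\<bar>" using s by (auto simp: closed_segment_eq_real_ivl split: if_splits)
      have "((\<lambda>s. s ^ Suc n *\<^sub>R (w /\<^sub>R Suc n)) has_vector_derivative s ^ n *\<^sub>R w) (at s within closed_segment 0 t)"
      proof -
        have "((\<lambda>s. s ^ Suc n) has_real_derivative Suc n * s ^ n) (at s within closed_segment 0 t)"
          using DERIV_pow[of "Suc n" s "closed_segment 0 t"] by simp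
        from has_vector_derivative_scaleR[OF this has_vector_derivative_const[of "w /\<^sub>R Suc n"]]
        have "((\<lambda>s. s ^ Suc n *\<^sub>R (w /\<^sub>R Suc n)) has_vector_derivative
            s ^ Suc n *\<^sub>R 0 + (Suc n * s ^ n) *\<^sub>R (w /\<^sub>R Suc n)) (at s within closed_segment 0 t)" .
        moreover have "s ^ Suc n *\<^sub>R 0 + (Suc n * s ^ n) *\<^sub>R (w /\<^sub>R Suc n) = s ^ n *\<^sub>R w"
          by (simp add: field_simps)
        ultimately show ?thesis by metis
      qed
      then show "(?F has_vector_derivative f' s - s ^ n *\<^sub>R w) (at s within closed_segment 0 t)"
        using has_vector_derivative_within_subset[OF f[OF sJ], of "closed_segment 0 t"] elim
        by (intro has_vector_derivative_diff) auto
      have "norm (f' s - s ^ n *\<^sub>R w) \<le> e/2 * \<bar>s\<bar> ^ n" using d'[OF sJ] st elim by linarith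
      also have "\<dots> \<le> e/2 * \<bar>t\<bar> ^ n" using \<open>e > 0\<close> st by (intro mult_left_mono power_mono) auto
      finally show "norm (f' s - s ^ n *\<^sub>R w) \<le> e/2 * \<bar>t\<bar> ^ n" .
    qed auto
    then have *: "norm (?F t) \<le> e/2 * \<bar>t ^ Suc n\<bar>" using 0 by (simp add: abs_mult power_abs ac_simps)
    have "f t /\<^sub>R t ^ Suc n - w /\<^sub>R Suc n = ?F t /\<^sub>R t ^ Suc n" using elim by (simp add: algebra_simps)
    then have "dist (f t /\<^sub>R t ^ Suc n) (w /\<^sub>R Suc n) = norm (?F t) / \<bar>t ^ Suc n\<bar>"
      by (simp only: dist_norm norm_scaleR abs_inverse divide_inverse_commute)
    also have "\<dots> \<le> e/2" using * elim by (simp add: pos_divide_le_eq del: power_Suc)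
    finally show ?case using \<open>e > 0\<close> by linarith
  qed
qed

text \<open>The family \<open>g\<close> lists a function with its successive derivatives, so the
  induction step is a shift of the index. Asking only for short segments from 0 to stay in
  \<open>J\<close> covers open sets as well as relatively open parts of an interval that ends at
  0.\<close>

lemma taylor_leading_term:
  fixes g :: "nat \<Rightarrow> real \<Rightarrow> 'b::real_normed_vector"
  assumes seg: "\<forall>\<^sub>F t in at 0 within J. closed_segment 0 t \<subseteq> J" and J: "0 \<in> J"
  shows "(\<And>j t. j < k \<Longrightarrow> t \<in> J \<Longrightarrow> (g j has_vector_derivative g (Suc j) t) (at t within J)) \<Longrightarrow>
    (\<And>j. j < k \<Longrightarrow> g j 0 = 0) \<Longrightarrow> continuous_on J (g k) \<Longrightarrow>
    ((\<lambda>t. g 0 t /\<^sub>R t ^ k) \<longlongrightarrow> g k 0 /\<^sub>R fact k) (at 0 within J)"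
proof (induction k arbitrary: g)
  case 0
  then show ?case using J by (simp add: continuous_on_def)
next
  case (Suc k)
  have lim: "((\<lambda>t. g (Suc 0) t /\<^sub>R t ^ k) \<longlongrightarrow> g (Suc k) 0 /\<^sub>R fact k) (at 0 within J)"
    using Suc.IH[of "\<lambda>j. g (Suc j)"] Suc.prems by simp
  have "g (Suc 0) 0 = 0 ^ k *\<^sub>R (g (Suc k) 0 /\<^sub>R fact k)"
    using Suc.prems(2) by (cases k) auto
  from tendsto_quotient_from_derivative[OF seg J Suc.prems(1)[OF zero_less_Suc] Suc.prems(2)[OF zero_less_Suc] this lim]
  show ?case by (simp add: mult.commute)
qed

section \<open>Higher derivatives at 0 read off from one difference quotient\<close>

lemma smooth_on_higher_vector_derivative:
  fixes f :: "real \<Rightarrow> 'b::real_normed_vector"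
  assumes f: "smooth_on J f" and nb: "\<And>t. t \<in> J \<Longrightarrow> at t within J \<noteq> bot"
  shows "smooth_on J (higher_vector_derivative j f J)"
    and "t \<in> J \<Longrightarrow> (higher_vector_derivative j f J has_vector_derivative higher_vector_derivative (Suc j) f J t) (at t within J)"
proof -
  have step: "(h has_vector_derivative vector_derivative h (at t within J)) (at t within J)"
    if h: "smooth_on J h" and t: "t \<in> J" for h :: "real \<Rightarrow> 'b" and t
  proof -
    have "Ck_on (Suc 0) J h" using h by (simp add: smooth_on_def del: Ck_on.simps)
    then obtain h' where "\<And>x. x\<in>J \<Longrightarrow> (h has_derivative h' x) (at x within J)"
      "\<And>v. Ck_on 0 J (\<lambda>x. h' x v)" by (rule Ck_on_SucE) (rule that)
    then have "h differentiable at t within J" using t differentiableI by metis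
    then show ?thesis by (simp add: vector_derivative_works)
  qed
  have smooth_step: "smooth_on J (\<lambda>t. vector_derivative h (at t within J))"
    if h: "smooth_on J h" for h :: "real \<Rightarrow> 'b"
    unfolding smooth_on_def
  proof
    fix k
    have "Ck_on (Suc k) J h" using h by (simp add: smooth_on_def del: Ck_on.simps)
    then obtain h' where
      h': "\<And>x. x\<in>J \<Longrightarrow> (h has_derivative h' x) (at x within J)" "\<And>v. Ck_on k J (\<lambda>x. h' x v)"
      by (rule Ck_on_SucE) (rule that)
    have "h' t 1 = vector_derivative h (at t within J)" if t: "t \<in> J" for t
    proof -
      interpret bounded_linear "h' t" using h'(1)[OF t] has_derivative_bounded_linear by blast
      have "h' t x = x *\<^sub>R h' t 1" for x
        using scaleR[of x 1] by (metis mult.right_neutral real_scaleR_def)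
      then have "h' t = (\<lambda>x. x *\<^sub>R h' t 1)" by blast
      then have "(h has_vector_derivative h' t 1) (at t within J)"
        using h'(1)[OF t] unfolding has_vector_derivative_def by metis
      then show ?thesis using vector_derivative_within[OF nb[OF t]] by metis
    qed
    then show "Ck_on k J (\<lambda>t. vector_derivative h (at t within J))"
      by (rule Ck_on_cong[OF h'(2)[of 1]])
  qed
  show *: "smooth_on J (higher_vector_derivative j f J)" for j
    by (induction j) (simp_all add: f smooth_step)
  show "t \<in> J \<Longrightarrow> (higher_vector_derivative j f J has_vector_derivative higher_vector_derivative (Suc j) f J t) (at t within J)"
    using step[OF *] by simp
qed

lemma higher_vector_derivative_tendsto:
  fixes f :: "real \<Rightarrow> 'b::real_normed_vector"
  assumes seg: "\<forall>\<^sub>F t in at 0 within J. closed_segment 0 t \<subseteq> J" and J: "0 \<in> J"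
    and f: "smooth_on J f" and nb: "\<And>t. t \<in> J \<Longrightarrow> at t within J \<noteq> bot"
    and k: "k \<ge> 1" and 0: "\<And>j. j \<in> {1..<k} \<Longrightarrow> higher_vector_derivative j f J 0 = 0"
  shows "((\<lambda>t. (f t - f 0) /\<^sub>R t ^ k) \<longlongrightarrow> higher_vector_derivative k f J 0 /\<^sub>R fact k) (at 0 within J)"
proof -
  \<comment> \<open>Only the entry 0 is shifted, by the constant \<open>f 0\<close>; now all entries
    below \<open>k\<close> vanish at 0, as \<open>taylor_leading_term\<close> demands.\<close>
  define g where "g = (\<lambda>j. if j = 0 then (\<lambda>t. f t - f 0) else higher_vector_derivative j f J)"
  note hvd = smooth_on_higher_vector_derivative[OF f nb]
  have "((\<lambda>t. g 0 t /\<^sub>R t ^ k) \<longlongrightarrow> g k 0 /\<^sub>R fact k) (at 0 within J)"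
  proof (rule taylor_leading_term[OF seg J])
    fix j t assume "j < k" "t \<in> J"
    then show "(g j has_vector_derivative g (Suc j) t) (at t within J)"
      using hvd(2)[of t j] has_vector_derivative_diff[OF hvd(2)[of t 0] has_vector_derivative_const[of "f 0"]]
      by (cases "j = 0") (simp_all add: g_def)
  next
    fix j assume "j < k" then show "g j 0 = 0" using 0 by (auto simp: g_def)
  next
    show "continuous_on J (g k)" using smooth_on_continuous[OF hvd(1)] k by (auto simp: g_def)
  qed
  then show ?thesis using k by (simp add: g_def)
qed

text \<open>Converse of \<open>higher_vector_derivative_tendsto\<close>. For \<open>j < k\<close>
  the quotient of order \<open>j\<close> is \<open>t ^ (k - j)\<close> times the convergent one of
  order \<open>k\<close>, so it tends to 0. By strong induction the derivatives between 1 and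
  \<open>j - 1\<close> vanish, so that limit is also the \<open>j\<close>-th derivative divided by
  j!.\<close>

lemma higher_vector_derivative_eqI:
  fixes f :: "real \<Rightarrow> 'b::real_normed_vector"
  assumes seg: "\<forall>\<^sub>F t in at 0 within J. closed_segment 0 t \<subseteq> J" and J: "0 \<in> J"
    and f: "smooth_on J f" and nb: "\<And>t. t \<in> J \<Longrightarrow> at t within J \<noteq> bot"
    and k: "k \<ge> 1" and lim: "((\<lambda>t. (f t - f 0) /\<^sub>R t ^ k) \<longlongrightarrow> v) (at 0 within J)"
  shows "\<And>j. j \<in> {1..<k} \<Longrightarrow> higher_vector_derivative j f J 0 = 0"
    and "higher_vector_derivative k f J 0 = fact k *\<^sub>R v"
proof -
  note L = higher_vector_derivative_tendsto[OF seg J f nb]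
  show 0: "higher_vector_derivative j f J 0 = 0" if "j \<in> {1..<k}" for j
    using that
  proof (induction j rule: less_induct)
    case (less j)
    have "((\<lambda>t. (f t - f 0) /\<^sub>R t ^ j) \<longlongrightarrow> higher_vector_derivative j f J 0 /\<^sub>R fact j) (at 0 within J)"
      by (rule L) (use less in auto)
    moreover have "((\<lambda>t. t ^ (k - j) *\<^sub>R ((f t - f 0) /\<^sub>R t ^ k)) \<longlongrightarrow> 0 ^ (k - j) *\<^sub>R v) (at 0 within J)"
      by (intro tendsto_intros lim)
    then have "((\<lambda>t. (f t - f 0) /\<^sub>R t ^ j) \<longlongrightarrow> 0 ^ (k - j) *\<^sub>R v) (at 0 within J)"
    proof (rule Lim_transform_eventually)
      have "\<forall>\<^sub>F t in at 0 within J. t \<noteq> 0" by (simp add: eventually_at_filter)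
      then show "\<forall>\<^sub>F t in at 0 within J. t ^ (k - j) *\<^sub>R ((f t - f 0) /\<^sub>R t ^ k) = (f t - f 0) /\<^sub>R t ^ j"
      proof eventually_elim
        case (elim t)
        have "t ^ (k - j) * inverse (t ^ k) = inverse (t ^ j)"
          using elim less.prems by (simp add: power_diff field_simps)
        then show ?case by simp
      qed
    qed
    ultimately have "higher_vector_derivative j f J 0 /\<^sub>R fact j = 0 ^ (k - j) *\<^sub>R v"
      by (rule tendsto_unique[OF nb[OF J]])
    then show ?case using less.prems by (simp add: power_0_left)
  qed
  have "higher_vector_derivative k f J 0 /\<^sub>R fact k = v"
    using tendsto_unique[OF nb[OF J] L[OF _ k 0] lim] by simp
  then show "higher_vector_derivative k f J 0 = fact k *\<^sub>R v"
    by (auto simp: field_simps)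
qed

lemma eventually_closed_segment_open:
  "open J \<Longrightarrow> (0::real) \<in> J \<Longrightarrow> \<forall>\<^sub>F t in at 0 within J. closed_segment 0 t \<subseteq> J"
proof -
  assume "open J" "0 \<in> J"
  then obtain r where r: "r > 0" "ball 0 r \<subseteq> J" using open_contains_ball by blast
  have "closed_segment 0 t \<subseteq> J" if "dist t 0 < r" for t
    using closed_segment_subset[of 0 "ball 0 r" t] that r by (auto simp: dist_norm)
  then show ?thesis unfolding eventually_at using r(1) by (intro exI[of _ r]) simp
qed

lemma at_within_open_not_bot: "open J \<Longrightarrow> (t::real) \<in> J \<Longrightarrow> at t within J \<noteq> bot"
  by (subst at_within_open) auto

lemma open_time_slice:
  fixes W :: "(real \<times> 'e::topological_space) set"
  assumes "open W"
  shows "open {t. (t, x) \<in> W}"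
proof -
  have "open ((\<lambda>t. (t, x)) -` W)" by (intro open_vimage assms continuous_intros)
  then show ?thesis by (simp add: vimage_def)
qed

lemma higher_vector_derivative_slice:
  fixes f :: "real \<times> 'e::real_normed_vector \<Rightarrow> 'b::real_normed_vector"
  assumes f: "smooth_on W f" and W: "open W" "(t, x) \<in> W"
  shows "higher_vector_derivative j (\<lambda>t. f (t, x)) {t. (t, x) \<in> W} t = (dirderiv (1, 0) ^^ j) f (t, x)"
  using W(2)
proof (induction j arbitrary: t)
  case (Suc j)
  let ?J = "{t. (t, x) \<in> W}"
  have J: "open ?J" using open_time_slice[OF W(1)] .
  have "((\<lambda>t. (dirderiv (1, 0) ^^ j) f (t, x)) has_vector_derivative (dirderiv (1, 0) ^^ Suc j) f (t, x)) (at t within ?J)"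
    using time_derivative[OF smooth_on_dirderiv_funpow[OF f W(1)] W(1) Suc.prems] by simp
  then have "(higher_vector_derivative j (\<lambda>t. f (t, x)) ?J has_vector_derivative (dirderiv (1, 0) ^^ Suc j) f (t, x)) (at t within ?J)"
    by (rule has_vector_derivative_transform[rotated 2]) (use Suc.prems Suc.IH in blast)+
  moreover have "at t within ?J \<noteq> bot" using at_within_open_not_bot[OF J] Suc.prems by blast
  ultimately show ?case
    unfolding higher_vector_derivative.simps by (intro vector_derivative_within)
qed simp

text \<open>A zero limit at order \<open>k\<close> removes the \<open>k\<close>-th derivative as
  well, so \<open>j = k\<close> is included. This extra order improves the remainder of a curve from
  o(t^k) to O(t^(k+1)).\<close>

lemma time_derivatives_zero:
  fixes g :: "real \<times> 'e::euclidean_space \<Rightarrow> 'c::real_normed_vector"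
  assumes g: "smooth_on W g" and W: "open W" "(0, x) \<in> W"
    and lim: "((\<lambda>t. g (t, x) /\<^sub>R t ^ k) \<longlongrightarrow> 0) (at 0)" and 0: "g (0, x) = 0" and k: "k \<ge> 1" and j: "j \<le> k"
  shows "(dirderiv (1, 0) ^^ j) g (0, x) = 0"
proof (cases "j = 0")
  case True then show ?thesis using 0 by simp
next
  case False
  let ?J = "{t. (t, x) \<in> W}"
  have J: "open ?J" "0 \<in> ?J"
    using open_time_slice[OF W(1)] W(2) by simp_all
  have sm: "smooth_on ?J (\<lambda>t. g (t, x))"
    by (rule smooth_on_compose[OF g]) (auto intro: smooth_on_Pair smooth_on_id smooth_on_const)
  have lim': "((\<lambda>t. (g (t, x) - g (0, x)) /\<^sub>R t ^ k) \<longlongrightarrow> 0) (at 0 within ?J)"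
    using lim 0 at_within_open[OF J(2,1)] by simp
  note hv = higher_vector_derivative_eqI[OF eventually_closed_segment_open[OF J] J(2) sm at_within_open_not_bot[OF J(1)] k lim']
  have "higher_vector_derivative j (\<lambda>t. g (t, x)) ?J 0 = 0"
  proof (cases "j = k")
    case True then show ?thesis using hv(2) by simp
  next
    case False then show ?thesis using hv(1) j \<open>j \<noteq> 0\<close> by simp
  qed
  then show ?thesis using higher_vector_derivative_slice[OF g W] by metis
qed

section \<open>Leading terms of curves\<close>

text \<open>For a smooth curve whose derivatives of orders 1 to k - 1 vanish at 0, \<open>v\<close>
  is the k-th derivative divided by k!. The limit is two-sided and sees \<open>\<gamma>\<close> only
  near 0, so changes of chart domain do not affect it.\<close>

definition leading_term :: "nat \<Rightarrow> (real \<Rightarrow> 'b::real_normed_vector) \<Rightarrow> 'b \<Rightarrow> bool" where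
  "leading_term k \<gamma> v \<longleftrightarrow> ((\<lambda>t. (\<gamma> t - \<gamma> 0) /\<^sub>R t ^ k) \<longlongrightarrow> v) (at 0)"

lemma eventually_at_0_nonzero: "\<forall>\<^sub>F t in at (0::real). t \<noteq> 0"
  by (simp add: eventually_at_filter)

lemma leading_term_tendsto:
  assumes "leading_term k \<gamma> v" "k \<ge> 1"
  shows "(\<gamma> \<longlongrightarrow> \<gamma> 0) (at 0)"
proof -
  have "((\<lambda>t. t ^ k *\<^sub>R ((\<gamma> t - \<gamma> 0) /\<^sub>R t ^ k) + \<gamma> 0) \<longlongrightarrow> 0 ^ k *\<^sub>R v + \<gamma> 0) (at 0)"
    using assms(1) unfolding leading_term_def by (intro tendsto_intros)
  then have "((\<lambda>t. t ^ k *\<^sub>R ((\<gamma> t - \<gamma> 0) /\<^sub>R t ^ k) + \<gamma> 0) \<longlongrightarrow> \<gamma> 0) (at 0)"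
    using assms(2) by (simp add: power_0_left)
  then show ?thesis
  proof (rule Lim_transform_eventually)
    show "\<forall>\<^sub>F t in at 0. t ^ k *\<^sub>R ((\<gamma> t - \<gamma> 0) /\<^sub>R t ^ k) + \<gamma> 0 = \<gamma> t"
      using eventually_at_0_nonzero by eventually_elim simp
  qed
qed

lemma leading_term_cong:
  assumes "leading_term k \<gamma> v" "\<forall>\<^sub>F t in at 0. \<gamma> t = \<gamma>' t" "\<gamma> 0 = \<gamma>' 0"
  shows "leading_term k \<gamma>' v"
proof -
  have "\<forall>\<^sub>F t in at 0. (\<gamma> t - \<gamma> 0) /\<^sub>R t ^ k = (\<gamma>' t - \<gamma>' 0) /\<^sub>R t ^ k"
    using assms(2) by eventually_elim (simp add: assms(3))
  with assms(1) show ?thesis unfolding leading_term_def by (rule Lim_transform_eventually)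
qed

text \<open>Only the first derivative of \<open>F\<close> contributes: the increment of
  \<open>\<gamma>\<close> is O(t^k), so the error in the linear approximation of \<open>F\<close> is
  o(t^k).\<close>

lemma leading_term_chain:
  assumes \<gamma>: "leading_term k \<gamma> v" "k \<ge> 1" and F: "(F has_derivative F') (at (\<gamma> 0))"
  shows "leading_term k (\<lambda>t. F (\<gamma> t)) (F' v)"
proof -
  interpret bounded_linear F' using F has_derivative_bounded_linear by blast
  obtain e where e: "\<And>h. F (\<gamma> 0 + h) = F (\<gamma> 0) + F' h + e h"
    and lim: "((\<lambda>h. norm (e h) / norm h) \<longlongrightarrow> 0) (at 0)"
    using F unfolding has_derivative_iff_Ex by blast
  have [simp]: "e 0 = 0" using e[of 0] zero by simp
  let ?h = "\<lambda>t. \<gamma> t - \<gamma> 0"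
  have h0: "(?h \<longlongrightarrow> 0) (at 0)" using leading_term_tendsto[OF \<gamma>] LIM_zero by blast
  have hk: "((\<lambda>t. ?h t /\<^sub>R t ^ k) \<longlongrightarrow> v) (at 0)" using \<gamma>(1) unfolding leading_term_def .
  have "isCont (\<lambda>h. norm (e h) / norm h) 0" using lim by (simp add: isCont_def)
  from isCont_tendsto_compose[OF this h0]
  have "((\<lambda>t. norm (e (?h t)) / norm (?h t)) \<longlongrightarrow> 0) (at 0)" by simp
  from tendsto_mult[OF this tendsto_norm[OF hk]]
  have "((\<lambda>t. norm (e (?h t)) / norm (?h t) * norm (?h t /\<^sub>R t ^ k)) \<longlongrightarrow> 0) (at 0)" by simp
  \<comment> \<open>For a zero increment the quotient on the left is 0 by the convention on
    division, and the right side agrees because \<open>e 0 = 0\<close>.\<close>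
  moreover have "norm (e (?h t)) / norm (?h t) * norm (?h t /\<^sub>R t ^ k) = norm (e (?h t) /\<^sub>R t ^ k)" for t
    by (cases "?h t = 0") simp_all
  ultimately have "((\<lambda>t. e (?h t) /\<^sub>R t ^ k) \<longlongrightarrow> 0) (at 0)"
    by (simp only: tendsto_norm_zero_iff)
  from tendsto_add[OF tendsto[OF hk] this]
  have "((\<lambda>t. F' (?h t /\<^sub>R t ^ k) + e (?h t) /\<^sub>R t ^ k) \<longlongrightarrow> F' v) (at 0)" by simp
  moreover have "F' (?h t /\<^sub>R t ^ k) + e (?h t) /\<^sub>R t ^ k = (F (\<gamma> t) - F (\<gamma> 0)) /\<^sub>R t ^ k" for t
    using e[of "?h t"] by (simp add: scaleR scaleR_add_right)
  ultimately show ?thesis unfolding leading_term_def by simp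
qed

text \<open>Near \<open>x0\<close> the map \<open>R (t, _)\<close> differs from the identity by a
  map whose Lipschitz constant tends to 0 with t, so it alters the difference of two curves by
  o(t^k) only. Both points may move, and each may move by much more than t^k; the commutator
  requires this.\<close>

lemma near_identity_leading:
  fixes R :: "real \<times> 'e::euclidean_space \<Rightarrow> 'e"
  assumes R: "smooth_on W R" and W: "open W" "(0, x0) \<in> W"
    and id: "\<And>x. (0, x) \<in> W \<Longrightarrow> R (0, x) = x"
    and P: "(P \<longlongrightarrow> x0) (at 0)" and Q: "(Q \<longlongrightarrow> x0) (at 0)"
    and PQ: "((\<lambda>t. (P t - Q t) /\<^sub>R t ^ k) \<longlongrightarrow> v) (at 0)"
  shows "((\<lambda>t. (R (t, P t) - R (t, Q t)) /\<^sub>R t ^ k) \<longlongrightarrow> v) (at 0)"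
proof -
  let ?D = "\<lambda>t. (R (t, P t) - R (t, Q t) - (P t - Q t)) /\<^sub>R t ^ k"
  have "(?D \<longlongrightarrow> 0) (at 0)"
    unfolding tendsto_iff
  proof (intro allI impI)
    fix e :: real assume "e > 0"
    \<comment> \<open>The quotient of \<open>P t - Q t\<close> by \<open>t ^ k\<close> eventually
      has norm below \<open>norm v + 1\<close>, so this choice leaves an error below
      \<open>e\<close>.\<close>
    define \<epsilon> where "\<epsilon> = e / (norm v + 1)"
    have nv: "norm v + 1 > 0" by (simp add: add_nonneg_pos)
    then have "\<epsilon> > 0" using \<open>e > 0\<close> by (simp add: \<epsilon>_def)
    from near_identity_lipschitz[OF R W id this] obtain \<delta> where \<delta>: "\<delta> > 0"
      "\<And>t y y'. \<bar>t\<bar> < \<delta> \<Longrightarrow> dist y x0 < \<delta> \<Longrightarrow> dist y' x0 < \<delta> \<Longrightarrow>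
        norm (R (t, y) - R (t, y') - (y - y')) \<le> \<epsilon> * norm (y - y')" by blast
    have "\<forall>\<^sub>F t in at 0. \<bar>t\<bar> < \<delta>" using \<delta>(1) by (auto simp: eventually_at intro!: exI[of _ \<delta>])
    moreover have "\<forall>\<^sub>F t in at 0. dist (P t) x0 < \<delta>" "\<forall>\<^sub>F t in at 0. dist (Q t) x0 < \<delta>"
      using P Q \<delta>(1) by (auto dest: tendstoD)
    moreover have "\<forall>\<^sub>F t in at 0. norm ((P t - Q t) /\<^sub>R t ^ k) < norm v + 1"
      using order_tendstoD(2)[OF tendsto_norm[OF PQ]] by simp
    ultimately show "\<forall>\<^sub>F t in at 0. dist (?D t) 0 < e"
    proof eventually_elim
      case (elim t)
      have "norm (?D t) = norm (R (t, P t) - R (t, Q t) - (P t - Q t)) * \<bar>inverse (t ^ k)\<bar>" by simp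
      also have "\<dots> \<le> (\<epsilon> * norm (P t - Q t)) * \<bar>inverse (t ^ k)\<bar>"
        using \<delta>(2)[OF elim(1-3)] by (intro mult_right_mono) auto
      also have "\<dots> = \<epsilon> * norm ((P t - Q t) /\<^sub>R t ^ k)" by simp
      also have "\<dots> < \<epsilon> * (norm v + 1)" using elim(4) \<open>\<epsilon> > 0\<close> by (intro mult_strict_left_mono)
      also have "\<dots> = e" using nv by (simp add: \<epsilon>_def)
      finally show ?case by (simp add: dist_norm)
    qed
  qed
  from tendsto_add[OF this PQ] show ?thesis
    by (simp add: scaleR_diff_right)
qed

text \<open>The displacement splits into \<open>R (t, \<beta> t) - R (t, x0)\<close>, with leading
  term \<open>w\<close>, and \<open>R (t, x0) - x0\<close>, with leading term
  \<open>v\<close>.\<close>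

lemma leading_term_compose_near_identity:
  fixes R :: "real \<times> 'e::euclidean_space \<Rightarrow> 'e"
  assumes R: "smooth_on W R" and W: "open W" "(0, x0) \<in> W"
    and id: "\<And>x. (0, x) \<in> W \<Longrightarrow> R (0, x) = x"
    and a: "leading_term k (\<lambda>t. R (t, x0)) v" and b: "leading_term k \<beta> w" "\<beta> 0 = x0" and k: "k \<ge> 1"
  shows "leading_term k (\<lambda>t. R (t, \<beta> t)) (v + w)"
proof -
  have "((\<lambda>t. (R (t, \<beta> t) - R (t, x0)) /\<^sub>R t ^ k) \<longlongrightarrow> w) (at 0)"
    using b leading_term_tendsto[OF b(1) k] unfolding leading_term_def
    by (intro near_identity_leading[OF R W id]) auto
  from tendsto_add[OF a[unfolded leading_term_def] this] show ?thesis
    unfolding leading_term_def using b(2) by (simp add: scaleR_diff_right)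
qed

text \<open>Eventually \<open>R (t, x0) - x0\<close> is the negative of
  \<open>R (t, \<beta> t) - R (t, x0)\<close>, which has the leading term of
  \<open>\<beta>\<close>.\<close>

lemma leading_term_left_inverse:
  fixes R :: "real \<times> 'e::euclidean_space \<Rightarrow> 'e"
  assumes R: "smooth_on W R" and W: "open W" "(0, x0) \<in> W"
    and id: "\<And>x. (0, x) \<in> W \<Longrightarrow> R (0, x) = x"
    and b: "leading_term k \<beta> w" "\<beta> 0 = x0" and k: "k \<ge> 1"
    and inv: "\<forall>\<^sub>F t in at 0. R (t, \<beta> t) = x0"
  shows "leading_term k (\<lambda>t. R (t, x0)) (- w)"
proof -
  have "((\<lambda>t. (R (t, \<beta> t) - R (t, x0)) /\<^sub>R t ^ k) \<longlongrightarrow> w) (at 0)"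
    using b leading_term_tendsto[OF b(1) k] unfolding leading_term_def
    by (intro near_identity_leading[OF R W id]) auto
  from tendsto_minus[OF this]
  have "((\<lambda>t. - ((R (t, \<beta> t) - R (t, x0)) /\<^sub>R t ^ k)) \<longlongrightarrow> - w) (at 0)" .
  then show ?thesis unfolding leading_term_def
  proof (rule Lim_transform_eventually)
    show "\<forall>\<^sub>F t in at 0. - ((R (t, \<beta> t) - R (t, x0)) /\<^sub>R t ^ k) = (R (t, x0) - R (0, x0)) /\<^sub>R t ^ k"
      using inv by eventually_elim (simp add: id[OF W(2)] flip: scaleR_minus_right)
  qed
qed

text \<open>Applied to \<open>a\<close>, \<open>b\<close> and to \<open>b\<close>, \<open>a\<close> and subtracted, this gives the commutator: the first-order
  displacements \<open>a(t, x0) - x0\<close> and \<open>b(t, x0) - x0\<close> cancel.\<close>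

lemma leading_term_displacement:
  fixes a :: "real \<times> 'e::euclidean_space \<Rightarrow> 'e"
  assumes a: "smooth_on W a" and W: "open W" and U: "open U" "x0 \<in> U" "\<And>x. x \<in> U \<Longrightarrow> (0, x) \<in> W"
    and id: "\<And>x. x \<in> U \<Longrightarrow> a (0, x) = x"
    and lead: "\<And>x. x \<in> U \<Longrightarrow> leading_term k (\<lambda>t. a (t, x)) (X x)"
    and X: "smooth_on U X" and b: "leading_term l \<beta> w" "\<beta> 0 = x0" and kl: "k \<ge> 1" "l \<ge> 1"
  shows "((\<lambda>t. (a (t, \<beta> t) - \<beta> t - (a (t, x0) - x0)) /\<^sub>R t ^ (k + l)) \<longlongrightarrow> dirderiv w X x0) (at 0)"
proof -
  define V where "V = W \<inter> (UNIV \<times> U)"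
  \<comment> \<open>The remainder after the leading term. It is flat to order \<open>Suc k\<close>
    in time at each point over \<open>U\<close>, so differences of it in space carry the factor
    t^(k+1).\<close>
  define e where "e = (\<lambda>z. a z - snd z - fst z ^ k *\<^sub>R X (snd z))"
  have V: "open V" "(0, x0) \<in> V" using W U by (auto simp: V_def intro: open_Int open_Times)
  have e: "smooth_on V e"
    unfolding e_def V_def
    by (intro smooth_on_diff smooth_on_scaleR smooth_on_power smooth_on_fst smooth_on_snd smooth_on_id
        smooth_on_subset[OF a] smooth_on_compose[OF X]) auto
  have flat: "(dirderiv (1, 0) ^^ j) e (0, x) = 0" if x: "(0, x) \<in> V" and j: "j < Suc k" for x j
  proof (rule time_derivatives_zero[OF e V(1) x _ _ kl(1)])
    have xU: "x \<in> U" using x by (simp add: V_def)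
    show "e (0, x) = 0" using kl id[OF xU] by (simp add: e_def power_0_left)
    have "((\<lambda>t. (a (t, x) - x) /\<^sub>R t ^ k - X x) \<longlongrightarrow> 0) (at 0)"
      using lead[OF xU] id[OF xU] by (simp add: leading_term_def LIM_zero)
    then show "((\<lambda>t. e (t, x) /\<^sub>R t ^ k) \<longlongrightarrow> 0) (at 0)"
    proof (rule Lim_transform_eventually)
      show "\<forall>\<^sub>F t in at 0. (a (t, x) - x) /\<^sub>R t ^ k - X x = e (t, x) /\<^sub>R t ^ k"
        using eventually_at_0_nonzero by eventually_elim (simp add: e_def scaleR_diff_right)
    qed
  qed (use j in simp)
  obtain C \<delta> where C: "0 \<le> C" "0 < \<delta>"
    "\<And>t y y'. \<bar>t\<bar> < \<delta> \<Longrightarrow> dist y x0 < \<delta> \<Longrightarrow> dist y' x0 < \<delta> \<Longrightarrow>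
     norm (e (t, y) - e (t, y')) \<le> C * \<bar>t\<bar> ^ Suc k * norm (y - y')"
    using time_flat_lipschitz[OF e V flat] by blast
  have b0: "(\<beta> \<longlongrightarrow> x0) (at 0)" using leading_term_tendsto[OF b(1) kl(2)] b(2) by simp
  have bl: "((\<lambda>t. (\<beta> t - x0) /\<^sub>R t ^ l) \<longlongrightarrow> w) (at 0)" using b unfolding leading_term_def by simp
  have "((\<lambda>t. (e (t, \<beta> t) - e (t, x0)) /\<^sub>R t ^ (k + l)) \<longlongrightarrow> 0) (at 0)"
  proof (rule Lim_null_comparison)
    \<comment> \<open>This is the Lipschitz constant of order t^(k+1) times
      \<open>norm (\<beta> t - x0)\<close>, divided by t^(k+l): one factor t is left over.\<close>
    have "((\<lambda>t. C * \<bar>t\<bar> * norm ((\<beta> t - x0) /\<^sub>R t ^ l)) \<longlongrightarrow> C * \<bar>0\<bar> * norm w) (at 0)"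
      by (intro tendsto_intros bl)
    then show "((\<lambda>t. C * \<bar>t\<bar> * norm ((\<beta> t - x0) /\<^sub>R t ^ l)) \<longlongrightarrow> 0) (at 0)" by simp
    have "\<forall>\<^sub>F t in at 0. \<bar>t\<bar> < \<delta>" using C(2) by (auto simp: eventually_at intro!: exI[of _ \<delta>])
    moreover have "\<forall>\<^sub>F t in at 0. dist (\<beta> t) x0 < \<delta>" using b0 C(2) by (rule tendstoD)
    ultimately show "\<forall>\<^sub>F t in at 0. norm ((e (t, \<beta> t) - e (t, x0)) /\<^sub>R t ^ (k + l)) \<le> C * \<bar>t\<bar> * norm ((\<beta> t - x0) /\<^sub>R t ^ l)"
      using eventually_at_0_nonzero
    proof eventually_elim
      case (elim t)
      have "norm ((e (t, \<beta> t) - e (t, x0)) /\<^sub>R t ^ (k + l)) = norm (e (t, \<beta> t) - e (t, x0)) / \<bar>t\<bar> ^ (k + l)"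
        by (simp add: power_abs divide_inverse_commute)
      also have "\<dots> \<le> (C * \<bar>t\<bar> ^ Suc k * norm (\<beta> t - x0)) / \<bar>t\<bar> ^ (k + l)"
        using C(3)[of t "\<beta> t" x0] elim C(2) by (intro divide_right_mono) auto
      also have "\<dots> = C * \<bar>t\<bar> * norm ((\<beta> t - x0) /\<^sub>R t ^ l)"
        using elim(3) by (simp only: norm_scaleR abs_inverse power_abs) (simp add: power_add field_simps)
      finally show ?case .
    qed
  qed
  moreover have "((\<lambda>t. (X (\<beta> t) - X x0) /\<^sub>R t ^ l) \<longlongrightarrow> dirderiv w X x0) (at 0)"
    using leading_term_chain[OF b(1) kl(2), of X "\<lambda>v. dirderiv v X x0"]
      has_derivative_dirderiv[OF X U(1,2)] b(2) unfolding leading_term_def by simp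
  ultimately have "((\<lambda>t. (e (t, \<beta> t) - e (t, x0)) /\<^sub>R t ^ (k + l) + (X (\<beta> t) - X x0) /\<^sub>R t ^ l) \<longlongrightarrow> 0 + dirderiv w X x0) (at 0)"
    by (rule tendsto_add)
  then have "((\<lambda>t. (e (t, \<beta> t) - e (t, x0)) /\<^sub>R t ^ (k + l) + (X (\<beta> t) - X x0) /\<^sub>R t ^ l) \<longlongrightarrow> dirderiv w X x0) (at 0)"
    by simp
  then show ?thesis
  proof (rule Lim_transform_eventually)
    show "\<forall>\<^sub>F t in at 0. (e (t, \<beta> t) - e (t, x0)) /\<^sub>R t ^ (k + l) + (X (\<beta> t) - X x0) /\<^sub>R t ^ l
        = (a (t, \<beta> t) - \<beta> t - (a (t, x0) - x0)) /\<^sub>R t ^ (k + l)"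
      using eventually_at_0_nonzero
    proof eventually_elim
      case (elim t)
      have "(X (\<beta> t) - X x0) /\<^sub>R t ^ l = (t ^ k *\<^sub>R (X (\<beta> t) - X x0)) /\<^sub>R t ^ (k + l)"
        using elim by (simp add: power_add)
      then have "(e (t, \<beta> t) - e (t, x0)) /\<^sub>R t ^ (k + l) + (X (\<beta> t) - X x0) /\<^sub>R t ^ l
        = ((e (t, \<beta> t) - e (t, x0)) + t ^ k *\<^sub>R (X (\<beta> t) - X x0)) /\<^sub>R t ^ (k + l)"
        by (simp only: scaleR_add_right)
      also have "(e (t, \<beta> t) - e (t, x0)) + t ^ k *\<^sub>R (X (\<beta> t) - X x0) = a (t, \<beta> t) - \<beta> t - (a (t, x0) - x0)"
        by (simp add: e_def algebra_simps)
      finally show ?case .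
    qed
  qed
qed

text \<open>What survives are the change of \<open>X\<close> along \<open>Y\<close> and the change
  of \<open>Y\<close> along \<open>X\<close>. In the sign convention of \<open>lie_bracket\<close>
  the limit is the bracket of \<open>Y\<close> with \<open>X\<close>.\<close>

lemma commutator_leading:
  fixes a b :: "real \<times> 'e::euclidean_space \<Rightarrow> 'e"
  assumes U: "open U" "x0 \<in> U"
    and a: "smooth_on Wa a" "open Wa" "\<And>x. x \<in> U \<Longrightarrow> (0, x) \<in> Wa" "\<And>x. x \<in> U \<Longrightarrow> a (0, x) = x"
      "\<And>x. x \<in> U \<Longrightarrow> leading_term k (\<lambda>t. a (t, x)) (X x)" "smooth_on U X" "k \<ge> 1"
    and b: "smooth_on Wb b" "open Wb" "\<And>x. x \<in> U \<Longrightarrow> (0, x) \<in> Wb" "\<And>x. x \<in> U \<Longrightarrow> b (0, x) = x"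
      "\<And>x. x \<in> U \<Longrightarrow> leading_term l (\<lambda>t. b (t, x)) (Y x)" "smooth_on U Y" "l \<ge> 1"
  shows "((\<lambda>t. (a (t, b (t, x0)) - b (t, a (t, x0))) /\<^sub>R t ^ (k + l)) \<longlongrightarrow>
    dirderiv (Y x0) X x0 - dirderiv (X x0) Y x0) (at 0)"
proof -
  have "((\<lambda>t. (a (t, b (t, x0)) - b (t, x0) - (a (t, x0) - x0)) /\<^sub>R t ^ (k + l)) \<longlongrightarrow> dirderiv (Y x0) X x0) (at 0)"
    by (rule leading_term_displacement[OF a(1,2) U a(3-6) b(5)[OF U(2)] b(4)[OF U(2)] a(7) b(7)])
  moreover
  have "((\<lambda>t. (b (t, a (t, x0)) - a (t, x0) - (b (t, x0) - x0)) /\<^sub>R t ^ (l + k)) \<longlongrightarrow> dirderiv (X x0) Y x0) (at 0)"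
    by (rule leading_term_displacement[OF b(1,2) U b(3-6) a(5)[OF U(2)] a(4)[OF U(2)] b(7) a(7)])
  ultimately have "((\<lambda>t. (a (t, b (t, x0)) - b (t, x0) - (a (t, x0) - x0)) /\<^sub>R t ^ (k + l)
      - (b (t, a (t, x0)) - a (t, x0) - (b (t, x0) - x0)) /\<^sub>R t ^ (l + k)) \<longlongrightarrow>
      dirderiv (Y x0) X x0 - dirderiv (X x0) Y x0) (at 0)"
    by (rule tendsto_diff)
  then show ?thesis
    by (simp add: add.commute[of l k] flip: scaleR_diff_right)
qed

section \<open>Smoothness of inverse maps\<close>

lemma linear_eq_sum_Basis:
  fixes f :: "'a::euclidean_space \<Rightarrow> 'b::real_vector"
  assumes "linear f"
  shows "f u = (\<Sum>b\<in>Basis. (u \<bullet> b) *\<^sub>R f b)"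
proof -
  have "f u = f (\<Sum>b\<in>Basis. (u \<bullet> b) *\<^sub>R b)" by (simp add: euclidean_representation)
  then show ?thesis by (simp only: linear_sum[OF assms] linear_scale[OF assms] o_def)
qed

text \<open>Based on the identity L y - L z = L z (M z - M y) L y. As \<open>L y\<close> occurs on
  the right, it is first bounded for \<open>y\<close> close to \<open>z\<close>. Continuity of
  \<open>M\<close> on fixed vectors suffices in finite dimension.\<close>

lemma continuous_inverse_family:
  fixes M :: "'z::real_normed_vector \<Rightarrow> 'e::euclidean_space \<Rightarrow> 'e"
  assumes S: "open S" "z \<in> S"
    and M: "\<And>z. z \<in> S \<Longrightarrow> linear (M z)" and L: "\<And>z. z \<in> S \<Longrightarrow> linear (L z)"
    and inv: "\<And>z v. z \<in> S \<Longrightarrow> L z (M z v) = v" "\<And>z v. z \<in> S \<Longrightarrow> M z (L z v) = v"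
    and cont: "\<And>b. continuous (at z) (\<lambda>z. M z b)"
  shows "continuous (at z) (\<lambda>z. L z v)"
proof -
  obtain K where K: "K > 0" "\<And>v. norm (L z v) \<le> K * norm v"
    using bounded_linear.pos_bounded[OF linear_conv_bounded_linear[THEN iffD1, OF L[OF S(2)]]]
    by (metis mult.commute)
  define \<epsilon> where "\<epsilon> = (\<lambda>y. \<Sum>b\<in>(Basis::'e set). norm (M z b - M y b))"
  have "(\<epsilon> \<longlongrightarrow> (\<Sum>b\<in>(Basis::'e set). norm (M z b - M z b))) (at z)"
    unfolding \<epsilon>_def using cont by (intro tendsto_intros) (simp add: isCont_def)
  then have \<epsilon>0: "(\<epsilon> \<longlongrightarrow> 0) (at z)" by simp
  have diff: "norm (M z u - M y u) \<le> \<epsilon> y * norm u" if "y \<in> S" for y u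
  proof -
    have "M z u - M y u = (\<Sum>b\<in>Basis. (u \<bullet> b) *\<^sub>R (M z b - M y b))"
      using linear_eq_sum_Basis[OF M[OF S(2)], of u] linear_eq_sum_Basis[OF M[OF that], of u]
      by (simp add: scaleR_diff_right sum_subtractf)
    also have "norm \<dots> \<le> (\<Sum>b\<in>Basis. norm (M z b - M y b) * norm u)"
    proof (rule sum_norm_le)
      fix b :: 'e assume "b \<in> Basis"
      then show "norm ((u \<bullet> b) *\<^sub>R (M z b - M y b)) \<le> norm (M z b - M y b) * norm u"
        using Basis_le_norm[of b u] by (simp add: mult.commute[of _ "norm u"] mult_right_mono)
    qed
    finally show ?thesis by (simp add: \<epsilon>_def sum_distrib_right)
  qed
  have bound: "norm (L y v - L z v) \<le> K * (\<epsilon> y * (2 * K * norm v))"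
    if y: "y \<in> S" "K * \<epsilon> y < 1/2" for y
  proof -
    have eps: "\<epsilon> y \<ge> 0" unfolding \<epsilon>_def by (intro sum_nonneg) simp
    have eq: "L y v - L z v = L z (M z (L y v) - M y (L y v))"
      using inv y(1) S(2) by (simp add: linear_diff[OF L[OF S(2)]])
    have 1: "norm (L y v - L z v) \<le> K * (\<epsilon> y * norm (L y v))"
      unfolding eq using K(2)[of "M z (L y v) - M y (L y v)"] diff[OF y(1), of "L y v"] K(1)
      by (meson less_imp_le mult_left_mono order_trans)
    have "norm (L y v) \<le> norm (L z v) + norm (L y v - L z v)"
      by (metis add.commute diff_add_cancel norm_triangle_ineq)
    also have "\<dots> \<le> K * norm v + (K * \<epsilon> y) * norm (L y v)" using K(2)[of v] 1 by (simp add: mult.assoc)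
    \<comment> \<open>Since \<open>K * \<epsilon> y\<close> is below 1/2, half of
      \<open>norm (L y v)\<close> can be absorbed on the left.\<close>
    also have "\<dots> \<le> K * norm v + 1/2 * norm (L y v)"
      using y(2) by (intro add_left_mono mult_right_mono) auto
    finally have "norm (L y v) \<le> 2 * K * norm v" by simp
    then have "K * (\<epsilon> y * norm (L y v)) \<le> K * (\<epsilon> y * (2 * K * norm v))"
      using K(1) eps by (intro mult_left_mono) auto
    with 1 show ?thesis by linarith
  qed
  have "((\<lambda>y. L y v - L z v) \<longlongrightarrow> 0) (at z)"
  proof (rule Lim_null_comparison)
    have "((\<lambda>y. K * (\<epsilon> y * (2 * K * norm v))) \<longlongrightarrow> K * (0 * (2 * K * norm v))) (at z)"
      by (intro tendsto_intros \<epsilon>0)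
    then show "((\<lambda>y. K * (\<epsilon> y * (2 * K * norm v))) \<longlongrightarrow> 0) (at z)" by simp
    have "((\<lambda>y. K * \<epsilon> y) \<longlongrightarrow> K * 0) (at z)" by (intro tendsto_intros \<epsilon>0)
    then have "\<forall>\<^sub>F y in at z. K * \<epsilon> y < 1/2" by (rule order_tendstoD) simp
    moreover have "\<forall>\<^sub>F y in at z. y \<in> S" using S by (rule eventually_at_in_open')
    ultimately show "\<forall>\<^sub>F y in at z. norm (L y v - L z v) \<le> K * (\<epsilon> y * (2 * K * norm v))"
      by eventually_elim (use bound in blast)
  qed
  then show ?thesis unfolding isCont_def by (rule LIM_zero_cancel)
qed

text \<open>At a zero of \<open>q\<close> a derivative of \<open>p\<close> would be multiplied by 0,
  so continuity of \<open>p\<close> suffices. It is applied with the coordinates of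
  \<open>L y v\<close> as \<open>p\<close>, whose differentiability is still to be shown.\<close>

lemma has_derivative_mult_vanishing:
  fixes p :: "'z::real_normed_vector \<Rightarrow> real" and q :: "'z \<Rightarrow> 'b::real_normed_vector"
  assumes q: "(q has_derivative q') (at z)" "q z = 0" and p: "continuous (at z) p"
  shows "((\<lambda>y. p y *\<^sub>R q y) has_derivative (\<lambda>h. p z *\<^sub>R q' h)) (at z)"
proof -
  interpret bounded_linear q' using q has_derivative_bounded_linear by blast
  obtain e where e: "\<And>h. q (z + h) = q' h + e h"
    and lim: "((\<lambda>h. norm (e h) / norm h) \<longlongrightarrow> 0) (at 0)"
    using q unfolding has_derivative_iff_Ex by auto
  obtain K where K: "\<And>h. norm (q' h) \<le> norm h * K" using bounded by blast
  have pz: "((\<lambda>h. p (z + h)) \<longlongrightarrow> p z) (at 0)"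
    using p unfolding isCont_iff .
  define E where "E = (\<lambda>h. p (z + h) *\<^sub>R e h + (p (z + h) - p z) *\<^sub>R q' h)"
  have "((\<lambda>h. norm (E h) / norm h) \<longlongrightarrow> 0) (at 0)"
  proof (rule Lim_null_comparison)
    have "((\<lambda>h. \<bar>p (z + h)\<bar> * (norm (e h) / norm h) + \<bar>p (z + h) - p z\<bar> * K) \<longlongrightarrow> \<bar>p z\<bar> * 0 + \<bar>p z - p z\<bar> * K) (at 0)"
      by (intro tendsto_intros pz lim)
    then show "((\<lambda>h. \<bar>p (z + h)\<bar> * (norm (e h) / norm h) + \<bar>p (z + h) - p z\<bar> * K) \<longlongrightarrow> 0) (at 0)" by simp
    have "\<forall>\<^sub>F h in at (0::'z). h \<noteq> 0" by (simp add: eventually_at_filter)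
    then show "\<forall>\<^sub>F h in at 0. norm (norm (E h) / norm h) \<le> \<bar>p (z + h)\<bar> * (norm (e h) / norm h) + \<bar>p (z + h) - p z\<bar> * K"
    proof eventually_elim
      case (elim h)
      have "norm (E h) \<le> \<bar>p (z + h)\<bar> * norm (e h) + \<bar>p (z + h) - p z\<bar> * (norm h * K)"
        unfolding E_def
        by (rule norm_triangle_le) (use K[of h] in \<open>simp add: mult_left_mono\<close>)
      then have "norm (E h) / norm h \<le> (\<bar>p (z + h)\<bar> * norm (e h) + \<bar>p (z + h) - p z\<bar> * (norm h * K)) / norm h"
        by (rule divide_right_mono) simp
      also have "\<dots> = \<bar>p (z + h)\<bar> * (norm (e h) / norm h) + \<bar>p (z + h) - p z\<bar> * K"
        using elim by (simp add: add_divide_distrib)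
      finally show ?case by simp
    qed
  qed
  moreover have "p (z + h) *\<^sub>R q (z + h) = p z *\<^sub>R q z + p z *\<^sub>R q' h + E h" for h
    using e[of h] q(2) by (simp add: E_def algebra_simps)
  moreover have "bounded_linear (\<lambda>h. p z *\<^sub>R q' h)"
    by (rule bounded_linear_compose[OF bounded_linear_scaleR_right bounded_linear_axioms])
  ultimately show ?thesis unfolding has_derivative_iff_Ex by blast
qed

text \<open>The derivative of L is -L M' L, which involves only M' and L itself; both are C^k by the
  time the step to k + 1 is made.\<close>

lemma Ck_on_inverse_family:
  fixes M :: "'z::real_normed_vector \<Rightarrow> 'e::euclidean_space \<Rightarrow> 'e"
  assumes S: "open S"
    and M: "\<And>z. z \<in> S \<Longrightarrow> linear (M z)" and L: "\<And>z. z \<in> S \<Longrightarrow> linear (L z)"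
    and inv: "\<And>z v. z \<in> S \<Longrightarrow> L z (M z v) = v" "\<And>z v. z \<in> S \<Longrightarrow> M z (L z v) = v"
    and smooth: "\<And>b. Ck_on k S (\<lambda>z. M z b)"
  shows "Ck_on k S (\<lambda>z. L z v)"
  using smooth
proof (induction k arbitrary: v)
  case 0
  have "continuous (at z) (\<lambda>z. L z v)" if z: "z \<in> S" for z
  proof (rule continuous_inverse_family[OF S z M L inv])
    fix b show "continuous (at z) (\<lambda>z. M z b)"
      using 0 z continuous_on_eq_continuous_at[OF S] by auto
  qed
  then show ?case by (simp add: continuous_at_imp_continuous_on)
next
  case (Suc k)
  have "Ck_on k S (\<lambda>z. M z b)" for b using Suc.prems Ck_on_SucD by blast
  then have Lk: "Ck_on k S (\<lambda>z. L z v)" for v using Suc.IH by blast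
  have cL: "continuous (at z) (\<lambda>z. L z v)" if z: "z \<in> S" for z v
  proof (rule continuous_inverse_family[OF S z M L inv])
    fix b
    have "Ck_on (Suc 0) S (\<lambda>z. M z b)"
      using Suc.prems[of b] by (induction k) (auto dest: Ck_on_SucD simp del: Ck_on.simps)
    then have "continuous_on S (\<lambda>z. M z b)" using Ck_on_SucD Ck_on.simps(1) by blast
    then show "continuous (at z) (\<lambda>z. M z b)" using z continuous_on_eq_continuous_at[OF S] by blast
  qed
  define M' where "M' = (\<lambda>b z h. dirderiv h (\<lambda>z. M z b) z)"
  have M': "((\<lambda>z. M z b) has_derivative M' b z) (at z)" if "z \<in> S" for b z
    using Suc.prems[of b] that unfolding Ck_on_Suc_open[OF S] M'_def dirderiv_def[abs_def]
    by (simp add: frechet_derivative_works)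
  have M'k: "Ck_on k S (\<lambda>z. M' b z h)" for b h
    using Suc.prems[of b] unfolding Ck_on_Suc_open[OF S] M'_def by blast
  show ?case
  proof (rule Ck_on_SucI)
    fix z assume z: "z \<in> S"
    have LL: "bounded_linear (L z)" using L[OF z] linear_conv_bounded_linear by blast
    \<comment> \<open>For \<open>y\<close> in \<open>S\<close> this function is exactly
      \<open>L y v\<close>, being the expansion of L z v - L z (M y - M z) L y v. The factors
      containing \<open>M\<close> vanish at \<open>y = z\<close>, so it can be differentiated while
      \<open>L\<close> is only known to be continuous.\<close>
    have "((\<lambda>y. L z v - (\<Sum>b\<in>Basis. (L y v \<bullet> b) *\<^sub>R L z (M y b - M z b))) has_derivative
        (\<lambda>h. 0 - (\<Sum>b\<in>Basis. (L z v \<bullet> b) *\<^sub>R L z (M' b z h)))) (at z)"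
    proof (intro has_derivative_diff has_derivative_const has_derivative_sum has_derivative_mult_vanishing)
      fix b :: 'e
      have "((\<lambda>y. M y b - M z b) has_derivative (\<lambda>h. M' b z h - 0)) (at z)"
        by (intro has_derivative_diff has_derivative_const M' z)
      from bounded_linear.has_derivative[OF LL this]
      show "((\<lambda>y. L z (M y b - M z b)) has_derivative (\<lambda>h. L z (M' b z h))) (at z)" by simp
      show "L z (M z b - M z b) = 0" using linear_0[OF L[OF z]] by simp
      show "isCont (\<lambda>y. L y v \<bullet> b) z" by (intro continuous_intros cL z)
    qed
    then have "((\<lambda>y. L y v) has_derivative
        (\<lambda>h. 0 - (\<Sum>b\<in>Basis. (L z v \<bullet> b) *\<^sub>R L z (M' b z h)))) (at z)"
    proof (rule has_derivative_transform_within_open[OF _ S z])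
      fix y assume y: "y \<in> S"
      have "(\<Sum>b\<in>Basis. (L y v \<bullet> b) *\<^sub>R L z (M y b - M z b)) =
          (\<Sum>b\<in>Basis. (L y v \<bullet> b) *\<^sub>R L z (M y b)) - (\<Sum>b\<in>Basis. (L y v \<bullet> b) *\<^sub>R L z (M z b))"
        by (simp add: linear_diff[OF L[OF z]] scaleR_diff_right sum_subtractf)
      also have "(\<Sum>b\<in>Basis. (L y v \<bullet> b) *\<^sub>R L z (M y b)) = L z (M y (L y v))"
        using linear_eq_sum_Basis[OF linear_compose[OF M[OF y] L[OF z]], of "L y v"] by simp
      also have "(\<Sum>b\<in>Basis. (L y v \<bullet> b) *\<^sub>R L z (M z b)) = L z (M z (L y v))"
        using linear_eq_sum_Basis[OF linear_compose[OF M[OF z] L[OF z]], of "L y v"] by simp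
      finally show "L z v - (\<Sum>b\<in>Basis. (L y v \<bullet> b) *\<^sub>R L z (M y b - M z b)) = L y v"
        using inv y z by simp
    qed
    then show "((\<lambda>y. L y v) has_derivative
        (\<lambda>h. 0 - (\<Sum>b\<in>Basis. (L z v \<bullet> b) *\<^sub>R L z (M' b z h)))) (at z within S)"
      by (rule has_derivative_at_withinI)
  next
    fix h
    have "Ck_on k S (\<lambda>z. 0 - (\<Sum>b\<in>Basis. (L z v \<bullet> b) *\<^sub>R (\<Sum>c\<in>Basis. (M' b z h \<bullet> c) *\<^sub>R L z c)))"
      by (intro Ck_on_diff Ck_on_const Ck_on_sum bounded_bilinear.Ck_on[OF bounded_bilinear_scaleR] Lk
          bounded_linear.Ck_on_comp[OF bounded_linear_inner_left] M'k)
    then show "Ck_on k S (\<lambda>z. 0 - (\<Sum>b\<in>Basis. (L z v \<bullet> b) *\<^sub>R L z (M' b z h)))"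
      by (rule Ck_on_cong) (simp add: linear_eq_sum_Basis[OF L, of _ "M' _ _ h"])
  qed
qed

text \<open>A continuous \<open>g\<close> with \<open>f (g y) = y\<close> has as derivative the
  inverse of the derivative of \<open>f\<close>, taken at \<open>g y\<close>. This formula contains
  \<open>g\<close> only through composition, so C^k regularity of \<open>g\<close> yields
  C^(k+1).\<close>

lemma smooth_on_inverse:
  fixes f :: "'e::euclidean_space \<Rightarrow> 'e"
  assumes f: "smooth_on S f" and S: "open S" and T: "open T"
    and g: "continuous_on T g" "g ` T \<subseteq> S" "\<And>y. y \<in> T \<Longrightarrow> f (g y) = y"
    and inv: "\<And>x. x \<in> S \<Longrightarrow> inj (\<lambda>v. dirderiv v f x)"
  shows "smooth_on T g"
proof -
  define M where "M = (\<lambda>x v. dirderiv v f x)"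
  define L where "L = (\<lambda>x. Hilbert_Choice.inv (M x))"
  have M: "linear (M x)" if "x \<in> S" for x
    using has_derivative_dirderiv[OF f S that] has_derivative_linear unfolding M_def by blast
  have injM: "inj (M x)" if "x \<in> S" for x using inv[OF that] by (simp add: M_def)
  have bijM: "bij (M x)" if "x \<in> S" for x
    using linear_injective_imp_surjective[OF M injM] injM that by (auto simp: bij_def)
  have LM: "L x (M x v) = v" "M x (L x v) = v" if "x \<in> S" for x v
    using bijM[OF that] unfolding L_def bij_def by (auto simp: surj_f_inv_f)
  have L: "linear (L x)" if "x \<in> S" for x
    using inj_linear_imp_inv_linear[OF M injM] that unfolding L_def by blast
  have sL: "smooth_on S (\<lambda>x. L x v)" for v
    unfolding smooth_on_def
  proof
    fix k show "Ck_on k S (\<lambda>x. L x v)"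
    proof (rule Ck_on_inverse_family[OF S M L LM])
      fix b show "Ck_on k S (\<lambda>x. M x b)"
        using smooth_on_dirderiv[OF f S, of b] by (simp add: M_def smooth_on_def)
    qed
  qed
  have der: "(g has_derivative L (g y)) (at y)" if y: "y \<in> T" for y
  proof (rule has_derivative_inverse_basic[of f "M (g y)" g y])
    have gy: "g y \<in> S" using y g by blast
    show "(f has_derivative M (g y)) (at (g y))"
      using has_derivative_dirderiv[OF f S gy] by (simp add: M_def)
    show "bounded_linear (L (g y))" using L[OF gy] linear_conv_bounded_linear by blast
    show "L (g y) \<circ> M (g y) = id" using LM(1)[OF gy] by (auto simp: o_def)
    show "isCont g y" using g(1) y continuous_on_eq_continuous_at[OF T] by blast
  qed (use T y g in auto)
  have "Ck_on k T g" for k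
  proof (induction k)
    case 0 show ?case using g by simp
  next
    case (Suc k)
    show ?case
    proof (rule Ck_on_SucI)
      show "(g has_derivative L (g y)) (at y within T)" if "y \<in> T" for y
        using der[OF that] has_derivative_at_withinI by blast
      show "Ck_on k T (\<lambda>y. L (g y) v)" for v
        by (rule Ck_on_compose[OF Suc _ g(2)]) (use sL[of v] in \<open>simp add: smooth_on_def\<close>)
    qed
  qed
  then show ?thesis by (simp add: smooth_on_def)
qed

section \<open>Smooth families of maps of a compact manifold\<close>

abbreviation chart_image :: "('a, 'e) chart \<Rightarrow> 'e set" where
  "chart_image c \<equiv> coord c ` chart_dom c"

definition flow_dom :: "(real \<Rightarrow> 'a \<Rightarrow> 'a) \<Rightarrow> ('a, 'e) chart \<Rightarrow> ('a, 'e) chart \<Rightarrow> (real \<times> 'e) set" where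
  "flow_dom \<Phi> c d = {(t, x). x \<in> chart_image c \<and> \<Phi> t (chart_inv c x) \<in> chart_dom d}"

definition flow_rep :: "(real \<Rightarrow> 'a \<Rightarrow> 'a) \<Rightarrow> ('a, 'e) chart \<Rightarrow> ('a, 'e) chart \<Rightarrow> real \<times> 'e \<Rightarrow> 'e" where
  "flow_rep \<Phi> c d = (\<lambda>(t, x). coord d (\<Phi> t (chart_inv c x)))"

lemma flow_dom_iff: "(t, x) \<in> flow_dom \<Phi> c d \<longleftrightarrow> x \<in> chart_image c \<and> \<Phi> t (chart_inv c x) \<in> chart_dom d"
  by (simp add: flow_dom_def)

lemma flow_rep_apply: "flow_rep \<Phi> c d (t, x) = coord d (\<Phi> t (chart_inv c x))"
  by (simp add: flow_rep_def)

locale compact_manifold =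
  fixes A :: "('a::{t2_space, second_countable_topology}, 'e::euclidean_space) chart set"
  assumes atlas: "smooth_atlas A" and compact: "compact (UNIV :: 'a set)"
begin

lemma chart:
  assumes "c \<in> A"
  shows "open (chart_dom c)" "open (chart_image c)"
    "continuous_on (chart_dom c) (coord c)" "continuous_on (chart_image c) (chart_inv c)"
    "\<And>p. p \<in> chart_dom c \<Longrightarrow> chart_inv c (coord c p) = p"
    "\<And>x. x \<in> chart_image c \<Longrightarrow> chart_inv c x \<in> chart_dom c"
    "\<And>x. x \<in> chart_image c \<Longrightarrow> coord c (chart_inv c x) = x"
  using assms atlas unfolding smooth_atlas_def is_chart_def homeomorphism_def by blast+

lemma chart_exists: obtains c where "c \<in> A" "p \<in> chart_dom c"
  using atlas unfolding smooth_atlas_def by blast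

lemma transition_smooth:
  "c \<in> A \<Longrightarrow> d \<in> A \<Longrightarrow> smooth_on (coord c ` (chart_dom c \<inter> chart_dom d)) (\<lambda>x. coord d (chart_inv c x))"
  using atlas unfolding smooth_atlas_def o_def by blast

lemma chart_image_Int:
  "c \<in> A \<Longrightarrow> coord c ` (chart_dom c \<inter> N) = chart_image c \<inter> chart_inv c -` N"
  using chart(5-7)[of c] by (auto simp: image_iff)

lemma open_chart_image_Int:
  assumes "c \<in> A" "open N" shows "open (coord c ` (chart_dom c \<inter> N))"
  unfolding chart_image_Int[OF assms(1)]
  by (rule continuous_open_preimage[OF chart(4,2)[OF assms(1)] assms(2)])

text \<open>Over the whole line each \<open>flow_dom\<close> is open, so derivatives are ordinary
  ones. Only joint regularity is recorded, so that composition and inversion can be treated in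
  coordinates; membership in \<open>diffeos\<close> is supplied separately.\<close>

definition jointly_smooth :: "(real \<Rightarrow> 'a \<Rightarrow> 'a) \<Rightarrow> bool" where
  "jointly_smooth \<Phi> \<longleftrightarrow> continuous_on UNIV (\<lambda>(t, p). \<Phi> t p) \<and>
     (\<forall>c\<in>A. \<forall>d\<in>A. smooth_on (flow_dom \<Phi> c d) (flow_rep \<Phi> c d))"

lemma smooth_diffeo_curve_UNIV:
  "smooth_diffeo_curve A UNIV \<Phi> \<longleftrightarrow> (\<forall>t. \<Phi> t \<in> diffeos A) \<and> jointly_smooth \<Phi>"
  unfolding smooth_diffeo_curve_def jointly_smooth_def flow_dom_def flow_rep_def by simp

lemma continuous_on_flow:
  assumes "continuous_on UNIV (\<lambda>(t, p). \<Phi> t p)" "continuous_on S f" "continuous_on S g"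
  shows "continuous_on S (\<lambda>z. \<Phi> (f z) (g z))"
  using continuous_on_compose2[OF assms(1) continuous_on_Pair[OF assms(2,3)]] by simp

lemma continuous_on_flow_chart:
  assumes "continuous_on UNIV (\<lambda>(t, p). \<Phi> t p)" "c \<in> A"
  shows "continuous_on (UNIV \<times> chart_image c) (\<lambda>z. \<Phi> (fst z) (chart_inv c (snd z)))"
  by (intro continuous_on_flow[OF assms(1)] continuous_on_compose2[OF chart(4)[OF assms(2)]]
      continuous_intros) auto

lemma flow_dom_eq:
  "flow_dom \<Phi> c d = (UNIV \<times> chart_image c) \<inter> (\<lambda>z. \<Phi> (fst z) (chart_inv c (snd z))) -` chart_dom d"
  by (auto simp: flow_dom_def)

lemma open_flow_dom:
  assumes "continuous_on UNIV (\<lambda>(t, p). \<Phi> t p)" "c \<in> A" "d \<in> A"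
  shows "open (flow_dom \<Phi> c d)"
  unfolding flow_dom_eq
  by (rule continuous_open_preimage[OF continuous_on_flow_chart[OF assms(1,2)]])
     (auto intro!: open_Times chart assms)

lemma continuous_on_flow_rep:
  assumes "continuous_on UNIV (\<lambda>(t, p). \<Phi> t p)" "c \<in> A" "d \<in> A"
  shows "continuous_on (flow_dom \<Phi> c d) (flow_rep \<Phi> c d)"
proof -
  have "continuous_on (flow_dom \<Phi> c d) (\<lambda>z. coord d (\<Phi> (fst z) (chart_inv c (snd z))))"
    by (rule continuous_on_compose2[OF chart(3)[OF assms(3)]
          continuous_on_subset[OF continuous_on_flow_chart[OF assms(1,2)]]])
       (auto simp: flow_dom_def)
  then show ?thesis by (simp add: flow_rep_def case_prod_unfold)
qed

lemma jointly_smoothD: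
  assumes "jointly_smooth \<Phi>"
  shows "continuous_on UNIV (\<lambda>(t, p). \<Phi> t p)"
    "c \<in> A \<Longrightarrow> d \<in> A \<Longrightarrow> smooth_on (flow_dom \<Phi> c d) (flow_rep \<Phi> c d)"
    "c \<in> A \<Longrightarrow> d \<in> A \<Longrightarrow> open (flow_dom \<Phi> c d)"
  using assms open_flow_dom unfolding jointly_smooth_def by blast+

section \<open>Joint smoothness under composition, change of time and inversion\<close>

lemma jointly_smooth_id: "jointly_smooth (\<lambda>t. id)"
  unfolding jointly_smooth_def
proof (intro conjI ballI)
  show "continuous_on UNIV (\<lambda>(t::real, p::'a). id p)"
    by (simp add: case_prod_unfold) (intro continuous_intros)
  fix c d assume c: "c \<in> A" and d: "d \<in> A"
  have "smooth_on (flow_dom (\<lambda>t. id) c d) (\<lambda>z. coord d (chart_inv c (snd z)))"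
    by (rule smooth_on_compose[OF transition_smooth[OF c d]])
       (auto simp: flow_dom_def chart_image_Int[OF c] intro!: smooth_on_snd smooth_on_id)
  then show "smooth_on (flow_dom (\<lambda>t. id) c d) (flow_rep (\<lambda>t. id) c d)"
    by (simp add: flow_rep_def case_prod_unfold)
qed

text \<open>In coordinates the composition factors through a chart around the intermediate point.
  That chart depends on the point considered, hence the local argument.\<close>

lemma jointly_smooth_compose:
  assumes \<Phi>: "jointly_smooth \<Phi>" and \<Psi>: "jointly_smooth \<Psi>"
  shows "jointly_smooth (\<lambda>t. \<Phi> t \<circ> \<Psi> t)"
proof -
  let ?H = "\<lambda>t. \<Phi> t \<circ> \<Psi> t"
  note \<Phi>D = jointly_smoothD[OF \<Phi>] and \<Psi>D = jointly_smoothD[OF \<Psi>]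
  have cont: "continuous_on UNIV (\<lambda>(t, p). ?H t p)"
    unfolding case_prod_unfold o_def
    by (intro continuous_on_flow[OF \<Phi>D(1)] continuous_on_flow[OF \<Psi>D(1)] continuous_intros)
  have "smooth_on (flow_dom ?H c d) (flow_rep ?H c d)" if c: "c \<in> A" and d: "d \<in> A" for c d
  proof (rule smooth_on_local[OF open_flow_dom[OF cont c d]])
    fix z assume z: "z \<in> flow_dom ?H c d"
    obtain t0 x0 where tx: "z = (t0, x0)" by (cases z)
    obtain e where e: "e \<in> A" "\<Psi> t0 (chart_inv c x0) \<in> chart_dom e" using chart_exists by blast
    define g where "g = (\<lambda>z. (fst z, flow_rep \<Psi> c e z))"
    define N where "N = flow_dom \<Psi> c e \<inter> g -` flow_dom \<Phi> e d"
    have g: "smooth_on (flow_dom \<Psi> c e) g" unfolding g_def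
      by (intro smooth_on_Pair smooth_on_fst smooth_on_id \<Psi>D c e)
    have "open N" unfolding N_def
      by (rule continuous_open_preimage[OF smooth_on_continuous[OF g]]) (intro \<Phi>D \<Psi>D c d e)+
    moreover have inN: "g (t, x) = (t, coord e (\<Psi> t (chart_inv c x)))" for t x
      by (simp add: g_def flow_rep_apply)
    have "z \<in> N" using z e unfolding N_def tx by (simp add: flow_dom_iff inN chart(5)[OF e(1)])
    moreover have "N \<subseteq> flow_dom ?H c d"
      unfolding N_def using chart(5)[OF e(1)] by (auto simp: flow_dom_iff inN)
    moreover have "smooth_on N (\<lambda>z. flow_rep \<Phi> e d (g z))"
      by (rule smooth_on_compose[OF \<Phi>D(2)[OF e(1) d] smooth_on_subset[OF g]]) (auto simp: N_def)
    then have "smooth_on N (flow_rep ?H c d)"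
    proof (rule smooth_on_cong)
      fix z assume "z \<in> N"
      then show "flow_rep \<Phi> e d (g z) = flow_rep ?H c d z"
        unfolding N_def using chart(5)[OF e(1)]
        by (cases z) (auto simp: flow_dom_iff inN flow_rep_apply)
    qed
    ultimately show "\<exists>U. open U \<and> z \<in> U \<and> U \<subseteq> flow_dom ?H c d \<and> smooth_on U (flow_rep ?H c d)"
      by blast
  qed
  with cont show ?thesis unfolding jointly_smooth_def by blast
qed

text \<open>The chain rule within domains applies even where \<open>\<tau>\<close> touches an end
  point of \<open>I\<close> and derivatives of \<open>\<phi>\<close> are one-sided; the composite is
  defined for all real times.\<close>

lemma jointly_smooth_reparam:
  assumes \<phi>: "smooth_diffeo_curve A I \<phi>" and \<tau>: "smooth_on UNIV \<tau>" "\<And>t. \<tau> t \<in> I"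
  shows "jointly_smooth (\<lambda>t. \<phi> (\<tau> t))"
  unfolding jointly_smooth_def
proof (intro conjI ballI)
  have c: "continuous_on (I \<times> UNIV) (\<lambda>(t, p). \<phi> t p)" using \<phi> unfolding smooth_diffeo_curve_def by blast
  have "continuous_on UNIV (\<lambda>z::real \<times> 'a. (\<tau> (fst z), snd z))"
    by (intro continuous_intros continuous_on_compose2[OF smooth_on_continuous[OF \<tau>(1)]]) auto
  from continuous_on_compose2[OF c this]
  show "continuous_on UNIV (\<lambda>(t, p). \<phi> (\<tau> t) p)" using \<tau>(2) by (auto simp: case_prod_unfold)
  fix c d assume c: "c \<in> A" and d: "d \<in> A"
  have "smooth_on {(t, x). t \<in> I \<and> x \<in> chart_image c \<and> \<phi> t (chart_inv c x) \<in> chart_dom d}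
        (\<lambda>(t, x). coord d (\<phi> t (chart_inv c x)))"
    using \<phi> c d unfolding smooth_diffeo_curve_def by blast
  moreover have "smooth_on (flow_dom (\<lambda>t. \<phi> (\<tau> t)) c d) (\<lambda>z. (\<tau> (fst z), snd z))"
    by (intro smooth_on_Pair smooth_on_snd smooth_on_id smooth_on_compose[OF \<tau>(1)] smooth_on_fst) auto
  ultimately have "smooth_on (flow_dom (\<lambda>t. \<phi> (\<tau> t)) c d)
      (\<lambda>z. (\<lambda>(t, x). coord d (\<phi> t (chart_inv c x))) (\<tau> (fst z), snd z))"
    by (rule smooth_on_compose) (use \<tau>(2) in \<open>auto simp: flow_dom_iff\<close>)
  then show "smooth_on (flow_dom (\<lambda>t. \<phi> (\<tau> t)) c d) (flow_rep (\<lambda>t. \<phi> (\<tau> t)) c d)"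
    by (simp add: flow_rep_def case_prod_unfold)
qed

text \<open>The map \<open>F\<close> adding time as a component is a continuous bijection; over a
  compact time interval its source is compact and its target Hausdorff, so the inverse is
  continuous. This is where compactness of the manifold enters.\<close>

lemma continuous_on_inverse_flow:
  fixes \<Phi> :: "real \<Rightarrow> 'a \<Rightarrow> 'a"
  assumes cont: "continuous_on UNIV (\<lambda>(t, p). \<Phi> t p)" and bij: "\<And>t. bij (\<Phi> t)"
  shows "continuous_on UNIV (\<lambda>(t, p). inv_into UNIV (\<Phi> t) p)"
proof -
  define F where "F = (\<lambda>z :: real \<times> 'a. (fst z, \<Phi> (fst z) (snd z)))"
  define H where "H = (\<lambda>z :: real \<times> 'a. (fst z, inv_into UNIV (\<Phi> (fst z)) (snd z)))"
  have F: "continuous_on S F" for S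
    unfolding F_def by (intro continuous_intros continuous_on_flow[OF cont])
  have HF: "H (F z) = z" "F (H z) = z" for z
    using bij_is_inj[OF bij] bij_is_surj[OF bij] by (simp_all add: F_def H_def surj_f_inv_f)
  have "continuous (at z) H" for z :: "real \<times> 'a"
  proof -
    \<comment> \<open>The margin 1 puts \<open>z\<close> in the interior of the time slab, so that
      continuity on the slab gives continuity at \<open>z\<close>.\<close>
    define n where "n = \<bar>fst z\<bar> + 1"
    have "continuous_on (F ` ({-n..n} \<times> UNIV)) H"
      by (rule continuous_on_inv[OF F]) (use compact HF in \<open>auto intro: compact_Times\<close>)
    moreover have "{-n<..<n} \<times> UNIV \<subseteq> F ` ({-n..n} \<times> UNIV)"
    proof
      fix y :: "real \<times> 'a" assume "y \<in> {-n<..<n} \<times> UNIV"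
      then have "H y \<in> {-n..n} \<times> UNIV" by (auto simp: H_def)
      then show "y \<in> F ` ({-n..n} \<times> UNIV)" using HF(2)[of y] by (metis image_eqI)
    qed
    ultimately have "continuous_on ({-n<..<n} \<times> UNIV) H" by (rule continuous_on_subset)
    moreover have "open ({-n<..<n} \<times> (UNIV :: 'a set))" by (intro open_Times) auto
    moreover have "z \<in> {-n<..<n} \<times> UNIV" by (cases z) (auto simp: n_def)
    ultimately show ?thesis using continuous_on_eq_continuous_at by blast
  qed
  then have "continuous_on UNIV H" by (simp add: continuous_at_imp_continuous_on)
  then have "continuous_on UNIV (\<lambda>z. snd (H z))" by (rule continuous_on_snd)
  then show ?thesis by (simp add: H_def case_prod_unfold)
qed

text \<open>Each single \<open>\<Phi> t\<close> has a smooth inverse by definition of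
  \<open>diffeos\<close>; differentiating the composite at fixed time exhibits a left inverse of the
  space derivative.\<close>

lemma flow_rep_space_injective:
  assumes \<Phi>: "jointly_smooth \<Phi>" and diff: "\<And>t. \<Phi> t \<in> diffeos A" and cd: "c \<in> A" "d \<in> A"
    and z: "(t, x) \<in> flow_dom \<Phi> c d" and h: "dirderiv (0, h) (flow_rep \<Phi> c d) (t, x) = 0"
  shows "h = 0"
proof -
  note \<Phi>D = jointly_smoothD[OF \<Phi>]
  let ?g = "inv_into UNIV (\<Phi> t)"
  let ?N = "coord d ` (chart_dom d \<inter> ?g -` chart_dom c)"
  let ?k = "\<lambda>y. coord c (?g (chart_inv d y))"
  have inj: "inj (\<Phi> t)" using diff by (simp add: diffeos_def bij_is_inj)
  have g: "continuous_on UNIV ?g" "smooth_on ?N ?k"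
    using diff[of t] cd unfolding diffeos_def smooth_map_def o_def by blast+
  have N: "open ?N"
    using open_chart_image_Int[OF cd(2)] open_vimage[OF chart(1)[OF cd(1)] g(1)] by blast
  have x: "x \<in> chart_image c" "\<Phi> t (chart_inv c x) \<in> chart_dom d" using z by (auto simp: flow_dom_iff)
  have gx: "?g (\<Phi> t p) = p" for p using inj by simp
  have "flow_rep \<Phi> c d (t, x) \<in> ?N"
    unfolding flow_rep_apply using x chart(6)[OF cd(1)] gx by (intro imageI) auto
  note k' = has_derivative_dirderiv[OF g(2) N this]
  have S: "open ((\<lambda>x. (t, x)) -` flow_dom \<Phi> c d)"
    by (intro open_vimage \<Phi>D cd continuous_intros)
  have "((\<lambda>x. ?k (flow_rep \<Phi> c d (t, x))) has_derivative
      (\<lambda>h. dirderiv (dirderiv (0, h) (flow_rep \<Phi> c d) (t, x)) ?k (flow_rep \<Phi> c d (t, x)))) (at x)"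
    by (rule has_derivative_compose[OF space_derivative[OF \<Phi>D(2)[OF cd] \<Phi>D(3)[OF cd] z] k'])
  then have "((\<lambda>x. x) has_derivative
      (\<lambda>h. dirderiv (dirderiv (0, h) (flow_rep \<Phi> c d) (t, x)) ?k (flow_rep \<Phi> c d (t, x)))) (at x)"
    by (rule has_derivative_transform_within_open[OF _ S])
       (use z chart(5)[OF cd(2)] chart(7)[OF cd(1)] gx in \<open>auto simp: flow_dom_iff flow_rep_apply\<close>)
  from has_derivative_unique[OF this has_derivative_ident]
  have "dirderiv (dirderiv (0, h) (flow_rep \<Phi> c d) (t, x)) ?k (flow_rep \<Phi> c d (t, x)) = h"
    by (rule fun_cong)
  moreover have "dirderiv 0 ?k (flow_rep \<Phi> c d (t, x)) = 0"
    using linear_0[OF has_derivative_linear[OF k']] .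
  ultimately show ?thesis using h by simp
qed

text \<open>Carrying time along turns the inverses at all times into one inverse of a map of (t, x).
  Its derivative is block triangular with 1 in the time corner, so injectivity reduces to that of
  the space derivative.\<close>

lemma jointly_smooth_inverse:
  assumes \<Phi>: "jointly_smooth \<Phi>" and diff: "\<And>t. \<Phi> t \<in> diffeos A"
  shows "jointly_smooth (\<lambda>t. inv_into UNIV (\<Phi> t))"
proof -
  note \<Phi>D = jointly_smoothD[OF \<Phi>]
  let ?\<Psi> = "\<lambda>t. inv_into UNIV (\<Phi> t)"
  have bij: "bij (\<Phi> t)" for t using diff by (simp add: diffeos_def)
  have cont: "continuous_on UNIV (\<lambda>(t, p). ?\<Psi> t p)"
    using continuous_on_inverse_flow[OF \<Phi>D(1) bij] .
  have inv: "?\<Psi> t (\<Phi> t p) = p" "\<Phi> t (?\<Psi> t p) = p" for t p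
    using bij_is_inj[OF bij] bij_is_surj[OF bij] by (simp_all add: surj_f_inv_f)
  have "smooth_on (flow_dom ?\<Psi> d c) (flow_rep ?\<Psi> d c)" if c: "c \<in> A" and d: "d \<in> A" for c d
  proof -
    let ?S = "flow_dom \<Phi> c d" and ?T = "flow_dom ?\<Psi> d c"
    define F where "F = (\<lambda>z. (fst z, flow_rep \<Phi> c d z))"
    define H where "H = (\<lambda>z. (fst z, flow_rep ?\<Psi> d c z))"
    have F: "smooth_on ?S F" unfolding F_def
      by (intro smooth_on_Pair smooth_on_fst smooth_on_id \<Phi>D c d)
    have "smooth_on ?T H"
    proof (rule smooth_on_inverse[OF F \<Phi>D(3)[OF c d] open_flow_dom[OF cont d c]])
      show "continuous_on ?T H" unfolding H_def
        by (intro continuous_intros continuous_on_flow_rep cont c d)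
      show "H ` ?T \<subseteq> ?S"
        using chart(5-6)[OF c] chart(6)[OF d] inv(2) by (auto simp: H_def flow_dom_iff flow_rep_apply)
      show "F (H y) = y" if "y \<in> ?T" for y
        using that chart(5)[OF c] chart(7)[OF d] inv(2)
        by (cases y) (auto simp: F_def H_def flow_dom_iff flow_rep_apply)
      show "inj (\<lambda>v. dirderiv v F z)" if z: "z \<in> ?S" for z
      proof -
        obtain t x where tx: "z = (t, x)" by (cases z)
        have DF: "dirderiv v F z = (fst v, dirderiv v (flow_rep \<Phi> c d) z)" for v
        proof (rule dirderiv_eqI)
          show "(F has_derivative (\<lambda>v. (fst v, dirderiv v (flow_rep \<Phi> c d) z))) (at z)"
            unfolding F_def using has_derivative_dirderiv[OF \<Phi>D(2,3)[OF c d] z]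
            by (intro has_derivative_Pair has_derivative_fst has_derivative_ident)
        qed
        have "v = 0" if "dirderiv v F z = 0" for v
        proof -
          obtain \<tau> h where v: "v = (\<tau>, h)" by (cases v)
          have "fst v = 0" "dirderiv v (flow_rep \<Phi> c d) z = 0"
            using that[unfolded DF] by (simp_all add: zero_prod_def)
          then show ?thesis
            using flow_rep_space_injective[OF \<Phi> diff c d] z unfolding tx v by (simp add: zero_prod_def)
        qed
        moreover have "linear (\<lambda>v. dirderiv v F z)"
          using has_derivative_linear[OF has_derivative_dirderiv[OF F \<Phi>D(3)[OF c d] z]] .
        ultimately show ?thesis using linear_injective_0 by blast
      qed
    qed
    from smooth_on_snd[OF this] show ?thesis by (simp add: H_def)
  qed
  with cont show ?thesis unfolding jointly_smooth_def by blast
qed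

lemma smooth_curve_flow:
  assumes \<Phi>: "jointly_smooth \<Phi>"
  shows "continuous_on UNIV (\<lambda>t. \<Phi> t p)"
    and "c \<in> A \<Longrightarrow> smooth_on {t. \<Phi> t p \<in> chart_dom c} (\<lambda>t. coord c (\<Phi> t p))"
proof -
  note \<Phi>D = jointly_smoothD[OF \<Phi>]
  show "continuous_on UNIV (\<lambda>t. \<Phi> t p)"
    by (intro continuous_on_flow[OF \<Phi>D(1)] continuous_intros)
  assume c: "c \<in> A"
  obtain d where d: "d \<in> A" "p \<in> chart_dom d" using chart_exists by blast
  have "smooth_on {t. \<Phi> t p \<in> chart_dom c} (\<lambda>t. flow_rep \<Phi> d c (t, coord d p))"
    by (rule smooth_on_compose[OF \<Phi>D(2)[OF d(1) c]])
       (use d chart(5)[OF d(1)] in \<open>auto simp: flow_dom_iff intro: smooth_on_Pair smooth_on_id smooth_on_const\<close>)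
  then show "smooth_on {t. \<Phi> t p \<in> chart_dom c} (\<lambda>t. coord c (\<Phi> t p))"
    using d chart(5)[OF d(1)] by (simp add: flow_rep_apply)
qed

lemma eventually_flow_in:
  assumes \<Phi>: "jointly_smooth \<Phi>" "\<Phi> 0 = id" and N: "open N" "p \<in> N"
  shows "\<forall>\<^sub>F t in at 0. \<Phi> t p \<in> N"
proof -
  have "isCont (\<lambda>t. \<Phi> t p) 0"
    using smooth_curve_flow(1)[OF \<Phi>(1)] continuous_on_eq_continuous_at[OF open_UNIV] by blast
  then have "((\<lambda>t. \<Phi> t p) \<longlongrightarrow> p) (at 0)" using \<Phi>(2) by (simp add: isCont_def)
  from topological_tendstoD[OF this N] show ?thesis .
qed

end

section \<open>Curves in a group of diffeomorphisms\<close>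

text \<open>Orders multiply under substitution. The limit is taken within \<open>J\<close> because
  the given curve may exist on one side of 0 only.\<close>

lemma leading_term_reparam:
  fixes \<gamma> :: "real \<Rightarrow> 'b::real_normed_vector"
  assumes \<gamma>: "((\<lambda>s. (\<gamma> s - \<gamma> 0) /\<^sub>R s ^ k) \<longlongrightarrow> v) (at 0 within J)"
    and \<tau>: "leading_term m \<tau> b" "m \<ge> 1" "\<tau> 0 = 0" "\<forall>\<^sub>F t in at 0. \<tau> t \<in> J \<and> \<tau> t \<noteq> 0"
  shows "leading_term (m * k) (\<lambda>t. \<gamma> (\<tau> t)) (b ^ k *\<^sub>R v)"
proof -
  have "filterlim \<tau> (at 0 within J) (at 0)"
    unfolding filterlim_at using \<tau>(4) leading_term_tendsto[OF \<tau>(1,2)] \<tau>(3) by simp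
  from filterlim_compose[OF \<gamma> this]
  have 1: "((\<lambda>t. (\<gamma> (\<tau> t) - \<gamma> 0) /\<^sub>R \<tau> t ^ k) \<longlongrightarrow> v) (at 0)" .
  have 2: "((\<lambda>t. \<tau> t /\<^sub>R t ^ m) \<longlongrightarrow> b) (at 0)"
    using \<tau>(1,3) unfolding leading_term_def by simp
  have "((\<lambda>t. (\<tau> t /\<^sub>R t ^ m) ^ k *\<^sub>R ((\<gamma> (\<tau> t) - \<gamma> 0) /\<^sub>R \<tau> t ^ k)) \<longlongrightarrow> b ^ k *\<^sub>R v) (at 0)"
    by (intro tendsto_intros 1 2)
  then show ?thesis unfolding leading_term_def
  proof (rule Lim_transform_eventually)
    show "\<forall>\<^sub>F t in at 0. (\<tau> t /\<^sub>R t ^ m) ^ k *\<^sub>R ((\<gamma> (\<tau> t) - \<gamma> 0) /\<^sub>R \<tau> t ^ k) =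
        (\<gamma> (\<tau> t) - \<gamma> (\<tau> 0)) /\<^sub>R t ^ (m * k)"
      using \<tau>(4)
    proof eventually_elim
      case (elim t)
      have "(\<tau> t /\<^sub>R t ^ m) ^ k * inverse (\<tau> t ^ k) = inverse (t ^ (m * k))"
        using elim by (simp add: power_mult power_mult_distrib power_inverse)
      then show ?case by (simp add: \<tau>(3))
    qed
  qed
qed

lemma leading_term_power: "leading_term m (\<lambda>t::real. t ^ m) 1" if "m \<ge> 1"
  unfolding leading_term_def
proof (rule Lim_transform_eventually[OF tendsto_const])
  show "\<forall>\<^sub>F t in at 0. 1 = (t ^ m - 0 ^ m) /\<^sub>R t ^ m"
    using eventually_at_0_nonzero by eventually_elim (use that in \<open>simp add: power_0_left\<close>)
qed

lemma leading_term_scaled_id: "leading_term 1 (\<lambda>t::real. b * t) b"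
  unfolding leading_term_def
proof (rule Lim_transform_eventually[OF tendsto_const])
  show "\<forall>\<^sub>F t in at 0. b = (b * t - b * 0) /\<^sub>R t ^ 1"
    using eventually_at_0_nonzero by eventually_elim simp
qed

lemma leading_term_sin_squared: "leading_term 2 (\<lambda>t::real. a * sin t ^ 2) a"
  unfolding leading_term_def
proof (rule Lim_transform_eventually)
  have "((\<lambda>t::real. sin t / t) \<longlongrightarrow> 1) (at 0)"
    using DERIV_sin[of 0] by (simp add: has_field_derivative_iff)
  then have "((\<lambda>t::real. a * (sin t / t) ^ 2) \<longlongrightarrow> a * 1 ^ 2) (at 0)" by (intro tendsto_intros)
  then show "((\<lambda>t::real. a * (sin t / t) ^ 2) \<longlongrightarrow> a) (at 0)" by simp
  show "\<forall>\<^sub>F t in at 0. a * (sin t / t) ^ 2 = (a * sin t ^ 2 - a * sin 0 ^ 2) /\<^sub>R t ^ 2"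
    by (simp add: power_divide field_simps)
qed

lemma eventually_sin_nonzero: "\<forall>\<^sub>F t in at 0. sin t \<noteq> (0::real)"
proof -
  have "((\<lambda>t::real. sin t / t) \<longlongrightarrow> 1) (at 0)"
    using DERIV_sin[of 0] by (simp add: has_field_derivative_iff)
  then have "\<forall>\<^sub>F t in at 0. 0 < sin t / (t::real)" by (rule order_tendstoD) simp
  then show ?thesis by eventually_elim auto
qed

section \<open>Derivatives on intervals that may end at 0\<close>

lemma time_interval_at_within:
  assumes I: "time_interval I" and U: "open U" "t \<in> I" "t \<in> U"
  shows "at t within (I \<inter> U) \<noteq> bot"
proof -
  have "connected I" using I unfolding time_interval_def by (simp add: is_interval_connected)
  moreover have "I \<noteq> {x}" for x using I unfolding time_interval_def by auto
  ultimately have "t islimpt I" using connected_imp_perfect U(2) by blast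
  then have "t islimpt I \<inter> U"
    using islimpt_Int_eventually eventually_at_in_open'[OF U(1,3)] by blast
  then show ?thesis by (simp add: trivial_limit_within)
qed

text \<open>\<open>I \<inter> U\<close> need not be an interval, since a curve can leave a chart and
  return; only the segments to small times are certain to stay inside.\<close>

lemma time_interval_segment:
  assumes I: "time_interval I" and U: "open U" "0 \<in> U"
  shows "\<forall>\<^sub>F t in at 0 within (I \<inter> U). closed_segment 0 t \<subseteq> I \<inter> U"
proof -
  obtain r where r: "r > 0" "ball 0 r \<subseteq> U" using U open_contains_ball by blast
  have "closed_segment 0 t \<subseteq> I \<inter> U" if "t \<in> I" "dist t 0 < r" for t
  proof -
    have "closed_segment 0 t \<subseteq> I"
      using I that(1) unfolding time_interval_def
      by (intro closed_segment_subset) (auto simp: is_interval_convex)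
    moreover have "closed_segment 0 t \<subseteq> ball 0 r"
      using that(2) r(1) by (intro closed_segment_subset) (auto simp: dist_norm)
    ultimately show ?thesis using r(2) by blast
  qed
  then show ?thesis unfolding eventually_at using r(1) by (intro exI[of _ r]) auto
qed

locale diffeo_subgroup = compact_manifold A
  for A :: "('a::{t2_space, second_countable_topology}, 'e::euclidean_space) chart set" +
  fixes G :: "('a \<Rightarrow> 'a) set"
  assumes subgroup: "subgroup G (Diff_group A)"
begin

lemma G_diffeos: "f \<in> G \<Longrightarrow> f \<in> diffeos A"
  using subgroup.subset[OF subgroup] by (auto simp: Diff_group_def)

lemma G_id: "id \<in> G"
  using subgroup.one_closed[OF subgroup] by (simp add: Diff_group_def)

lemma G_comp: "f \<in> G \<Longrightarrow> g \<in> G \<Longrightarrow> f \<circ> g \<in> G"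
  using subgroup.m_closed[OF subgroup] by (simp add: Diff_group_def)

lemma G_inv:
  assumes f: "f \<in> G" shows "inv_into UNIV f \<in> G"
proof -
  have bij: "bij f" "inv_into UNIV f \<in> diffeos A"
    using G_diffeos[OF f] by (auto simp: diffeos_def bij_imp_bij_inv inv_inv_eq)
  \<comment> \<open>\<open>m_inv\<close> is a definite description within \<open>diffeos A\<close>,
    so it has to be identified with the inverse function.\<close>
  have "m_inv (Diff_group A) f = inv_into UNIV f"
    unfolding m_inv_def Diff_group_def
  proof (simp, rule the_equality)
    show "inv_into UNIV f \<in> diffeos A \<and> f \<circ> inv_into UNIV f = id \<and> inv_into UNIV f \<circ> f = id"
      using bij by (simp add: bij_is_inj bij_is_surj surj_iff[THEN iffD1])
    show "g = inv_into UNIV f" if "g \<in> diffeos A \<and> f \<circ> g = id \<and> g \<circ> f = id" for g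
      using that inv_unique_comp by metis
  qed
  then show ?thesis using subgroup.m_inv_closed[OF subgroup f] by simp
qed

text \<open>\<open>X\<close> is not asked to be a vector field, so the notion applies to a sum or a
  bracket before that is known.\<close>

definition leading_flow :: "nat \<Rightarrow> (real \<Rightarrow> 'a \<Rightarrow> 'a) \<Rightarrow> ('a, 'e) vfield \<Rightarrow> bool" where
  "leading_flow k \<Phi> X \<longleftrightarrow> k \<ge> 1 \<and> (\<forall>t. \<Phi> t \<in> G) \<and> jointly_smooth \<Phi> \<and> \<Phi> 0 = id \<and>
     (\<forall>p. \<forall>c\<in>A. p \<in> chart_dom c \<longrightarrow> leading_term k (\<lambda>t. coord c (\<Phi> t p)) (X p c))"

lemma leading_flowD:
  assumes "leading_flow k \<Phi> X"
  shows "k \<ge> 1" "\<Phi> t \<in> G" "jointly_smooth \<Phi>" "\<Phi> 0 = id"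
    "c \<in> A \<Longrightarrow> p \<in> chart_dom c \<Longrightarrow> leading_term k (\<lambda>t. coord c (\<Phi> t p)) (X p c)"
  using assms unfolding leading_flow_def by blast+

lemma flow_rep_chart:
  "c \<in> A \<Longrightarrow> q \<in> chart_dom c \<Longrightarrow> flow_rep \<Phi> c c (t, coord c q) = coord c (\<Phi> t q)"
  by (simp add: flow_rep_apply chart(5))

lemma flow_at_0:
  assumes "\<Phi> 0 = id" "c \<in> A"
  shows "(0, x) \<in> flow_dom \<Phi> c c \<longleftrightarrow> x \<in> chart_image c"
    and "x \<in> chart_image c \<Longrightarrow> flow_rep \<Phi> c c (0, x) = x"
  using assms chart(6,7)[OF assms(2)] by (auto simp: flow_dom_iff flow_rep_apply)

lemma leading_flow_rep:
  assumes "leading_flow k \<Phi> X" "c \<in> A" "x \<in> chart_image c"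
  shows "leading_term k (\<lambda>t. flow_rep \<Phi> c c (t, x)) (local_rep c X x)"
  using leading_flowD(5)[OF assms(1,2) chart(6)[OF assms(2,3)]]
  by (simp add: flow_rep_apply local_rep_def)

text \<open>The transformation rule of \<open>X\<close> under a change of charts is not assumed but derived from the curves;
  in particular it need not be computed for the bracket.\<close>

lemma leading_flow_tangent:
  assumes \<Phi>: "leading_flow k \<Phi> X" and 0: "\<And>c. c \<notin> A \<or> p \<notin> chart_dom c \<Longrightarrow> X p c = 0"
  shows "X p \<in> tangent_space A p"
proof -
  note \<Phi>D = leading_flowD[OF \<Phi>]
  have "X p d = frechet_derivative (coord d \<circ> chart_inv c) (at (coord c p)) (X p c)"
    if c: "c \<in> A" and d: "d \<in> A" and p: "p \<in> chart_dom c \<inter> chart_dom d" for c d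
  proof -
    have "leading_term k (\<lambda>t. coord d (chart_inv c (coord c (\<Phi> t p))))
        (dirderiv (X p c) (\<lambda>x. coord d (chart_inv c x)) (coord c p))"
    proof (rule leading_term_chain[OF \<Phi>D(5)[OF c] \<Phi>D(1)])
      show "((\<lambda>x. coord d (chart_inv c x)) has_derivative
          (\<lambda>v. dirderiv v (\<lambda>x. coord d (chart_inv c x)) (coord c p))) (at (coord c (\<Phi> 0 p)))"
        using has_derivative_dirderiv[OF transition_smooth[OF c d] open_chart_image_Int[OF c chart(1)[OF d]]] p
        by (simp add: \<Phi>D(4))
    qed (use p in simp)
    then have "leading_term k (\<lambda>t. coord d (\<Phi> t p))
        (dirderiv (X p c) (\<lambda>x. coord d (chart_inv c x)) (coord c p))"
    proof (rule leading_term_cong)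
      have "\<forall>\<^sub>F t in at 0. \<Phi> t p \<in> chart_dom c"
        using eventually_flow_in[OF \<Phi>D(3,4) chart(1)[OF c]] p by blast
      then show "\<forall>\<^sub>F t in at 0. coord d (chart_inv c (coord c (\<Phi> t p))) = coord d (\<Phi> t p)"
        by eventually_elim (simp add: chart(5)[OF c])
    qed (use p in \<open>simp add: \<Phi>D(4) chart(5)[OF c]\<close>)
    moreover have "leading_term k (\<lambda>t. coord d (\<Phi> t p)) (X p d)" using \<Phi>D(5)[OF d] p by blast
    ultimately have "X p d = dirderiv (X p c) (\<lambda>x. coord d (chart_inv c x)) (coord c p)"
      unfolding leading_term_def using tendsto_unique[OF at_neq_bot] by blast
    then show ?thesis by (simp add: dirderiv_def o_def)
  qed
  then show ?thesis unfolding tangent_space_def using 0 by blast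
qed

lemma leading_flow_vector_field:
  assumes "leading_flow k \<Phi> X" "\<And>p c. c \<notin> A \<or> p \<notin> chart_dom c \<Longrightarrow> X p c = 0"
    and "\<And>c. c \<in> A \<Longrightarrow> smooth_on (chart_image c) (local_rep c X)"
  shows "X \<in> vector_fields A"
  unfolding vector_fields_def using leading_flow_tangent[OF assms(1,2)] assms(3) by blast

lemma vector_fieldD:
  assumes "X \<in> vector_fields A"
  shows "c \<notin> A \<or> p \<notin> chart_dom c \<Longrightarrow> X p c = 0" "c \<in> A \<Longrightarrow> smooth_on (chart_image c) (local_rep c X)"
    "X p \<in> tangent_space A p"
  using assms unfolding vector_fields_def tangent_space_def by blast+

lemma leading_flow_reparam:
  assumes \<Phi>: "leading_flow k \<Phi> X" and \<tau>: "smooth_on UNIV \<tau>" "leading_term m \<tau> b" "m \<ge> 1" "\<tau> 0 = 0"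
    "\<forall>\<^sub>F t in at 0. \<tau> t \<noteq> 0"
  shows "leading_flow (m * k) (\<lambda>t. \<Phi> (\<tau> t)) (\<lambda>p c. b ^ k *\<^sub>R X p c)"
  unfolding leading_flow_def
proof (intro conjI allI ballI impI)
  note \<Phi>D = leading_flowD[OF \<Phi>]
  show "1 \<le> m * k" using \<Phi>D(1) \<tau>(3) by (simp add: Suc_le_eq)
  show "\<Phi> (\<tau> t) \<in> G" for t using \<Phi>D(2) .
  have "smooth_diffeo_curve A UNIV \<Phi>" unfolding smooth_diffeo_curve_UNIV using \<Phi>D G_diffeos by blast
  then show "jointly_smooth (\<lambda>t. \<Phi> (\<tau> t))" by (rule jointly_smooth_reparam[OF _ \<tau>(1)]) simp
  show "\<Phi> (\<tau> 0) = id" using \<Phi>D(4) \<tau>(4) by simp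
  fix p c assume c: "c \<in> A" "p \<in> chart_dom c"
  show "leading_term (m * k) (\<lambda>t. coord c (\<Phi> (\<tau> t) p)) (b ^ k *\<^sub>R X p c)"
    using leading_term_reparam[where \<gamma> = "\<lambda>t. coord c (\<Phi> t p)" and k = k and v = "X p c" and J = UNIV and \<tau> = \<tau> and m = m and b = b] \<Phi>D(5)[OF c] \<tau>
    unfolding leading_term_def by simp
qed

text \<open>With unequal orders only the field of the lower order would survive in the leading term;
  hence the common \<open>k\<close>.\<close>

lemma leading_flow_compose:
  assumes \<Phi>: "leading_flow k \<Phi> X" and \<Psi>: "leading_flow k \<Psi> Y"
  shows "leading_flow k (\<lambda>t. \<Phi> t \<circ> \<Psi> t) (\<lambda>p c. X p c + Y p c)"
  unfolding leading_flow_def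
proof (intro conjI allI ballI impI)
  note \<Phi>D = leading_flowD[OF \<Phi>] and \<Psi>D = leading_flowD[OF \<Psi>]
  show "1 \<le> k" using \<Phi>D(1) .
  show "\<Phi> t \<circ> \<Psi> t \<in> G" for t using G_comp \<Phi>D(2) \<Psi>D(2) .
  show "jointly_smooth (\<lambda>t. \<Phi> t \<circ> \<Psi> t)" using jointly_smooth_compose \<Phi>D(3) \<Psi>D(3) .
  show "\<Phi> 0 \<circ> \<Psi> 0 = id" using \<Phi>D(4) \<Psi>D(4) by simp
  fix p c assume c: "c \<in> A" and p: "p \<in> chart_dom c"
  have x: "coord c p \<in> chart_image c" using p by simp
  have "leading_term k (\<lambda>t. flow_rep \<Phi> c c (t, coord c (\<Psi> t p))) (X p c + Y p c)"
  proof (rule leading_term_compose_near_identity[OF jointly_smoothD(2,3)[OF \<Phi>D(3) c c] _ _ _ \<Psi>D(5)[OF c p] _ \<Phi>D(1)])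
    show "(0, coord c p) \<in> flow_dom \<Phi> c c" using flow_at_0(1)[where \<Phi> = \<Phi>, OF \<Phi>D(4) c] x by blast
    show "flow_rep \<Phi> c c (0, x) = x" if "(0, x) \<in> flow_dom \<Phi> c c" for x
      using flow_at_0[where \<Phi> = \<Phi>, OF \<Phi>D(4) c] that by blast
    show "leading_term k (\<lambda>t. flow_rep \<Phi> c c (t, coord c p)) (X p c)"
      using \<Phi>D(5)[OF c p] by (simp add: flow_rep_chart[OF c p])
  qed (simp add: \<Psi>D(4))
  then show "leading_term k (\<lambda>t. coord c ((\<Phi> t \<circ> \<Psi> t) p)) (X p c + Y p c)"
  proof (rule leading_term_cong)
    show "\<forall>\<^sub>F t in at 0. flow_rep \<Phi> c c (t, coord c (\<Psi> t p)) = coord c ((\<Phi> t \<circ> \<Psi> t) p)"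
      using eventually_flow_in[OF \<Psi>D(3,4) chart(1)[OF c] p]
      by eventually_elim (simp add: flow_rep_chart[OF c])
  qed (simp add: flow_rep_chart[OF c] p \<Psi>D(4))
qed

lemma flow_inverse:
  assumes "leading_flow k \<Phi> X"
  shows "inv_into UNIV (\<Phi> t) (\<Phi> t p) = p" "\<Phi> t (inv_into UNIV (\<Phi> t) p) = p"
proof -
  have "bij (\<Phi> t)" using G_diffeos[OF leading_flowD(2)[OF assms]] by (simp add: diffeos_def)
  then show "inv_into UNIV (\<Phi> t) (\<Phi> t p) = p" "\<Phi> t (inv_into UNIV (\<Phi> t) p) = p"
    by (simp_all add: bij_is_inj bij_is_surj surj_f_inv_f)
qed

text \<open>The inverses carry the curve \<open>\<Phi> t p\<close> back to \<open>p\<close>. As they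
  are near the identity, they displace \<open>p\<close> itself by the opposite amount to leading
  order.\<close>

lemma leading_flow_inverse:
  assumes \<Phi>: "leading_flow k \<Phi> X"
  shows "leading_flow k (\<lambda>t. inv_into UNIV (\<Phi> t)) (\<lambda>p c. - X p c)"
  unfolding leading_flow_def
proof (intro conjI allI ballI impI)
  let ?\<Psi> = "\<lambda>t. inv_into UNIV (\<Phi> t)"
  note \<Phi>D = leading_flowD[OF \<Phi>]
  show "1 \<le> k" using \<Phi>D(1) .
  show "?\<Psi> t \<in> G" for t using G_inv \<Phi>D(2) .
  show sm: "jointly_smooth ?\<Psi>" by (rule jointly_smooth_inverse[OF \<Phi>D(3) G_diffeos[OF \<Phi>D(2)]])
  show \<Psi>0: "?\<Psi> 0 = id" using \<Phi>D(4) by simp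
  fix p c assume c: "c \<in> A" and p: "p \<in> chart_dom c"
  have x: "coord c p \<in> chart_image c" using p by simp
  have "leading_term k (\<lambda>t. flow_rep ?\<Psi> c c (t, coord c p)) (- X p c)"
  proof (rule leading_term_left_inverse[OF jointly_smoothD(2,3)[OF sm c c] _ _ \<Phi>D(5)[OF c p] _ \<Phi>D(1)])
    show "(0, coord c p) \<in> flow_dom ?\<Psi> c c" using flow_at_0(1)[where \<Phi> = ?\<Psi>, OF \<Psi>0 c] x by blast
    show "flow_rep ?\<Psi> c c (0, x) = x" if "(0, x) \<in> flow_dom ?\<Psi> c c" for x
      using flow_at_0[where \<Phi> = ?\<Psi>, OF \<Psi>0 c] that by blast
    show "\<forall>\<^sub>F t in at 0. flow_rep ?\<Psi> c c (t, coord c (\<Phi> t p)) = coord c p"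
      using eventually_flow_in[OF \<Phi>D(3,4) chart(1)[OF c] p]
      by eventually_elim (simp add: flow_rep_chart[OF c] flow_inverse[OF \<Phi>])
  qed (simp add: \<Phi>D(4))
  then show "leading_term k (\<lambda>t. coord c (?\<Psi> t p)) (- X p c)"
    by (simp add: flow_rep_chart[OF c p])
qed

text \<open>With \<open>Q = \<Phi> \<circ> \<Psi>\<close> and \<open>P = \<Psi> \<circ> \<Phi>\<close>, the difference \<open>P - Q\<close> has the bracket as leading term, and
  \<open>Q\<^sup>-\<^sup>1 P - id = Q\<^sup>-\<^sup>1 P - Q\<^sup>-\<^sup>1 Q\<close> has the same one since \<open>Q\<^sup>-\<^sup>1\<close> is near the identity.\<close>

lemma leading_flow_commutator:
  assumes \<Phi>: "leading_flow k \<Phi> X" and \<Psi>: "leading_flow l \<Psi> Y"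
    and X: "X \<in> vector_fields A" and Y: "Y \<in> vector_fields A"
  shows "leading_flow (l + k) (\<lambda>t. inv_into UNIV (\<Phi> t \<circ> \<Psi> t) \<circ> (\<Psi> t \<circ> \<Phi> t)) (lie_bracket A X Y)"
  unfolding leading_flow_def
proof (intro conjI allI ballI impI)
  let ?Q = "\<lambda>t. \<Phi> t \<circ> \<Psi> t" and ?P = "\<lambda>t. \<Psi> t \<circ> \<Phi> t"
  let ?R = "\<lambda>t. inv_into UNIV (\<Phi> t \<circ> \<Psi> t)"
  note \<Phi>D = leading_flowD[OF \<Phi>] and \<Psi>D = leading_flowD[OF \<Psi>]
  show "1 \<le> l + k" using \<Phi>D(1) by simp
  have QG: "?Q t \<in> G" and PG: "?P t \<in> G" for t using G_comp \<Phi>D(2) \<Psi>D(2) by blast+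
  show "?R t \<circ> ?P t \<in> G" for t using G_comp[OF G_inv[OF QG] PG] .
  have smQ: "jointly_smooth ?Q" and smP: "jointly_smooth ?P"
    using jointly_smooth_compose \<Phi>D(3) \<Psi>D(3) by blast+
  have smR: "jointly_smooth ?R" by (rule jointly_smooth_inverse[OF smQ G_diffeos[OF QG]])
  show "jointly_smooth (\<lambda>t. ?R t \<circ> ?P t)" by (rule jointly_smooth_compose[OF smR smP])
  have 0: "?Q 0 = id" "?P 0 = id" "?R 0 = id" using \<Phi>D(4) \<Psi>D(4) by simp_all
  then show "?R 0 \<circ> ?P 0 = id" by simp
  have RQ: "?R t (?Q t q) = q" for t q
    using G_diffeos[OF QG[of t]] by (simp add: diffeos_def bij_is_inj del: o_apply)
  fix p c assume c: "c \<in> A" and p: "p \<in> chart_dom c"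
  let ?x = "coord c p" and ?U = "chart_image c"
  \<comment> \<open>\<open>\<Psi>\<close> takes the part of \<open>a\<close> and
    \<open>\<Phi>\<close> that of \<open>b\<close> in \<open>commutator_leading\<close>: this
    exchange yields the sign of \<open>lie_bracket A X Y\<close> and the order in the form
    \<open>l + k\<close>.\<close>
  let ?a = "flow_rep \<Psi> c c" and ?b = "flow_rep \<Phi> c c" and ?r = "flow_rep ?R c c"
  have x: "?x \<in> ?U" using p by simp
  have "((\<lambda>t. (?a (t, ?b (t, ?x)) - ?b (t, ?a (t, ?x))) /\<^sub>R t ^ (l + k)) \<longlongrightarrow>
      dirderiv (local_rep c X ?x) (local_rep c Y) ?x - dirderiv (local_rep c Y ?x) (local_rep c X) ?x) (at 0)"
    by (rule commutator_leading[OF chart(2)[OF c] x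
          jointly_smoothD(2,3)[OF \<Psi>D(3) c c] flow_at_0(1)[where \<Phi> = \<Psi>, OF \<Psi>D(4) c, THEN iffD2] flow_at_0(2)[where \<Phi> = \<Psi>, OF \<Psi>D(4) c]
          leading_flow_rep[OF \<Psi> c] vector_fieldD(2)[OF Y c] \<Psi>D(1)
          jointly_smoothD(2,3)[OF \<Phi>D(3) c c] flow_at_0(1)[where \<Phi> = \<Phi>, OF \<Phi>D(4) c, THEN iffD2] flow_at_0(2)[where \<Phi> = \<Phi>, OF \<Phi>D(4) c]
          leading_flow_rep[OF \<Phi> c] vector_fieldD(2)[OF X c] \<Phi>D(1)])
  moreover have "dirderiv (local_rep c X ?x) (local_rep c Y) ?x - dirderiv (local_rep c Y ?x) (local_rep c X) ?x
      = lie_bracket A X Y p c"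
    using c p by (simp add: lie_bracket_def dirderiv_def local_rep_def chart(5)[OF c])
  ultimately have "((\<lambda>t. (?a (t, ?b (t, ?x)) - ?b (t, ?a (t, ?x))) /\<^sub>R t ^ (l + k)) \<longlongrightarrow> lie_bracket A X Y p c) (at 0)"
    by simp
  then have lim: "((\<lambda>t. (coord c (?P t p) - coord c (?Q t p)) /\<^sub>R t ^ (l + k)) \<longlongrightarrow> lie_bracket A X Y p c) (at 0)"
  proof (rule Lim_transform_eventually)
    show "\<forall>\<^sub>F t in at 0. (?a (t, ?b (t, ?x)) - ?b (t, ?a (t, ?x))) /\<^sub>R t ^ (l + k)
        = (coord c (?P t p) - coord c (?Q t p)) /\<^sub>R t ^ (l + k)"
      using eventually_flow_in[OF \<Phi>D(3,4) chart(1)[OF c] p] eventually_flow_in[OF \<Psi>D(3,4) chart(1)[OF c] p]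
      by eventually_elim (simp add: flow_rep_chart[OF c] p)
  qed
  have tends: "((\<lambda>t. coord c (H t p)) \<longlongrightarrow> ?x) (at 0)" if H: "jointly_smooth H" "H 0 = id" for H
  proof -
    have "((\<lambda>t. H t p) \<longlongrightarrow> p) (at 0)"
      by (rule topological_tendstoI) (rule eventually_flow_in[OF H])
    moreover have "isCont (coord c) p"
      using chart(1,3)[OF c] p continuous_on_eq_continuous_at by blast
    ultimately show ?thesis using isCont_tendsto_compose by blast
  qed
  have "((\<lambda>t. (?r (t, coord c (?P t p)) - ?r (t, coord c (?Q t p))) /\<^sub>R t ^ (l + k)) \<longlongrightarrow> lie_bracket A X Y p c) (at 0)"
  proof (rule near_identity_leading[OF jointly_smoothD(2,3)[OF smR c c] _ _ tends[OF smP 0(2)] tends[OF smQ 0(1)] lim])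
    show "(0, ?x) \<in> flow_dom ?R c c" using flow_at_0(1)[where \<Phi> = ?R, OF 0(3) c] x by blast
    show "?r (0, x) = x" if "(0, x) \<in> flow_dom ?R c c" for x
      using flow_at_0[where \<Phi> = ?R, OF 0(3) c] that by blast
  qed
  then show "leading_term (l + k) (\<lambda>t. coord c ((?R t \<circ> ?P t) p)) (lie_bracket A X Y p c)"
    unfolding leading_term_def
  proof (rule Lim_transform_eventually)
    have R0: "(?R 0 \<circ> ?P 0) p = p" using 0 by simp
    show "\<forall>\<^sub>F t in at 0. (?r (t, coord c (?P t p)) - ?r (t, coord c (?Q t p))) /\<^sub>R t ^ (l + k)
       = (coord c ((?R t \<circ> ?P t) p) - coord c ((?R 0 \<circ> ?P 0) p)) /\<^sub>R t ^ (l + k)"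
      using eventually_flow_in[OF smP 0(2) chart(1)[OF c] p] eventually_flow_in[OF smQ 0(1) chart(1)[OF c] p]
    proof eventually_elim
      case (elim t)
      have "?r (t, coord c (?P t p)) = coord c ((?R t \<circ> ?P t) p)"
        using flow_rep_chart[OF c elim(1), of ?R t] by simp
      moreover have "?r (t, coord c (?Q t p)) = ?x"
        using flow_rep_chart[OF c elim(2), of ?R t] RQ[of t p] by metis
      ultimately show ?case using R0 by metis
    qed
  qed
qed

lemma leading_flow_integral_curve:
  assumes \<Phi>: "leading_flow k \<Phi> X" and X: "X \<in> vector_fields A"
    and Y: "(\<lambda>p c. fact k *\<^sub>R X p c) \<in> vector_fields A"
  shows "integral_curve A UNIV \<Phi> (\<lambda>p c. fact k *\<^sub>R X p c)"
proof -
  note \<Phi>D = leading_flowD[OF \<Phi>]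
  have "kth_order_integral_curve A k UNIV (\<lambda>t. \<Phi> t p) p (\<lambda>c. fact k *\<^sub>R X p c)" for p
    unfolding kth_order_integral_curve_def
  proof (intro conjI ballI impI)
    show "smooth_curve A UNIV (\<lambda>t. \<Phi> t p)"
      unfolding smooth_curve_def o_def using smooth_curve_flow[OF \<Phi>D(3)] by simp
    show "\<Phi> 0 p = p" using \<Phi>D(4) by simp
    show "(\<lambda>c. fact k *\<^sub>R X p c) \<in> tangent_space A p" using vector_fieldD(3)[OF Y] .
    fix c assume c: "c \<in> A" and p: "p \<in> chart_dom c"
    let ?J = "{t \<in> UNIV. \<Phi> t p \<in> chart_dom c}" and ?f = "coord c \<circ> (\<lambda>t. \<Phi> t p)"
    have J: "open ?J" "0 \<in> ?J"
      using open_vimage[OF chart(1)[OF c] smooth_curve_flow(1)[OF \<Phi>D(3)], of p] p \<Phi>D(4)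
      by (simp_all add: vimage_def)
    have f: "smooth_on ?J ?f" using smooth_curve_flow(2)[OF \<Phi>D(3) c, of p] by (simp add: o_def)
    have lim: "((\<lambda>t. (?f t - ?f 0) /\<^sub>R t ^ k) \<longlongrightarrow> X p c) (at 0 within ?J)"
      using \<Phi>D(5)[OF c p] unfolding leading_term_def at_within_open[OF J(2,1)] by simp
    note hv = higher_vector_derivative_eqI[OF eventually_closed_segment_open[OF J] J(2) f
        at_within_open_not_bot[OF J(1)] \<Phi>D(1) lim]
    show "higher_vector_derivative j ?f ?J 0 = 0" if "j \<in> {1..<k}" for j using hv(1) that by blast
    show "higher_vector_derivative k ?f ?J 0 = fact k *\<^sub>R X p c" using hv(2) by blast
  qed
  moreover have "smooth_diffeo_curve A UNIV \<Phi>"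
    unfolding smooth_diffeo_curve_UNIV using \<Phi>D(2,3) G_diffeos by blast
  moreover have "time_interval UNIV" unfolding time_interval_def
    by (auto simp: is_interval_univ)
  ultimately show ?thesis unfolding integral_curve_def using \<Phi>D(1,4) by blast
qed

text \<open>The factor is \<open>a ^ k / fact k\<close>, which is negative for \<open>a < 0\<close>
  and odd \<open>k\<close>. Only \<open>r \<noteq> 0\<close> is recorded; scaling by an arbitrary
  real number removes it later.\<close>

lemma integral_curve_leading_flow:
  assumes \<phi>: "integral_curve A I \<phi> X" "\<And>t. t \<in> I \<Longrightarrow> \<phi> t \<in> G"
  shows "\<exists>k \<Phi> r. r \<noteq> 0 \<and> leading_flow k \<Phi> (\<lambda>p c. r *\<^sub>R X p c)"
proof -
  have I: "time_interval I" and smooth: "smooth_diffeo_curve A I \<phi>" and \<phi>0: "\<phi> 0 = id"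
    using \<phi>(1) unfolding integral_curve_def by blast+
  obtain k where k: "k \<ge> 1" "\<And>p. kth_order_integral_curve A k I (\<lambda>t. \<phi> t p) p (X p)"
    using \<phi>(1) unfolding integral_curve_def by blast
  \<comment> \<open>Any other time will do, on either side of 0: by convexity \<open>I\<close>
    contains the segment from 0 to \<open>a\<close>, which is the range of
    \<open>\<tau>\<close>.\<close>
  obtain a where a: "a \<in> I" "a \<noteq> 0" using I unfolding time_interval_def by blast
  define \<tau> where "\<tau> = (\<lambda>t::real. a * sin t ^ 2)"
  have \<tau>I: "\<tau> t \<in> I" for t
  proof -
    have "0 \<in> I" "convex I" using I unfolding time_interval_def by (auto simp: is_interval_convex)
    moreover have "sin t ^ 2 \<le> 1" by (simp add: abs_square_le_1)
    ultimately have "(1 - sin t ^ 2) *\<^sub>R 0 + sin t ^ 2 *\<^sub>R a \<in> I"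
      using a(1) by (intro convexD) auto
    then show ?thesis by (simp add: \<tau>_def mult.commute)
  qed
  have \<tau>s: "smooth_on UNIV \<tau>" unfolding \<tau>_def
    by (intro smooth_on_bilinear[OF bounded_bilinear_mult] smooth_on_const smooth_on_power smooth_on_sin)
  have \<tau>l: "leading_term 2 \<tau> a" unfolding \<tau>_def by (rule leading_term_sin_squared)
  have \<tau>0: "\<tau> 0 = 0" by (simp add: \<tau>_def)
  have \<tau>n: "\<forall>\<^sub>F t in at 0. \<tau> t \<noteq> 0"
    using eventually_sin_nonzero by eventually_elim (simp add: \<tau>_def a(2))
  have sm: "jointly_smooth (\<lambda>t. \<phi> (\<tau> t))" by (rule jointly_smooth_reparam[OF smooth \<tau>s \<tau>I])
  have "leading_flow (2 * k) (\<lambda>t. \<phi> (\<tau> t)) (\<lambda>p c. (a ^ k / fact k) *\<^sub>R X p c)"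
    unfolding leading_flow_def
  proof (intro conjI allI ballI impI)
    show "1 \<le> 2 * k" using k by simp
    show "\<phi> (\<tau> t) \<in> G" for t using \<phi>(2) \<tau>I by blast
    show "jointly_smooth (\<lambda>t. \<phi> (\<tau> t))" by (rule sm)
    show "\<phi> (\<tau> 0) = id" using \<phi>0 \<tau>0 by simp
    fix p c assume c: "c \<in> A" and p: "p \<in> chart_dom c"
    let ?J = "{t \<in> I. \<phi> t p \<in> chart_dom c}" and ?f = "coord c \<circ> (\<lambda>t. \<phi> t p)"
    have curve: "continuous_on I (\<lambda>t. \<phi> t p)" "smooth_on ?J ?f"
      using k(2)[of p] c unfolding kth_order_integral_curve_def smooth_curve_def by blast+
    have hv: "\<And>j. j \<in> {1..<k} \<Longrightarrow> higher_vector_derivative j ?f ?J 0 = 0"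
      "higher_vector_derivative k ?f ?J 0 = X p c"
      using k(2)[of p] c p unfolding kth_order_integral_curve_def by blast+
    \<comment> \<open>The times spent in the chart are only relatively open in \<open>I\<close>;
      \<open>U\<close> is an open set cutting them out.\<close>
    obtain U where U: "open U" "U \<inter> I = (\<lambda>t. \<phi> t p) -` chart_dom c \<inter> I"
      using curve(1)[unfolded continuous_on_open_invariant] chart(1)[OF c] by blast
    have JU: "?J = I \<inter> U" using U(2) by blast
    have 0: "0 \<in> ?J" using I p \<phi>0 unfolding time_interval_def by simp
    have lim: "((\<lambda>t. (?f t - ?f 0) /\<^sub>R t ^ k) \<longlongrightarrow> X p c /\<^sub>R fact k) (at 0 within ?J)"
      using higher_vector_derivative_tendsto[OF _ 0 curve(2) _ k(1) hv(1)] hv(2)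
        time_interval_segment[OF I U(1)] time_interval_at_within[OF I U(1)] 0 unfolding JU by auto
    have "\<forall>\<^sub>F t in at 0. \<phi> (\<tau> t) p \<in> chart_dom c"
      using eventually_flow_in[OF sm _ chart(1)[OF c] p] \<phi>0 \<tau>0 by simp
    with \<tau>n have "\<forall>\<^sub>F t in at 0. \<tau> t \<in> ?J \<and> \<tau> t \<noteq> 0"
      by eventually_elim (simp add: \<tau>I)
    from leading_term_reparam[OF lim \<tau>l _ \<tau>0 this]
    show "leading_term (2 * k) (\<lambda>t. coord c (\<phi> (\<tau> t) p)) ((a ^ k / fact k) *\<^sub>R X p c)"
      by (simp add: divide_inverse)
  qed
  moreover have "a ^ k / fact k \<noteq> 0" using a by simp
  ultimately show ?thesis by blast
qed

end

section \<open>Closure of tangent fields under linear operations and brackets\<close>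

context diffeo_subgroup
begin

lemma leading_flow_zero: "leading_flow 1 (\<lambda>t. id) (\<lambda>p c. 0)"
  unfolding leading_flow_def using G_id jointly_smooth_id by (simp add: leading_term_def)

text \<open>Substituting \<open>b * t\<close> multiplies the coefficient by \<open>b ^ k\<close>,
  whence the k-th root. The order is preserved, which matters when the factorial of this very
  \<open>k\<close> is to be cancelled.\<close>

lemma leading_flow_scale_pos:
  assumes \<Phi>: "leading_flow k \<Phi> X" and "s > 0"
  shows "\<exists>\<Phi>'. leading_flow k \<Phi>' (\<lambda>p c. s *\<^sub>R X p c)"
proof -
  define b where "b = root k s"
  have k: "k > 0" using leading_flowD(1)[OF \<Phi>] by simp
  have b: "b ^ k = s" "b \<noteq> 0" using k \<open>s > 0\<close> by (simp_all add: b_def)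
  have "leading_flow (1 * k) (\<lambda>t. \<Phi> (b * t)) (\<lambda>p c. b ^ k *\<^sub>R X p c)"
  proof (rule leading_flow_reparam[OF \<Phi> _ leading_term_scaled_id])
    show "smooth_on UNIV (\<lambda>t. b * t)" by (rule smooth_on_linear) (rule bounded_linear_mult_right)
    show "\<forall>\<^sub>F t in at 0. b * t \<noteq> 0" using eventually_at_0_nonzero by eventually_elim (simp add: b)
  qed simp_all
  then show ?thesis using b by auto
qed

text \<open>A negative time factor does not change the sign for even orders, so inversion supplies
  it; the constant curve supplies the factor 0.\<close>

lemma leading_flow_scale:
  assumes \<Phi>: "leading_flow k \<Phi> X"
  shows "\<exists>k \<Phi>. leading_flow k \<Phi> (\<lambda>p c. r *\<^sub>R X p c)"
proof (cases r "0::real" rule: linorder_cases)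
  case less
  then have "\<exists>\<Phi>'. leading_flow k \<Phi>' (\<lambda>p c. (- r) *\<^sub>R (- X p c))"
    by (intro leading_flow_scale_pos[OF leading_flow_inverse[OF \<Phi>]]) simp
  then show ?thesis by auto
next
  case equal
  then show ?thesis using leading_flow_zero by auto
next
  case greater
  then show ?thesis using leading_flow_scale_pos[OF \<Phi>] by blast
qed

text \<open>Substituting \<open>t ^ l\<close> in the first curve and \<open>t ^ k\<close> in the
  second brings both to order \<open>l * k\<close> with unchanged coefficients.\<close>

lemma leading_flow_add:
  assumes \<Phi>: "leading_flow k \<Phi> X" and \<Psi>: "leading_flow l \<Psi> Y"
  shows "\<exists>m \<Xi>. leading_flow m \<Xi> (\<lambda>p c. X p c + Y p c)"
proof -
  have power: "leading_flow (m * k) (\<lambda>t. \<Phi> (t ^ m)) X" if "leading_flow k \<Phi> X" "m \<ge> 1" for m k \<Phi> X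
  proof -
    have "leading_flow (m * k) (\<lambda>t. \<Phi> (t ^ m)) (\<lambda>p c. 1 ^ k *\<^sub>R X p c)"
    proof (rule leading_flow_reparam[OF that(1) _ leading_term_power[OF that(2)] that(2)])
      show "smooth_on UNIV (\<lambda>t::real. t ^ m)" by (intro smooth_on_power smooth_on_id)
      show "\<forall>\<^sub>F t in at (0::real). t ^ m \<noteq> 0" using eventually_at_0_nonzero by eventually_elim simp
    qed (use that in \<open>simp add: power_0_left\<close>)
    then show ?thesis by simp
  qed
  have "leading_flow (l * k) (\<lambda>t. \<Phi> (t ^ l)) X" "leading_flow (l * k) (\<lambda>t. \<Psi> (t ^ k)) Y"
    using power[OF \<Phi> leading_flowD(1)[OF \<Psi>]] power[OF \<Psi> leading_flowD(1)[OF \<Phi>]]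
    by (simp_all only: mult.commute[of l k])
  from leading_flow_compose[OF this] show ?thesis by blast
qed

lemma vector_field_scale:
  assumes "leading_flow k \<Phi> (\<lambda>p c. r *\<^sub>R X p c)" "X \<in> vector_fields A"
  shows "(\<lambda>p c. r *\<^sub>R X p c) \<in> vector_fields A"
proof (rule leading_flow_vector_field[OF assms(1)])
  fix c assume "c \<in> A"
  then show "smooth_on (chart_image c) (local_rep c (\<lambda>p c. r *\<^sub>R X p c))"
    using smooth_on_scaleR[OF smooth_on_const vector_fieldD(2)[OF assms(2)]] by (simp add: local_rep_def)
qed (use vector_fieldD(1)[OF assms(2)] in auto)

lemma vector_field_add:
  assumes "leading_flow k \<Phi> (\<lambda>p c. X p c + Y p c)" "X \<in> vector_fields A" "Y \<in> vector_fields A"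
  shows "(\<lambda>p c. X p c + Y p c) \<in> vector_fields A"
proof (rule leading_flow_vector_field[OF assms(1)])
  fix c assume "c \<in> A"
  then show "smooth_on (chart_image c) (local_rep c (\<lambda>p c. X p c + Y p c))"
    using smooth_on_add[OF vector_fieldD(2)[OF assms(2)] vector_fieldD(2)[OF assms(3)]]
    by (simp add: local_rep_def)
qed (use vector_fieldD(1)[OF assms(2)] vector_fieldD(1)[OF assms(3)] in auto)

lemma vector_field_bracket:
  assumes "leading_flow k \<Phi> (lie_bracket A X Y)" and X: "X \<in> vector_fields A" and Y: "Y \<in> vector_fields A"
  shows "lie_bracket A X Y \<in> vector_fields A"
proof (rule leading_flow_vector_field[OF assms(1)])
  fix c assume c: "c \<in> A"
  note XD = vector_fieldD(2)[OF X c] and YD = vector_fieldD(2)[OF Y c]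
  have "smooth_on (chart_image c) (\<lambda>x. frechet_derivative (local_rep c Y) (at x) (local_rep c X x)
      - frechet_derivative (local_rep c X) (at x) (local_rep c Y x))"
    by (intro smooth_on_diff smooth_on_dirderiv_comp XD YD chart(2) c)
  then show "smooth_on (chart_image c) (local_rep c (lie_bracket A X Y))"
    by (rule smooth_on_cong) (simp only: local_rep_def lie_bracket_def c chart(6,7)[OF c], simp)
qed (auto simp: lie_bracket_def)

text \<open>The factor from the change of time and the factorial between coefficient and derivative
  are both absorbed by scaling, so tangency becomes a statement on leading coefficients.\<close>

lemma tangent_fields_iff:
  "X \<in> tangent_fields A G \<longleftrightarrow> X \<in> vector_fields A \<and> (\<exists>k \<Phi>. leading_flow k \<Phi> X)"
proof
  assume "X \<in> tangent_fields A G"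
  then obtain I \<phi> where X: "X \<in> vector_fields A" and \<phi>: "integral_curve A I \<phi> X" "\<And>t. t \<in> I \<Longrightarrow> \<phi> t \<in> G"
    unfolding tangent_fields_def by blast
  obtain k \<Phi> r where "r \<noteq> 0" "leading_flow k \<Phi> (\<lambda>p c. r *\<^sub>R X p c)"
    using integral_curve_leading_flow[OF \<phi>] by blast
  with leading_flow_scale[OF this(2), of "inverse r"] X
  show "X \<in> vector_fields A \<and> (\<exists>k \<Phi>. leading_flow k \<Phi> X)" by simp
next
  assume "X \<in> vector_fields A \<and> (\<exists>k \<Phi>. leading_flow k \<Phi> X)"
  then obtain k \<Phi> where X: "X \<in> vector_fields A" and \<Phi>: "leading_flow k \<Phi> X" by blast
  \<comment> \<open>Dividing by k! in advance makes the k-th derivative equal to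
    \<open>X\<close>.\<close>
  obtain \<Phi>' where \<Phi>': "leading_flow k \<Phi>' (\<lambda>p c. inverse (fact k) *\<^sub>R X p c)"
    using leading_flow_scale_pos[OF \<Phi>, of "inverse (fact k)"] by auto
  have "integral_curve A UNIV \<Phi>' (\<lambda>p c. fact k *\<^sub>R inverse (fact k) *\<^sub>R X p c)"
    by (rule leading_flow_integral_curve[OF \<Phi>']) (use X in \<open>simp_all add: vector_field_scale[OF \<Phi>']\<close>)
  then show "X \<in> tangent_fields A G"
    unfolding tangent_fields_def using X leading_flowD(2)[OF \<Phi>'] by auto
qed

lemma lie_subalgebra_tangent_fields: "lie_subalgebra A (tangent_fields A G)"
  unfolding lie_subalgebra_def
proof (intro conjI ballI allI)
  show "tangent_fields A G \<subseteq> vector_fields A" unfolding tangent_fields_def by blast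
  show "(\<lambda>p c. 0) \<in> tangent_fields A G"
    unfolding tangent_fields_iff
    using leading_flow_zero leading_flow_vector_field[OF leading_flow_zero] smooth_on_const
    by (auto simp: local_rep_def)
  fix X assume "X \<in> tangent_fields A G"
  then obtain k \<Phi> where X: "X \<in> vector_fields A" and \<Phi>: "leading_flow k \<Phi> X"
    unfolding tangent_fields_iff by blast
  show "(\<lambda>p c. r *\<^sub>R X p c) \<in> tangent_fields A G" for r
    unfolding tangent_fields_iff using leading_flow_scale[OF \<Phi>] vector_field_scale X by blast
  fix Y assume "Y \<in> tangent_fields A G"
  then obtain l \<Psi> where Y: "Y \<in> vector_fields A" and \<Psi>: "leading_flow l \<Psi> Y"
    unfolding tangent_fields_iff by blast
  show "(\<lambda>p c. X p c + Y p c) \<in> tangent_fields A G"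
    unfolding tangent_fields_iff using leading_flow_add[OF \<Phi> \<Psi>] vector_field_add X Y by blast
  show "lie_bracket A X Y \<in> tangent_fields A G"
    unfolding tangent_fields_iff
    using leading_flow_commutator[OF \<Phi> \<Psi> X Y] vector_field_bracket X Y by blast
qed

end

theorem corollary3p6:
  fixes A :: "('a::{t2_space, second_countable_topology}, 'e::euclidean_space) chart set"
    and G :: "('a \<Rightarrow> 'a) set"
    and S :: "('a, 'e) vfield set"
  assumes "smooth_atlas A"
    and "compact (UNIV :: 'a set)"
    and "subgroup G (Diff_group A)"
    and "S \<subseteq> vector_fields A"
    and "S \<subseteq> tangent_fields A G"
  shows "lie_generated A S \<subseteq> tangent_fields A G"
proof -
  interpret diffeo_subgroup A G using assms(1-3) by (simp add: diffeo_subgroup_def compact_manifold_def diffeo_subgroup_axioms_def)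
  \<comment> \<open>\<open>lie_generated A S\<close> is an intersection over all subalgebras
    containing \<open>S\<close>, and \<open>tangent_fields A G\<close> is one of them.\<close>
  show ?thesis unfolding lie_generated_def using lie_subalgebra_tangent_fields assms(5) by blast
qed

end
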